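(* Let $L$ be a language (with relation symbols and set-valued function symbols) such that every function symbol $F\in L$ is unary. Then for every finite $L$-structure $\mathbf A$ there exists a finite, irreducible substructure faithful, coherent EPPA-witness $\mathbf B$ of $\mathbf A$. Consequently, every free amalgamation class $\mathcal K$ of finite $L$-structures has the coherent extension property for partial automorphisms, i.e. for every $\mathbf A\in\mathcal K$ there is $\mathbf B\in\mathcal K$ which is a coherent EPPA-witness of $\mathbf A$.
   Context: A language consists of relation symbols and function symbols, each with an arity; a function symbol is unary if its arity is $1$. An $L$-structure $\mathbf A$ has a vertex set $A$ (possibly empty), relations $R_{\mathbf A}\subseteq A^{\mathrm{arity}(R)}$, and set-valued functions $F_{\mathbf A}:A^{\mathrm{arity}(F)}\to\mathscr P(A)$ (power set). An embedding $f:\mathbf A\to\mathbf B$ is an injective map with $(x_1,\dots,x_a)\in R_{\mathbf A}\iff (f(x_1),\dots,f(x_a))\in R_{\mathbf B}$ and $f(F_{\mathbf A}(x_1,\dots,x_a))=F_{\mathbf B}(f(x_1),\dots,f(x_a))$ for all relation and function symbols. If it is an inclusion, $\mathbf A$ is a substructure of $\mathbf B$ (so substructures are closed under the functions). For embeddings $\alpha_i:\mathbf A\to\mathbf B_i$ ($i=1,2$), an amalgamation of $\mathbf B_1,\mathbf B_2$ over $\mathbf A$ is a structure $\mathbf C$ with embeddings $\beta_i:\mathbf B_i\to\mathbf C$ such that $\beta_1\alpha_1=\beta_2\alpha_2$. It is free if the images of $\beta_1,\beta_2$ cover $C$ and meet exactly in the image of $A$, and every tuple $\bar t$ containing vertices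 of both $\beta_1(B_1\setminus\alpha_1(A))$ and $\beta_2(B_2\setminus\alpha_2(A))$ is in no relation of $\mathbf C$ and has $F_{\mathbf C}(\bar t)=\emptyset$ for every function symbol $F$ of arity $|\bar t|$. A class of finite structures is a free amalgamation class if it is hereditary (closed under substructures), has the joint embedding property (any two members embed in a common member), and for all embeddings $\alpha_i:\mathbf A\to\mathbf B_i$ between members the free amalgamation of $\mathbf B_1,\mathbf B_2$ over $\mathbf A$ can be found in the class. An $L$-structure is irreducible if it cannot be created as a free amalgamation of any two of its proper substructures. A partial automorphism of $\mathbf A$ is an isomorphism $f:\mathbf D\to\mathbf E$ between substructures $\mathbf D,\mathbf E$ of $\mathbf A$. $\mathbf B$ is an EPPA-witness of $\mathbf A$ if $\mathbf A$ is a substructure of $\mathbf B$ and every partial automorphism of $\mathbf A$ extends to an automorphism of $\mathbf B$. An EPPA-witness $\mathbf B$ of $\mathbf A$ is irreducible substructure faithful if for every irreducible substructure $\mathbf C$ of $\mathbf B$ there is an automorphism $g$ of $\mathbf B$ with $g(C)\subseteq A$. A triple $(f,g,h)$ of partial bijections between subsets of a set is coherent if $\mathrm{Dom}(f)=\mathrm{Dom}(h)$, $\mathrm{Range}(f)=\mathrm{Dom}(g)$, $\mathrm{Range}(g)=\mathrm{Range}(h)$ and $h=g\circ f$. A map $\varphi$ between families of partial bijections is coherent if it sends each coherent triple $(f,g,h)$ to a coherent triple $(\varphi(f),\varphi(g),\varphi(h))$. An EPPA-witness $\mathbf B$ of $\mathbf A$ is coherent if every partial automorphism $f$ of $\mathbf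 A$ extends to some $\hat f\in\mathrm{Aut}(\mathbf B)$ in such a way that the map $f\mapsto\hat f$ from partial automorphisms of $\mathbf A$ to automorphisms of $\mathbf B$ is coherent. *)

theory Defs
  imports Main
begin

record ('r, 'f) language =
  rels :: "'r set"
  funs :: "'f set"
  rel_arity :: "'r \<Rightarrow> nat"
  fun_arity :: "'f \<Rightarrow> nat"

text \<open>Tuples are lists. Values of \<open>rel\<close> and \<open>fn\<close> at symbols outside the language, and of \<open>fn\<close> at
  lists that are not tuples of vertices of the right length, are irrelevant: no notion below
  depends on them.\<close>

record ('r, 'f, 'a) struct =
  verts :: "'a set"
  rel :: "'r \<Rightarrow> 'a list set"
  fn :: "'f \<Rightarrow> 'a list \<Rightarrow> 'a set"

definition tuples :: "'a set \<Rightarrow> nat \<Rightarrow> 'a list set" where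
  "tuples X n = {xs. set xs \<subseteq> X \<and> length xs = n}"

definition L_structure :: "('r, 'f) language \<Rightarrow> ('r, 'f, 'a) struct \<Rightarrow> bool" where
  "L_structure L A \<longleftrightarrow>
     (\<forall>R\<in>rels L. rel A R \<subseteq> tuples (verts A) (rel_arity L R)) \<and>
     (\<forall>F\<in>funs L. \<forall>xs\<in>tuples (verts A) (fun_arity L F). fn A F xs \<subseteq> verts A)"

definition finite_structure :: "('r, 'f) language \<Rightarrow> ('r, 'f, 'a) struct \<Rightarrow> bool" where
  "finite_structure L A \<longleftrightarrow> L_structure L A \<and> finite (verts A)"

definition embedding ::
  "('r, 'f) language \<Rightarrow> ('a \<Rightarrow> 'b) \<Rightarrow> ('r, 'f, 'a) struct \<Rightarrow> ('r, 'f, 'b) struct \<Rightarrow> bool" where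
  "embedding L f A B \<longleftrightarrow>
     L_structure L A \<and> L_structure L B \<and>
     f ` verts A \<subseteq> verts B \<and> inj_on f (verts A) \<and>
     (\<forall>R\<in>rels L. \<forall>xs\<in>tuples (verts A) (rel_arity L R). xs \<in> rel A R \<longleftrightarrow> map f xs \<in> rel B R) \<and>
     (\<forall>F\<in>funs L. \<forall>xs\<in>tuples (verts A) (fun_arity L F). f ` fn A F xs = fn B F (map f xs))"

definition substructure ::
  "('r, 'f) language \<Rightarrow> ('r, 'f, 'a) struct \<Rightarrow> ('r, 'f, 'a) struct \<Rightarrow> bool" where
  "substructure L A B \<longleftrightarrow> embedding L id A B"

definition proper_substructure ::
  "('r, 'f) language \<Rightarrow> ('r, 'f, 'a) struct \<Rightarrow> ('r, 'f, 'a) struct \<Rightarrow> bool" where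
  "proper_substructure L A B \<longleftrightarrow> substructure L A B \<and> verts A \<noteq> verts B"

definition amalgamation ::
  "('r, 'f) language \<Rightarrow> ('a \<Rightarrow> 'b) \<Rightarrow> ('a \<Rightarrow> 'c) \<Rightarrow> ('b \<Rightarrow> 'd) \<Rightarrow> ('c \<Rightarrow> 'd) \<Rightarrow>
   ('r, 'f, 'a) struct \<Rightarrow> ('r, 'f, 'b) struct \<Rightarrow> ('r, 'f, 'c) struct \<Rightarrow> ('r, 'f, 'd) struct \<Rightarrow> bool"
  where
  "amalgamation L \<alpha>1 \<alpha>2 \<beta>1 \<beta>2 A B1 B2 C \<longleftrightarrow>
     embedding L \<alpha>1 A B1 \<and> embedding L \<alpha>2 A B2 \<and>
     embedding L \<beta>1 B1 C \<and> embedding L \<beta>2 B2 C \<and>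
     (\<forall>x\<in>verts A. \<beta>1 (\<alpha>1 x) = \<beta>2 (\<alpha>2 x))"

definition free_amalgamation ::
  "('r, 'f) language \<Rightarrow> ('a \<Rightarrow> 'b) \<Rightarrow> ('a \<Rightarrow> 'c) \<Rightarrow> ('b \<Rightarrow> 'd) \<Rightarrow> ('c \<Rightarrow> 'd) \<Rightarrow>
   ('r, 'f, 'a) struct \<Rightarrow> ('r, 'f, 'b) struct \<Rightarrow> ('r, 'f, 'c) struct \<Rightarrow> ('r, 'f, 'd) struct \<Rightarrow> bool"
  where
  "free_amalgamation L \<alpha>1 \<alpha>2 \<beta>1 \<beta>2 A B1 B2 C \<longleftrightarrow>
     amalgamation L \<alpha>1 \<alpha>2 \<beta>1 \<beta>2 A B1 B2 C \<and>
     \<beta>1 ` verts B1 \<union> \<beta>2 ` verts B2 = verts C \<and>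
     \<beta>1 ` verts B1 \<inter> \<beta>2 ` verts B2 = \<beta>1 ` \<alpha>1 ` verts A \<and>
     (\<forall>xs. set xs \<subseteq> verts C \<and>
           set xs \<inter> \<beta>1 ` (verts B1 - \<alpha>1 ` verts A) \<noteq> {} \<and>
           set xs \<inter> \<beta>2 ` (verts B2 - \<alpha>2 ` verts A) \<noteq> {} \<longrightarrow>
         (\<forall>R\<in>rels L. xs \<notin> rel C R) \<and>
         (\<forall>F\<in>funs L. fun_arity L F = length xs \<longrightarrow> fn C F xs = {}))"

text \<open>The substructures \<open>B1\<close>, \<open>B2\<close> sit inside \<open>C\<close> by their inclusion maps. Allowing arbitrary
  embeddings into \<open>C\<close> instead would change nothing for finite \<open>C\<close>, but would make every infinite
  structure with a proper substructure isomorphic to itself reducible.\<close>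

definition irreducible :: "('r, 'f) language \<Rightarrow> ('r, 'f, 'a) struct \<Rightarrow> bool" where
  "irreducible L C \<longleftrightarrow>
     L_structure L C \<and>
     \<not> (\<exists>(A :: ('r, 'f, 'a) struct) B1 B2 \<alpha>1 \<alpha>2.
          proper_substructure L B1 C \<and> proper_substructure L B2 C \<and>
          free_amalgamation L \<alpha>1 \<alpha>2 id id A B1 B2 C)"

text \<open>A class of structures is represented by its members with vertices in a fixed type, which is
  taken to be infinite in the theorem so that every isomorphism type of finite structures occurs.
  Closure under isomorphism is the usual tacit convention for such classes.\<close>

definition free_amalgamation_class ::
  "('r, 'f) language \<Rightarrow> ('r, 'f, 'a) struct set \<Rightarrow> bool" where
  "free_amalgamation_class L K \<longleftrightarrow>
     (\<forall>A\<in>K. finite_structure L A) \<and>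
     (\<forall>A\<in>K. \<forall>B f. embedding L f A B \<and> f ` verts A = verts B \<longrightarrow> B \<in> K) \<and>
     (\<forall>B\<in>K. \<forall>A. substructure L A B \<longrightarrow> A \<in> K) \<and>
     (\<forall>A\<in>K. \<forall>B\<in>K. \<exists>C\<in>K. (\<exists>f. embedding L f A C) \<and> (\<exists>g. embedding L g B C)) \<and>
     (\<forall>A\<in>K. \<forall>B1\<in>K. \<forall>B2\<in>K. \<forall>\<alpha>1 \<alpha>2. embedding L \<alpha>1 A B1 \<and> embedding L \<alpha>2 A B2 \<longrightarrow>
        (\<exists>C\<in>K. \<exists>\<beta>1 \<beta>2. free_amalgamation L \<alpha>1 \<alpha>2 \<beta>1 \<beta>2 A B1 B2 C))"

text \<open>Partial bijections are partial functions \<open>'a \<rightharpoonup> 'a\<close>, so that domain, range, composition and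
  extension are \<open>dom\<close>, \<open>ran\<close>, \<open>\<circ>\<^sub>m\<close> and \<open>\<subseteq>\<^sub>m\<close>. Automorphisms are represented in the same way, with
  domain and range the whole vertex set.\<close>

definition partial_bijection :: "('a \<rightharpoonup> 'a) \<Rightarrow> bool" where
  "partial_bijection f \<longleftrightarrow> inj_on f (dom f)"

definition isomorphism ::
  "('r, 'f) language \<Rightarrow> ('a \<rightharpoonup> 'a) \<Rightarrow> ('r, 'f, 'a) struct \<Rightarrow> ('r, 'f, 'a) struct \<Rightarrow> bool" where
  "isomorphism L f D E \<longleftrightarrow>
     dom f = verts D \<and> ran f = verts E \<and> embedding L (\<lambda>x. the (f x)) D E"

definition partial_automorphism ::
  "('r, 'f) language \<Rightarrow> ('r, 'f, 'a) struct \<Rightarrow> ('a \<rightharpoonup> 'a) \<Rightarrow> bool" where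
  "partial_automorphism L A f \<longleftrightarrow>
     (\<exists>D E. substructure L D A \<and> substructure L E A \<and> isomorphism L f D E)"

definition automorphism ::
  "('r, 'f) language \<Rightarrow> ('r, 'f, 'a) struct \<Rightarrow> ('a \<rightharpoonup> 'a) \<Rightarrow> bool" where
  "automorphism L B g \<longleftrightarrow> isomorphism L g B B"

definition EPPA_witness ::
  "('r, 'f) language \<Rightarrow> ('r, 'f, 'a) struct \<Rightarrow> ('r, 'f, 'a) struct \<Rightarrow> bool" where
  "EPPA_witness L A B \<longleftrightarrow>
     substructure L A B \<and>
     (\<forall>f. partial_automorphism L A f \<longrightarrow> (\<exists>g. automorphism L B g \<and> f \<subseteq>\<^sub>m g))"

definition irreducible_substructure_faithful ::
  "('r, 'f) language \<Rightarrow> ('r, 'f, 'a) struct \<Rightarrow> ('r, 'f, 'a) struct \<Rightarrow> bool" where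
  "irreducible_substructure_faithful L A B \<longleftrightarrow>
     (\<forall>C. substructure L C B \<and> irreducible L C \<longrightarrow>
        (\<exists>g. automorphism L B g \<and> (\<lambda>x. the (g x)) ` verts C \<subseteq> verts A))"

definition coherent_triple :: "('a \<rightharpoonup> 'a) \<Rightarrow> ('a \<rightharpoonup> 'a) \<Rightarrow> ('a \<rightharpoonup> 'a) \<Rightarrow> bool" where
  "coherent_triple f g h \<longleftrightarrow>
     partial_bijection f \<and> partial_bijection g \<and> partial_bijection h \<and>
     dom f = dom h \<and> ran f = dom g \<and> ran g = ran h \<and> h = g \<circ>\<^sub>m f"

definition coherent_map :: "('a \<rightharpoonup> 'a) set \<Rightarrow> (('a \<rightharpoonup> 'a) \<Rightarrow> ('a \<rightharpoonup> 'a)) \<Rightarrow> bool" where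
  "coherent_map P \<phi> \<longleftrightarrow>
     (\<forall>f\<in>P. \<forall>g\<in>P. \<forall>h\<in>P. coherent_triple f g h \<longrightarrow> coherent_triple (\<phi> f) (\<phi> g) (\<phi> h))"

definition coherent_EPPA_witness ::
  "('r, 'f) language \<Rightarrow> ('r, 'f, 'a) struct \<Rightarrow> ('r, 'f, 'a) struct \<Rightarrow> bool" where
  "coherent_EPPA_witness L A B \<longleftrightarrow>
     EPPA_witness L A B \<and>
     (\<exists>\<phi>. (\<forall>f. partial_automorphism L A f \<longrightarrow> automorphism L B (\<phi> f) \<and> f \<subseteq>\<^sub>m \<phi> f) \<and>
          coherent_map {f. partial_automorphism L A f} \<phi>)"

definition coherent_EPPA_class ::
  "('r, 'f) language \<Rightarrow> ('r, 'f, 'a) struct set \<Rightarrow> bool" where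
  "coherent_EPPA_class L K \<longleftrightarrow> (\<forall>A\<in>K. \<exists>B\<in>K. coherent_EPPA_witness L A B)"

end

theory Submission
  imports Defs
begin

text \<open>Fix a finite structure \<open>A\<close> and let \<open>P\<close> be the set of its partial automorphisms. The existence of a
good witness is a statement about permutation groups. Suppose that a finite set \<open>Y\<close> containing the
vertices of \<open>A\<close> carries a group \<open>G\<close> of permutations such that every \<open>f \<in> P\<close> extends coherently to
some \<open>\<phi> f \<in> G\<close>, and such that, conversely, an element of \<open>G\<close> can only map vertices of \<open>A\<close> back into
\<open>A\<close> in the way in which some member of \<open>P\<close> does. This is the locale \<open>extension_system\<close>. Call the
sets \<open>g ` A\<close> with \<open>g \<in> G\<close> copies of \<open>A\<close>. Carrying the relations and functions of \<open>A\<close> to all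
copies yields a structure, \<open>glued\<close>, on the union of the copies, on which \<open>G\<close> acts by automorphisms.
Two more properties of \<open>G\<close> make it the required witness.

\<^item> If \<open>g \<in> G\<close> maps a vertex \<open>x\<close> of \<open>A\<close> to a vertex \<open>y\<close> of \<open>A\<close>, then it maps the closure of \<open>x\<close>
  under the functions onto the closure of \<open>y\<close> (\<open>closure_invariant\<close>). Then different copies agree on the
  values of the functions, every copy is a substructure, and \<open>A\<close> is one of them.

\<^item> A set of vertices any two of which lie in a common copy lies in one copy (\<open>conformal\<close>). This gives
  irreducible substructure faithfulness: in an irreducible structure with unary functions, any two
  vertices lie in the closure of a single vertex or in the closures of two members of a tuple of some
  relation (\<open>irreducible_connected\<close>). In the glued structure, both situations force the two vertices
  into a common copy.

The system is built in three steps, each of which enlarges the vertices of the previous one.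

\<^item> A vertex becomes a pair of some \<open>x \<in> A\<close> and a valuation, which has one bit for each pair of a list
  \<open>r\<close> through \<open>x\<close> and another list \<open>s\<close>. For a list of vertices over \<open>r\<close>, the sums of their bits at the
  pairs \<open>(r, s)\<close> are invariants, and for vertices of \<open>A\<close> these sums tell which lists \<open>s\<close> are images of
  \<open>r\<close> under partial automorphisms. Individual bits may be flipped as long as the sums are kept, and this freedom is
  enough to extend every partial automorphism (\<open>extension_system_vals\<close>).

\<^item> For every set \<open>U\<close> of vertices that lies in no copy, each vertex in \<open>U\<close> receives one of
  \<open>card U - 1\<close> labels, injectively inside every copy. A set projecting bijectively onto \<open>U\<close> then
  cannot have all its pairs in common copies, by the pigeonhole principle; this enforces conformality
  (\<open>lab_conformal\<close>).

\<^item> Finally a vertex \<open>g x\<close> is replaced by the pair of \<open>g x\<close> and the image under \<open>g\<close> of the closure of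
  \<open>x\<close>. This enforces \<open>closure_invariant\<close>, and it keeps conformality since the union of the closures
  of pairwise compatible vertices is again a set of pairwise compatible vertices
  (\<open>closure_conformal\<close>).

The extensions are coherent because every choice is made either by a factor that depends only on the
domain or only on the range of the partial automorphism, or by the canonical extension \<open>transport\<close> of a
partial injection.

For the second claim, a free amalgamation class contains every finite structure whose irreducible
substructures it contains, because a reducible structure is a free amalgam of smaller ones. By
faithfulness the irreducible substructures of the witness of \<open>A\<close> are isomorphic to substructures of
\<open>A\<close>.\<close>

section \<open>Coherent extension of partial injections\<close>

definition numbering :: "'b set \<Rightarrow> 'b \<Rightarrow> nat" where
  "numbering S = (SOME e. bij_betw e S {..<card S})"

lemma numbering_bij: "finite S \<Longrightarrow> bij_betw (numbering S) S {..<card S}"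
  unfolding numbering_def
  using someI_ex[of "\<lambda>e. bij_betw e S {..<card S}"] ex_bij_betw_finite_nat[of S]
  by (simp add: atLeast0LessThan)

text \<open>The permutation of \<open>M\<close> that maps \<open>a i\<close> to \<open>b i\<close> for \<open>i \<in> S\<close>. Off \<open>a ` S\<close> it matches the numberings
chosen once and for all for the two complements; since these depend only on the complements,
permutations built in this way compose (\<open>transport_trans\<close>), which is where coherence comes from.\<close>

definition transport :: "'b set \<Rightarrow> 'i set \<Rightarrow> ('i \<Rightarrow> 'b) \<Rightarrow> ('i \<Rightarrow> 'b) \<Rightarrow> 'b \<Rightarrow> 'b" where
  "transport M S a b m =
     (if m \<in> a ` S then b (inv_into S a m)
      else inv_into (M - b ` S) (numbering (M - b ` S)) (numbering (M - a ` S) m))"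

lemma transport_apply: "inj_on a S \<Longrightarrow> i \<in> S \<Longrightarrow> transport M S a b (a i) = b i"
  by (simp add: transport_def)

lemma transport_off:
  assumes "finite M" "inj_on a S" "inj_on b S" "a ` S \<subseteq> M" "b ` S \<subseteq> M"
  shows "bij_betw (transport M S a b) (M - a ` S) (M - b ` S)"
    and "m \<in> M - a ` S \<Longrightarrow> numbering (M - b ` S) (transport M S a b m) = numbering (M - a ` S) m"
proof -
  have "card (a ` S) = card (b ` S)" using assms by (simp add: card_image)
  then have c: "card (M - a ` S) = card (M - b ` S)"
    using assms by (simp add: card_Diff_subset finite_subset)
  have 1: "bij_betw (numbering (M - a ` S)) (M - a ` S) {..<card (M - b ` S)}"
    using numbering_bij[of "M - a ` S"] assms(1) c by simp
  have 2: "bij_betw (numbering (M - b ` S)) (M - b ` S) {..<card (M - b ` S)}"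
    using numbering_bij[of "M - b ` S"] assms(1) by simp
  have "bij_betw (inv_into (M - b ` S) (numbering (M - b ` S)) \<circ> numbering (M - a ` S)) (M - a ` S) (M - b ` S)"
    by (rule bij_betw_trans[OF 1 bij_betw_inv_into[OF 2]])
  then show "bij_betw (transport M S a b) (M - a ` S) (M - b ` S)"
    by (rule bij_betw_cong[THEN iffD1, rotated]) (auto simp: transport_def)
  show "numbering (M - b ` S) (transport M S a b m) = numbering (M - a ` S) m" if "m \<in> M - a ` S"
    using that bij_betw_inv_into_right[OF 2, of "numbering (M - a ` S) m"] bij_betwE[OF 1]
    by (simp add: transport_def)
qed

lemma transport_bij:
  assumes "finite M" "inj_on a S" "inj_on b S" "a ` S \<subseteq> M" "b ` S \<subseteq> M"
  shows "bij_betw (transport M S a b) M M"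
proof -
  have "bij_betw (b \<circ> inv_into S a) (a ` S) (b ` S)"
    using assms by (auto intro!: bij_betw_trans[of _ _ S] bij_betw_inv_into inj_on_imp_bij_betw)
  then have "bij_betw (transport M S a b) (a ` S) (b ` S)"
    by (rule bij_betw_cong[THEN iffD1, rotated]) (auto simp: transport_def)
  from bij_betw_combine[OF this transport_off(1)[OF assms]] show ?thesis
    using assms by (simp add: Un_absorb1)
qed

lemma transport_trans:
  assumes "finite M" "inj_on a S" "inj_on b S" "inj_on c S"
    and "a ` S \<subseteq> M" "b ` S \<subseteq> M" "c ` S \<subseteq> M" and "m \<in> M"
  shows "transport M S b c (transport M S a b m) = transport M S a c m"
proof (cases "m \<in> a ` S")
  case True
  then show ?thesis using assms by (auto simp: transport_apply)
next
  case False
  then have m: "m \<in> M - a ` S" using assms by simp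
  have n: "transport M S a b m \<in> M - b ` S"
    using bij_betwE[OF transport_off(1)[OF assms(1,2,3,5,6)]] m by blast
  then have "transport M S b c (transport M S a b m)
      = inv_into (M - c ` S) (numbering (M - c ` S)) (numbering (M - b ` S) (transport M S a b m))"
    by (subst transport_def) simp
  also have "\<dots> = transport M S a c m"
    using m transport_off(2)[OF assms(1,2,3,5,6) m] by (simp add: transport_def)
  finally show ?thesis .
qed

lemma transport_reindex:
  assumes "inj_on f S" "inj_on a (f ` S)"
  shows "transport M (f ` S) a b = transport M S (a \<circ> f) (b \<circ> f)"
proof
  fix m
  have "inj_on (a \<circ> f) S" using assms by (rule comp_inj_on)
  then show "transport M (f ` S) a b m = transport M S (a \<circ> f) (b \<circ> f) m"
  proof (cases "m \<in> a ` f ` S")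
    case True
    then obtain i where i: "i \<in> S" "m = a (f i)" by blast
    then show ?thesis
      using transport_apply[OF assms(2), of "f i" M b]
        transport_apply[OF \<open>inj_on (a \<circ> f) S\<close> i(1), of M "b \<circ> f"] by simp
  qed (simp add: transport_def image_comp)
qed

lemma transport_cong:
  assumes "\<And>i. i \<in> S \<Longrightarrow> a i = a' i" "\<And>i. i \<in> S \<Longrightarrow> b i = b' i" "inj_on a S"
  shows "transport M S a b = transport M S a' b'"
proof
  fix m
  have im: "a ` S = a' ` S" "b ` S = b' ` S" using assms by (auto intro!: image_cong)
  have "inj_on a' S" using assms inj_on_cong by metis
  then show "transport M S a b m = transport M S a' b' m"
  proof (cases "m \<in> a ` S")
    case True
    then obtain i where i: "i \<in> S" "m = a i" by blast
    then show ?thesis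
      using transport_apply[OF assms(3) i(1), of M b] transport_apply[OF \<open>inj_on a' S\<close> i(1), of M b']
        assms(1,2)[OF i(1)] by simp
  qed (simp add: transport_def im)
qed

section \<open>Extension systems\<close>

text \<open>What the construction needs to know about the partial automorphisms of a structure on \<open>A\<close>. The
identity and the inverses are only required up to extension.\<close>

locale partial_bijections =
  fixes A :: "'a set" and P :: "('a \<rightharpoonup> 'a) set"
  assumes finite_A: "finite A"
    and P_dom: "f \<in> P \<Longrightarrow> dom f \<subseteq> A"
    and P_ran: "f \<in> P \<Longrightarrow> ran f \<subseteq> A"
    and P_inj: "f \<in> P \<Longrightarrow> f x = Some z \<Longrightarrow> f y = Some z \<Longrightarrow> x = y"
    and P_id: "\<exists>i\<in>P. \<forall>x\<in>A. i x = Some x"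
    and P_comp: "f \<in> P \<Longrightarrow> g \<in> P \<Longrightarrow> g \<circ>\<^sub>m f \<in> P"
    and P_inv: "f \<in> P \<Longrightarrow> \<exists>k\<in>P. \<forall>x y. f x = Some y \<longrightarrow> k y = Some x"
begin

lemma P_image: "(\<lambda>x. the (f x)) ` dom f = ran f"
proof -
  have "(\<exists>x\<in>dom f. z = the (f x)) \<longleftrightarrow> (\<exists>x. f x = Some z)" for z
    by (auto simp: dom_def)
  then show ?thesis by (auto simp: ran_def image_iff)
qed

lemma P_inj_on: "f \<in> P \<Longrightarrow> inj_on (\<lambda>x. the (f x)) (dom f)"
  using P_inj by (auto simp: inj_on_def)

end

text \<open>The set \<open>X\<close> contains a copy of \<open>A\<close> by way of \<open>\<iota>\<close>. The axiom \<open>\<phi>_coherent\<close> spells out coherent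
triples, and \<open>G_restrict\<close> says that \<open>G\<close> induces nothing on \<open>A\<close> that is not induced by \<open>P\<close>. Elements of
\<open>G\<close> are total functions on the type of \<open>X\<close> whose values outside \<open>X\<close> are arbitrary, so inverses are
only required on \<open>X\<close>.\<close>

locale extension_system = partial_bijections A P
  for A :: "'a set" and P :: "('a \<rightharpoonup> 'a) set" +
  fixes X :: "'x set" and \<iota> :: "'a \<Rightarrow> 'x" and G :: "('x \<Rightarrow> 'x) set"
    and \<phi> :: "('a \<rightharpoonup> 'a) \<Rightarrow> 'x \<Rightarrow> 'x"
  assumes finite_X: "finite X"
    and \<iota>_inj: "inj_on \<iota> A"
    and \<iota>_in: "x \<in> A \<Longrightarrow> \<iota> x \<in> X"
    and G_bij: "g \<in> G \<Longrightarrow> bij_betw g X X"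
    and G_id: "id \<in> G"
    and G_comp: "g \<in> G \<Longrightarrow> h \<in> G \<Longrightarrow> g \<circ> h \<in> G"
    and G_inv: "g \<in> G \<Longrightarrow> \<exists>k\<in>G. \<forall>v\<in>X. k (g v) = v"
    and \<phi>_in: "f \<in> P \<Longrightarrow> \<phi> f \<in> G"
    and \<phi>_extends: "f \<in> P \<Longrightarrow> f x = Some y \<Longrightarrow> \<phi> f (\<iota> x) = \<iota> y"
    and \<phi>_coherent: "e \<in> P \<Longrightarrow> f \<in> P \<Longrightarrow> f \<circ>\<^sub>m e \<in> P \<Longrightarrow> dom e = dom (f \<circ>\<^sub>m e) \<Longrightarrow>
        ran e = dom f \<Longrightarrow> ran f = ran (f \<circ>\<^sub>m e) \<Longrightarrow> v \<in> X \<Longrightarrow> \<phi> f (\<phi> e v) = \<phi> (f \<circ>\<^sub>m e) v"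
    and G_restrict: "g \<in> G \<Longrightarrow> \<exists>f\<in>P. \<forall>x\<in>A. \<forall>y\<in>A. g (\<iota> x) = \<iota> y \<longrightarrow> f x = Some y"
begin

lemma G_in: "g \<in> G \<Longrightarrow> v \<in> X \<Longrightarrow> g v \<in> X"
  using G_bij by (auto simp: bij_betw_def)

lemma G_inj: "g \<in> G \<Longrightarrow> v \<in> X \<Longrightarrow> w \<in> X \<Longrightarrow> g v = g w \<Longrightarrow> v = w"
  using G_bij by (auto simp: bij_betw_def inj_on_def)

lemma G_inverse:
  assumes "g \<in> G"
  obtains k where "k \<in> G" "\<And>v. v \<in> X \<Longrightarrow> k (g v) = v" "\<And>v. v \<in> X \<Longrightarrow> g (k v) = v"
proof -
  obtain k where k: "k \<in> G" "\<forall>v\<in>X. k (g v) = v" using G_inv assms by blast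
  have "g (k v) = v" if "v \<in> X" for v
  proof -
    have "g ` X = X" using G_bij[OF assms] by (simp add: bij_betw_def)
    then obtain w where w: "w \<in> X" "v = g w" using \<open>v \<in> X\<close> by (metis imageE)
    then have "k v = w" using k(2) by simp
    then show ?thesis using w(2) by simp
  qed
  with k show thesis by (intro that[of k]) auto
qed

end

definition conformal :: "'a set \<Rightarrow> 'x set \<Rightarrow> ('a \<Rightarrow> 'x) \<Rightarrow> ('x \<Rightarrow> 'x) set \<Rightarrow> bool" where
  "conformal A X \<iota> G \<longleftrightarrow>
     (\<forall>C\<subseteq>X. (\<forall>v\<in>C. \<forall>w\<in>C. \<exists>g\<in>G. v \<in> g ` \<iota> ` A \<and> w \<in> g ` \<iota> ` A) \<longrightarrow>
        (\<exists>g\<in>G. C \<subseteq> g ` \<iota> ` A))"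

section \<open>Valuations: a first extension system\<close>

type_synonym 'a val_vertex = "'a \<times> ('a list \<times> 'a list \<Rightarrow> bool)"

lemma (in partial_bijections) finite_distinct_lists: "finite {r. distinct r \<and> set r \<subseteq> A}"
proof -
  have "{r. distinct r \<and> set r \<subseteq> A} \<subseteq> {r. set r \<subseteq> A \<and> length r \<le> card A}"
    using finite_A by (auto simp: distinct_card[symmetric] card_mono)
  then show ?thesis using finite_lists_length_le[OF finite_A] finite_subset by blast
qed

context partial_bijections
begin

text \<open>Lists in the same orbit of \<open>P\<close>. For the partial automorphisms of a structure this says that the two
lists satisfy the same relations and generate isomorphic substructures in the same way.\<close>

definition similar :: "'a list \<Rightarrow> 'a list \<Rightarrow> bool" where
  "similar r s \<longleftrightarrow> (\<exists>f\<in>P. map f r = map Some s)"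

lemma similar_refl: "set r \<subseteq> A \<Longrightarrow> similar r r"
proof -
  assume r: "set r \<subseteq> A"
  obtain i where "i \<in> P" "\<forall>x\<in>A. i x = Some x" using P_id by blast
  moreover from this r have "map i r = map Some r" by (simp add: subset_iff)
  ultimately show ?thesis by (auto simp: similar_def)
qed

lemma similar_trans: "similar r s \<Longrightarrow> similar s u \<Longrightarrow> similar r u"
proof -
  assume "similar r s" "similar s u"
  then obtain f g where f: "f \<in> P" "map f r = map Some s" and g: "g \<in> P" "map g s = map Some u"
    by (auto simp: similar_def)
  have "map (g \<circ>\<^sub>m f) r = map Some u"
  proof (rule nth_equalityI)
    show "length (map (g \<circ>\<^sub>m f) r) = length (map Some u)"
      using f g by (metis length_map)
    fix i assume "i < length (map (g \<circ>\<^sub>m f) r)"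
    then have i: "i < length r" "i < length s" "i < length u"
      using f(2) g(2) by (metis length_map)+
    have "f (r ! i) = Some (s ! i)" "g (s ! i) = Some (u ! i)"
      using f(2) g(2) i by (metis nth_map)+
    then show "map (g \<circ>\<^sub>m f) r ! i = map Some u ! i" using i by simp
  qed
  then show ?thesis using P_comp[OF f(1) g(1)] by (auto simp: similar_def)
qed

lemma similar_sym: "similar r s \<Longrightarrow> similar s r"
proof -
  assume "similar r s"
  then obtain f where f: "f \<in> P" "map f r = map Some s" by (auto simp: similar_def)
  obtain k where k: "k \<in> P" "\<forall>x y. f x = Some y \<longrightarrow> k y = Some x" using P_inv f by blast
  have "map k s = map Some r"
  proof (rule nth_equalityI)
    show "length (map k s) = length (map Some r)" using f by (metis length_map)
    fix i assume "i < length (map k s)"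
    then have i: "i < length r" "i < length s" using f(2) by (metis length_map)+
    have "f (r ! i) = Some (s ! i)" using f(2) i by (metis nth_map)
    then show "map k s ! i = map Some r ! i" using i k by simp
  qed
  then show ?thesis using k(1) by (auto simp: similar_def)
qed

text \<open>An index \<open>(r, s)\<close> stands for the question whether \<open>r\<close> is similar to \<open>s\<close>. The first component is moved
by permutations of \<open>A\<close>, while the second is a fixed name of an orbit of lists.\<close>

definition indices :: "('a list \<times> 'a list) set" where
  "indices = {r. distinct r \<and> set r \<subseteq> A} \<times> {s. distinct s \<and> set s \<subseteq> A}"

lemma finite_indices: "finite indices"
  by (simp add: indices_def finite_distinct_lists)

definition vals :: "('a val_vertex) set" where
  "vals = {(x, \<chi>). x \<in> A \<and> (\<forall>r s. \<chi> (r, s) \<longrightarrow> (r, s) \<in> indices \<and> x \<in> set r)}"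

lemma finite_vals: "finite vals"
proof -
  have "finite {\<chi>. \<forall>i. (i \<in> indices \<longrightarrow> \<chi> i \<in> (UNIV :: bool set)) \<and> (i \<notin> indices \<longrightarrow> \<chi> i = False)}"
    by (rule finite_set_of_finite_funs[OF finite_indices]) simp
  then have "finite (A \<times> {\<chi>. \<forall>i. (i \<in> indices \<longrightarrow> \<chi> i \<in> (UNIV :: bool set)) \<and>
      (i \<notin> indices \<longrightarrow> \<chi> i = False)})"
    using finite_A by simp
  then show ?thesis by (rule rev_finite_subset) (auto simp: vals_def)
qed

text \<open>Only the head of \<open>r\<close> carries the answer to the question \<open>(r, s)\<close>, so the sum of the bits over the
members of \<open>r\<close> is that answer.\<close>

definition val_of :: "'a \<Rightarrow> 'a val_vertex" where
  "val_of x = (x, \<lambda>(r, s). (r, s) \<in> indices \<and> r \<noteq> [] \<and> x = hd r \<and> similar r s)"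

text \<open>For vertices over pairwise distinct elements of \<open>A\<close>, the parities of their bits at the list that they
lie over; otherwise \<open>None\<close>, so that the symmetries preserve distinctness of the projections too.\<close>

definition invariant :: "('a val_vertex) list \<Rightarrow> ('a list \<Rightarrow> bool) option" where
  "invariant vs = (if distinct (map fst vs)
     then Some (\<lambda>s. odd (length (filter (\<lambda>v. snd v (map fst vs, s)) vs))) else None)"

definition val_sym :: "('a val_vertex \<Rightarrow> 'a val_vertex) set"
  where "val_sym = {g. bij_betw g vals vals \<and>
     (\<forall>vs. set vs \<subseteq> vals \<longrightarrow> invariant (map g vs) = invariant vs)}"

lemma val_of_in: "x \<in> A \<Longrightarrow> val_of x \<in> vals"
  by (auto simp: vals_def val_of_def)

lemma val_sym_comp:
  assumes "g \<in> val_sym" "h \<in> val_sym" shows "g \<circ> h \<in> val_sym"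
proof -
  have g: "bij_betw g vals vals" "\<And>vs. set vs \<subseteq> vals \<Longrightarrow> invariant (map g vs) = invariant vs"
    and h: "bij_betw h vals vals" "\<And>vs. set vs \<subseteq> vals \<Longrightarrow> invariant (map h vs) = invariant vs"
    using assms by (auto simp: val_sym_def)
  have "invariant (map (g \<circ> h) vs) = invariant vs" if vs: "set vs \<subseteq> vals" for vs
  proof -
    have "set (map h vs) \<subseteq> vals" using vs h(1) by (auto simp: bij_betw_def)
    from g(2)[OF this] h(2)[OF vs] show ?thesis by simp
  qed
  then show ?thesis using bij_betw_trans[OF h(1) g(1)] by (simp add: val_sym_def)
qed

lemma val_sym_inv:
  assumes "g \<in> val_sym" shows "\<exists>k\<in>val_sym. \<forall>v\<in>vals. k (g v) = v"
proof
  have g: "bij_betw g vals vals" "\<And>vs. set vs \<subseteq> vals \<Longrightarrow> invariant (map g vs) = invariant vs"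
    using assms by (auto simp: val_sym_def)
  let ?k = "inv_into vals g"
  have k: "bij_betw ?k vals vals" using g(1) by (rule bij_betw_inv_into)
  have "invariant (map ?k vs) = invariant vs" if vs: "set vs \<subseteq> vals" for vs
  proof -
    have "set (map ?k vs) \<subseteq> vals" using vs k by (auto simp: bij_betw_def)
    moreover have "map g (map ?k vs) = vs"
      using vs bij_betw_inv_into_right[OF g(1)] by (auto intro!: map_idI)
    ultimately show ?thesis using g(2)[of "map ?k vs"] by simp
  qed
  then show "?k \<in> val_sym" using k by (simp add: val_sym_def)
  show "\<forall>v\<in>vals. ?k (g v) = v" using bij_betw_inv_into_left[OF g(1)] by blast
qed

lemma invariant_val_of:
  assumes "distinct r" "set r \<subseteq> A" "r \<noteq> []"
  shows "invariant (map val_of r)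
      = Some (\<lambda>s. distinct s \<and> set s \<subseteq> A \<and> similar r s)"
proof -
  have m: "map fst (map val_of r) = r" by (simp add: val_of_def comp_def)
  have "odd (length (filter (\<lambda>v. snd v (r, s)) (map val_of r)))
      \<longleftrightarrow> distinct s \<and> set s \<subseteq> A \<and> similar r s" for s
  proof -
    let ?t = "distinct s \<and> set s \<subseteq> A \<and> similar r s"
    have "filter (\<lambda>v. snd v (r, s)) (map val_of r) = map val_of (filter (\<lambda>x. x = hd r \<and> ?t) r)"
      using assms by (auto simp: filter_map comp_def val_of_def indices_def conj_ac intro!: filter_cong)
    moreover have "filter (\<lambda>x. x = hd r \<and> ?t) r = (if ?t then [hd r] else [])"
    proof (cases r)
      case (Cons a r')
      then have "filter (\<lambda>x. x = a \<and> ?t) r' = []"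
        using assms by (auto simp: filter_empty_conv)
      then show ?thesis using Cons by auto
    qed (use assms in simp)
    ultimately show ?thesis by simp
  qed
  then show ?thesis using assms(1) unfolding invariant_def m by simp
qed

text \<open>Let \<open>r\<close> list the vertices of \<open>A\<close> that \<open>g\<close> sends back into \<open>A\<close>, and let \<open>s\<close> be the list of their images.
The invariant of \<open>r\<close> records which lists are similar to \<open>r\<close>, and it equals that of \<open>s\<close>; as \<open>s\<close> is similar
to itself, \<open>r\<close> is similar to \<open>s\<close>.\<close>

lemma val_sym_restrict:
  assumes "g \<in> val_sym"
  shows "\<exists>f\<in>P. \<forall>x\<in>A. \<forall>y\<in>A. g (val_of x) = val_of y \<longrightarrow> f x = Some y"
proof -
  let ?D = "{x \<in> A. g (val_of x) \<in> val_of ` A}"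
  have "finite ?D" using finite_A by simp
  then obtain r where r: "set r = ?D" "distinct r"
    using finite_distinct_list[of ?D] by auto
  define s where "s = map (\<lambda>x. fst (g (val_of x))) r"
  have gx: "g (val_of x) = val_of (fst (g (val_of x)))" if "x \<in> ?D" for x
    using that by (auto simp: val_of_def)
  have gr: "map g (map val_of r) = map val_of s"
    unfolding s_def by (simp add: r(1)[symmetric]) (use gx r(1) in blast)
  have "similar r s"
  proof (cases "r = []")
    case True then show ?thesis by (simp add: s_def similar_refl)
  next
    case False
    have rA: "set r \<subseteq> A" using r by auto
    have sA: "set s \<subseteq> A" using r by (auto simp: s_def val_of_def)
    have "invariant (map val_of s) = invariant (map val_of r)"
    proof -
      have "set (map val_of r) \<subseteq> vals" using rA val_of_in by auto
      then show ?thesis using assms gr unfolding val_sym_def by (metis (mono_tags, lifting) mem_Collect_eq)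
    qed
    also have "\<dots> = Some (\<lambda>s. distinct s \<and> set s \<subseteq> A \<and> similar r s)"
      using invariant_val_of[OF r(2) rA False] .
    finally have *: "invariant (map val_of s) = Some (\<lambda>s. distinct s \<and> set s \<subseteq> A \<and> similar r s)" .
    then have ds: "distinct s"
      by (auto simp: invariant_def val_of_def comp_def split: if_splits)
    have "s \<noteq> []" using False by (simp add: s_def)
    then have "(\<lambda>u. distinct u \<and> set u \<subseteq> A \<and> similar s u) = (\<lambda>u. distinct u \<and> set u \<subseteq> A \<and> similar r u)"
      using * invariant_val_of[OF ds sA] by simp
    then have "similar s s \<longrightarrow> similar r s" using ds sA by metis
    then show ?thesis using similar_refl[OF sA] by blast
  qed
  then obtain f where f: "f \<in> P" "map f r = map Some s" by (auto simp: similar_def)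
  have "f x = Some y" if "x \<in> A" "y \<in> A" "g (val_of x) = val_of y" for x y
  proof -
    have "x \<in> set r" using that r by auto
    then have "f x = Some (fst (g (val_of x)))" using f(2) by (auto simp: s_def)
    then show ?thesis using that by (simp add: val_of_def)
  qed
  then show ?thesis using f(1) by blast
qed

definition relabel :: "('a \<Rightarrow> 'a) \<Rightarrow> 'a val_vertex \<Rightarrow> 'a val_vertex"
  where "relabel \<pi> v = (\<pi> (fst v),
     \<lambda>(r, s). (r, s) \<in> indices \<and> snd v (map (inv_into A \<pi>) r, s))"

text \<open>For a list \<open>r\<close> that starts in \<open>D\<close> but leaves it, move the answer to \<open>(r, s)\<close> from the head of \<open>r\<close> to
the first member of \<open>r\<close> outside \<open>D\<close>. Afterwards the valuations of the elements of \<open>D\<close> contain only the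
answers for lists inside \<open>D\<close>, and these are the ones that a partial automorphism with domain \<open>D\<close>
preserves. Two bits are flipped, so parities do not change.\<close>

definition flips :: "'a set \<Rightarrow> 'a list \<Rightarrow> 'a list \<Rightarrow> 'a \<Rightarrow> bool" where
  "flips D r s x \<longleftrightarrow> (r, s) \<in> indices \<and> \<not> set r \<subseteq> D \<and> hd r \<in> D \<and> similar r s \<and>
     (x = hd r \<or> x = hd (filter (\<lambda>y. y \<notin> D) r))"

definition flip :: "'a set \<Rightarrow> 'a val_vertex \<Rightarrow> 'a val_vertex"
  where "flip D v = (fst v, \<lambda>(r, s). snd v (r, s) \<noteq> flips D r s (fst v))"

lemma hd_filter_in: "\<not> set r \<subseteq> D \<Longrightarrow> hd (filter (\<lambda>y. y \<notin> D) r) \<in> set r - D"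
proof -
  assume "\<not> set r \<subseteq> D"
  then have "filter (\<lambda>y. y \<notin> D) r \<noteq> []" by (auto simp: filter_empty_conv)
  then have "hd (filter (\<lambda>y. y \<notin> D) r) \<in> set (filter (\<lambda>y. y \<notin> D) r)" by (rule hd_in_set)
  then show ?thesis by simp
qed

lemma flips_in: "flips D r s x \<Longrightarrow> x \<in> set r"
proof -
  assume f: "flips D r s x"
  then have "\<not> set r \<subseteq> D" by (simp add: flips_def)
  moreover from this have "hd r \<in> set r" by (cases r) auto
  ultimately show ?thesis using f hd_filter_in[of r D] by (auto simp: flips_def)
qed

lemma flip_flip: "flip D (flip D v) = v"
  by (cases v) (auto simp: flip_def fun_eq_iff)

lemma odd_filter_xor:
  "odd (length (filter (\<lambda>x. p x \<noteq> q x) xs))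
     \<longleftrightarrow> odd (length (filter p xs)) \<noteq> odd (length (filter q xs))"
  by (induction xs) auto

lemma length_filter_pair:
  "distinct r \<Longrightarrow> a \<in> set r \<Longrightarrow> b \<in> set r \<Longrightarrow> a \<noteq> b \<Longrightarrow>
     length (filter (\<lambda>x. x = a \<or> x = b) r) = 2"
proof -
  assume *: "distinct r" "a \<in> set r" "b \<in> set r" "a \<noteq> b"
  have "length (filter (\<lambda>x. x = a \<or> x = b) r) = card (set (filter (\<lambda>x. x = a \<or> x = b) r))"
    using * distinct_card[OF distinct_filter[of r]] by metis
  also have "set (filter (\<lambda>x. x = a \<or> x = b) r) = {a, b}" using * by auto
  finally show ?thesis using * by simp
qed

lemma even_flips: "distinct r \<Longrightarrow> even (length (filter (flips D r s) r))"
proof (cases "(r, s) \<in> indices \<and> \<not> set r \<subseteq> D \<and> hd r \<in> D \<and> similar r s")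
  case True
  assume r: "distinct r"
  have h: "hd r \<in> set r" using True by (cases r) auto
  have "filter (flips D r s) r = filter (\<lambda>x. x = hd r \<or> x = hd (filter (\<lambda>y. y \<notin> D) r)) r"
    using True by (auto simp: flips_def intro!: filter_cong)
  moreover have "hd (filter (\<lambda>y. y \<notin> D) r) \<in> set r - D" using True by (intro hd_filter_in) simp
  ultimately show ?thesis using length_filter_pair[OF r h] True by fastforce
next
  case False
  then have "filter (flips D r s) r = []" by (auto simp: flips_def filter_empty_conv)
  then show ?thesis by simp
qed

lemma flip_sym: "flip D \<in> val_sym"
proof -
  have maps: "flip D v \<in> vals" if "v \<in> vals" for v
  proof -
    have "(r, s) \<in> indices \<and> x \<in> set r" if "flips D r s x" for r s x
      using that flips_in[OF that] by (simp add: flips_def)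
    then show ?thesis using that by (cases v) (auto simp: vals_def flip_def)
  qed
  have "bij_betw (flip D) vals vals"
    using maps by (intro bij_betw_byWitness[of _ "flip D"]) (auto simp: flip_flip)
  moreover have "invariant (map (flip D) vs) = invariant vs" for vs
  proof -
    have m: "map fst (map (flip D) vs) = map fst vs" by (simp add: flip_def comp_def)
    let ?r = "map fst vs"
    have "odd (length (filter (\<lambda>v. snd v (?r, s)) (map (flip D) vs)))
        = odd (length (filter (\<lambda>v. snd v (?r, s)) vs))" if d: "distinct ?r" for s
    proof -
      have 1: "length (filter (\<lambda>v. snd v (?r, s)) (map (flip D) vs))
          = length (filter (\<lambda>v. snd v (?r, s) \<noteq> flips D ?r s (fst v)) vs)"
        by (simp add: filter_map comp_def flip_def)
      have "length (filter (flips D ?r s) ?r) = length (filter (\<lambda>v. flips D ?r s (fst v)) vs)"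
        by (simp add: filter_map comp_def)
      then have 2: "even (length (filter (\<lambda>v. flips D ?r s (fst v)) vs))"
        using even_flips[OF d, of D s] by (simp only:)
      show ?thesis
        unfolding 1 using odd_filter_xor[of "\<lambda>v. snd v (?r, s)" "\<lambda>v. flips D ?r s (fst v)" vs] 2
        by blast
    qed
    then show ?thesis unfolding invariant_def m by simp
  qed
  ultimately show ?thesis by (simp add: val_sym_def)
qed

lemma inv_map_map: "bij_betw \<pi> A A \<Longrightarrow> set r \<subseteq> A \<Longrightarrow> map (inv_into A \<pi>) (map \<pi> r) = r"
  by (auto intro!: map_idI simp: bij_betw_inv_into_left)

lemma indices_map: "bij_betw \<pi> A A \<Longrightarrow> (r, s) \<in> indices \<Longrightarrow> (map \<pi> r, s) \<in> indices"
proof -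
  assume \<pi>: "bij_betw \<pi> A A" and rs: "(r, s) \<in> indices"
  have r: "set r \<subseteq> A" "distinct r" using rs by (auto simp: indices_def)
  have "\<pi> ` set r \<subseteq> A" using r(1) bij_betwE[OF \<pi>] by blast
  moreover have "inj_on \<pi> (set r)"
    using \<pi> r(1) unfolding bij_betw_def by (blast intro: inj_on_subset)
  ultimately show ?thesis using rs r by (simp add: indices_def distinct_map)
qed

lemma relabel_in: "bij_betw \<pi> A A \<Longrightarrow> v \<in> vals \<Longrightarrow> relabel \<pi> v \<in> vals"
proof -
  assume \<pi>: "bij_betw \<pi> A A" and v: "v \<in> vals"
  have "\<pi> (fst v) \<in> set r" if "(r, s) \<in> indices" "snd v (map (inv_into A \<pi>) r, s)" for r s
  proof -
    have "fst v \<in> set r'" if "snd v (r', s')" for r' s'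
      using v that by (cases v) (auto simp: vals_def)
    from this[OF that(2)] obtain y where "y \<in> set r" "fst v = inv_into A \<pi> y" by auto
    then show ?thesis using that bij_betw_inv_into_right[OF \<pi>] by (auto simp: indices_def)
  qed
  then show ?thesis using v \<pi> by (auto simp: vals_def relabel_def bij_betwE)
qed

lemma relabel_apply:
  assumes "bij_betw \<pi> A A" "(r, s) \<in> indices"
  shows "snd (relabel \<pi> v) (map \<pi> r, s) = snd v (r, s)"
  using inv_map_map[OF assms(1)] indices_map[OF assms] assms(2)
  by (auto simp: relabel_def indices_def simp del: map_map)

lemma vals_eqI:
  assumes "v \<in> vals" "w \<in> vals" "fst v = fst w"
    and "\<And>r s. (r, s) \<in> indices \<Longrightarrow> snd v (r, s) = snd w (r, s)"
  shows "v = w"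
  using assms by (cases v; cases w) (auto simp: vals_def fun_eq_iff)

lemma indices_map_obtain:
  assumes "bij_betw \<pi> A A" "(r, s) \<in> indices"
  obtains r' where "(r', s) \<in> indices" "r = map \<pi> r'"
proof
  have i: "bij_betw (inv_into A \<pi>) A A" using assms(1) by (rule bij_betw_inv_into)
  show "(map (inv_into A \<pi>) r, s) \<in> indices" using indices_map[OF i assms(2)] .
  show "r = map \<pi> (map (inv_into A \<pi>) r)"
    using assms by (auto simp: indices_def bij_betw_inv_into_right intro!: map_idI[symmetric])
qed

lemma relabel_comp:
  assumes "bij_betw \<pi> A A" "bij_betw \<rho> A A" "bij_betw \<sigma> A A" "v \<in> vals"
    and "\<And>x. x \<in> A \<Longrightarrow> \<rho> (\<pi> x) = \<sigma> x"
  shows "relabel \<rho> (relabel \<pi> v) = relabel \<sigma> v"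
proof (rule vals_eqI)
  show "relabel \<rho> (relabel \<pi> v) \<in> vals" "relabel \<sigma> v \<in> vals"
    using assms relabel_in by auto
  show "fst (relabel \<rho> (relabel \<pi> v)) = fst (relabel \<sigma> v)"
    using assms by (auto simp: relabel_def vals_def)
  fix r s assume "(r, s) \<in> indices"
  then obtain r' where r': "(r', s) \<in> indices" "r = map \<sigma> r'"
    using assms(3) indices_map_obtain by blast
  have "r = map \<rho> (map \<pi> r')" using r' assms(5) by (auto simp: indices_def)
  then have "snd (relabel \<rho> (relabel \<pi> v)) (r, s) = snd (relabel \<pi> v) (map \<pi> r', s)"
    using relabel_apply[OF assms(2) indices_map[OF assms(1) r'(1)]] by simp
  also have "\<dots> = snd v (r', s)" using relabel_apply[OF assms(1) r'(1)] .
  also have "\<dots> = snd (relabel \<sigma> v) (r, s)"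
    using relabel_apply[OF assms(3) r'(1)] r'(2) by simp
  finally show "snd (relabel \<rho> (relabel \<pi> v)) (r, s) = snd (relabel \<sigma> v) (r, s)" .
qed

lemma relabel_id: "v \<in> vals \<Longrightarrow> bij_betw \<pi> A A \<Longrightarrow> (\<And>x. x \<in> A \<Longrightarrow> \<pi> x = x) \<Longrightarrow> relabel \<pi> v = v"
proof (rule vals_eqI)
  assume *: "v \<in> vals" "bij_betw \<pi> A A" "\<And>x. x \<in> A \<Longrightarrow> \<pi> x = x"
  then show "relabel \<pi> v \<in> vals" "v \<in> vals" using relabel_in by auto
  show "fst (relabel \<pi> v) = fst v" using * by (auto simp: relabel_def vals_def)
  fix r s assume rs: "(r, s) \<in> indices"
  then have "map \<pi> r = r" using * by (auto simp: indices_def intro!: map_idI)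
  then show "snd (relabel \<pi> v) (r, s) = snd v (r, s)"
    using relabel_apply[OF *(2) rs, of v] by simp
qed

lemma relabel_sym:
  assumes \<pi>: "bij_betw \<pi> A A" shows "relabel \<pi> \<in> val_sym"
proof -
  let ?\<rho> = "inv_into A \<pi>"
  have \<rho>: "bij_betw ?\<rho> A A" using \<pi> by (rule bij_betw_inv_into)
  have i: "bij_betw (\<lambda>x. x) A A" using bij_betw_id[of A] by (simp add: id_def)
  have 1: "relabel ?\<rho> (relabel \<pi> v) = v" if "v \<in> vals" for v
    using relabel_comp[OF \<pi> \<rho> i that] relabel_id[OF that i] bij_betw_inv_into_left[OF \<pi>] by simp
  have 2: "relabel \<pi> (relabel ?\<rho> v) = v" if "v \<in> vals" for v
    using relabel_comp[OF \<rho> \<pi> i that] relabel_id[OF that i] bij_betw_inv_into_right[OF \<pi>] by simp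
  have "bij_betw (relabel \<pi>) vals vals"
    using 1 2 relabel_in[OF \<pi>] relabel_in[OF \<rho>]
    by (intro bij_betw_byWitness[of _ "relabel ?\<rho>"]) auto
  moreover have "invariant (map (relabel \<pi>) vs) = invariant vs" if vs: "set vs \<subseteq> vals" for vs
  proof -
    let ?r = "map fst vs"
    have m: "map fst (map (relabel \<pi>) vs) = map \<pi> ?r" by (simp add: relabel_def comp_def)
    have rA: "set ?r \<subseteq> A" using vs by (auto simp: vals_def)
    have "inj_on \<pi> (set ?r)" using \<pi> rA by (auto simp: bij_betw_def intro: inj_on_subset)
    then have d: "distinct (map \<pi> ?r) \<longleftrightarrow> distinct ?r" using distinct_map[of \<pi> ?r] by blast
    have "filter (\<lambda>v. snd v (map \<pi> ?r, s)) (map (relabel \<pi>) vs)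
        = map (relabel \<pi>) (filter (\<lambda>v. snd v (?r, s)) vs)" if "distinct ?r" for s
    proof (cases "(?r, s) \<in> indices")
      case True
      show ?thesis unfolding filter_map comp_def relabel_apply[OF \<pi> True] ..
    next
      case False
      then have "(map \<pi> ?r, s) \<notin> indices" using rA that by (auto simp: indices_def)
      then have "filter (\<lambda>v. snd v (map \<pi> ?r, s)) (map (relabel \<pi>) vs) = []"
        by (auto simp: filter_empty_conv relabel_def)
      moreover have "filter (\<lambda>v. snd v (?r, s)) vs = []"
        using vs False by (auto simp: filter_empty_conv vals_def)
      ultimately show ?thesis by simp
    qed
    then show ?thesis unfolding invariant_def m d by simp
  qed
  ultimately show ?thesis by (simp add: val_sym_def)
qed

definition perm_of :: "('a \<rightharpoonup> 'a) \<Rightarrow> 'a \<Rightarrow> 'a" where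
  "perm_of f = transport A (dom f) (\<lambda>x. x) (\<lambda>x. the (f x))"

lemma perm_of_bij: "f \<in> P \<Longrightarrow> bij_betw (perm_of f) A A"
  unfolding perm_of_def
  using finite_A P_dom P_ran P_inj_on by (intro transport_bij) (auto simp: P_image)

lemma perm_of_apply: "f x = Some y \<Longrightarrow> perm_of f x = y"
  using transport_apply[of "\<lambda>x. x" "dom f" x A "\<lambda>x. the (f x)"] by (simp add: perm_of_def domI)

lemma perm_of_image: "perm_of f ` dom f = ran f"
proof -
  have "perm_of f ` dom f = (\<lambda>x. the (f x)) ` dom f"
    using perm_of_apply by (force intro!: image_cong)
  then show ?thesis by (simp add: P_image)
qed

lemma perm_of_coherent:
  assumes "e \<in> P" "f \<in> P" "f \<circ>\<^sub>m e \<in> P" "dom e = dom (f \<circ>\<^sub>m e)" "ran e = dom f" "x \<in> A"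
  shows "perm_of f (perm_of e x) = perm_of (f \<circ>\<^sub>m e) x"
proof -
  let ?e = "\<lambda>x. the (e x)" and ?f = "\<lambda>x. the (f x)"
  have d: "dom f = ?e ` dom e" using assms(5) by (simp only: P_image)
  have i: "inj_on ?e (dom e)" "inj_on ?f (dom f)" using P_inj_on[OF assms(1)] P_inj_on[OF assms(2)] by blast+
  have fe: "inj_on (?f \<circ> ?e) (dom e)" using i d by (auto intro: comp_inj_on)
  have "perm_of f = transport A (dom e) ?e (?f \<circ> ?e)"
    unfolding perm_of_def d using transport_reindex[OF i(1), of "\<lambda>x. x" A ?f]
    by (simp add: comp_def)
  moreover have "perm_of (f \<circ>\<^sub>m e) = transport A (dom e) (\<lambda>x. x) (?f \<circ> ?e)"
    unfolding perm_of_def assms(4)[symmetric]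
    by (rule transport_cong) auto
  moreover have "?e ` dom e \<subseteq> A" "(?f \<circ> ?e) ` dom e \<subseteq> A"
    using assms P_ran P_image[of e] P_image[of f] unfolding image_comp[symmetric] d[symmetric] by auto
  ultimately show ?thesis
    using transport_trans[OF finite_A _ i(1) fe, of "\<lambda>x. x" x] P_dom[OF assms(1)] assms(6)
    by (simp add: perm_of_def)
qed

text \<open>Normalise with respect to the domain, permute \<open>A\<close>, and undo the normalisation with respect to the
range; \<open>flip\<close> is an involution. The outer factors depend only on the domain and the range, so they
cancel in the composition of a coherent triple.\<close>

definition val_ext where
  "val_ext f = flip (ran f) \<circ> relabel (perm_of f) \<circ> flip (dom f)"

lemma flip_in: "v \<in> vals \<Longrightarrow> flip D v \<in> vals"
  using flip_sym[of D] by (auto simp: val_sym_def bij_betw_def)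

lemma val_ext_extends:
  assumes f: "f \<in> P" and xy: "f x = Some y"
  shows "val_ext f (val_of x) = val_of y"
proof -
  let ?\<pi> = "perm_of f"
  have \<pi>: "bij_betw ?\<pi> A A" using f by (rule perm_of_bij)
  have xA: "x \<in> A" "y \<in> A" using f xy P_dom P_ran by (auto intro: ranI)
  have norm: "snd (flip D (val_of z)) (r, s) \<longleftrightarrow>
      (r, s) \<in> indices \<and> r \<noteq> [] \<and> z = hd r \<and> similar r s \<and> set r \<subseteq> D"
    if "z \<in> D" for z D r s
    using that hd_filter_in[of r D] by (auto simp: flip_def val_of_def flips_def)
  have "relabel ?\<pi> (flip (dom f) (val_of x)) = flip (ran f) (val_of y)"
  proof (rule vals_eqI)
    show "relabel ?\<pi> (flip (dom f) (val_of x)) \<in> vals" "flip (ran f) (val_of y) \<in> vals"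
      using xA by (auto intro!: relabel_in[OF \<pi>] flip_in val_of_in)
    show "fst (relabel ?\<pi> (flip (dom f) (val_of x))) = fst (flip (ran f) (val_of y))"
      using perm_of_apply[of f x y, OF xy] by (simp add: relabel_def flip_def val_of_def)
    fix r s assume "(r, s) \<in> indices"
    then obtain r' where r': "(r', s) \<in> indices" "r = map ?\<pi> r'"
      using indices_map_obtain[OF \<pi>] by blast
    have r'A: "set r' \<subseteq> A" using r' by (auto simp: indices_def)
    have inj: "inj_on ?\<pi> A" using \<pi> by (simp add: bij_betw_def)
    have sub: "set r \<subseteq> ran f \<longleftrightarrow> set r' \<subseteq> dom f"
    proof -
      have "?\<pi> a \<in> ran f \<longleftrightarrow> a \<in> dom f" if "a \<in> set r'" for a
        unfolding perm_of_image[symmetric]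
        using inj_on_image_mem_iff[OF inj _ P_dom[OF f]] that r'A by blast
      then show ?thesis unfolding r'(2) set_map by blast
    qed
    have hd: "y = hd r \<longleftrightarrow> x = hd r'" if "r' \<noteq> []"
    proof -
      have "hd r = ?\<pi> (hd r')" "hd r' \<in> A" using that r'(2) r'A by (auto simp: hd_map)
      moreover have "?\<pi> x = y" using perm_of_apply[of f x y, OF xy] .
      ultimately show ?thesis using inj xA by (metis inj_on_eq_iff)
    qed
    have sim: "similar r s \<longleftrightarrow> similar r' s" if "set r' \<subseteq> dom f"
    proof -
      have "map f r' = map Some r"
        unfolding r'(2) using that perm_of_apply[of f] by (fastforce simp: dom_def)
      then have "similar r' r" using f by (auto simp: similar_def)
      then show ?thesis using similar_trans similar_sym by blast
    qed
    have "snd (relabel ?\<pi> (flip (dom f) (val_of x))) (r, s) = snd (flip (dom f) (val_of x)) (r', s)"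
      using relabel_apply[OF \<pi> r'(1)] r'(2) by simp
    also have "\<dots> \<longleftrightarrow> r' \<noteq> [] \<and> x = hd r' \<and> similar r' s \<and> set r' \<subseteq> dom f"
      using norm[of x "dom f" r' s] xy r'(1) by (auto simp: domI)
    also have "\<dots> \<longleftrightarrow> r \<noteq> [] \<and> y = hd r \<and> similar r s \<and> set r \<subseteq> ran f"
      using sub hd sim r'(2) by auto
    also have "\<dots> \<longleftrightarrow> snd (flip (ran f) (val_of y)) (r, s)"
      using norm[of y "ran f" r s] xy \<open>(r, s) \<in> indices\<close> by (auto simp: ranI)
    finally show "snd (relabel ?\<pi> (flip (dom f) (val_of x))) (r, s)
        = snd (flip (ran f) (val_of y)) (r, s)" .
  qed
  then show ?thesis by (simp add: val_ext_def flip_flip)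
qed

lemma val_ext_coherent:
  assumes "e \<in> P" "f \<in> P" "f \<circ>\<^sub>m e \<in> P" "dom e = dom (f \<circ>\<^sub>m e)" "ran e = dom f"
    "ran f = ran (f \<circ>\<^sub>m e)" "v \<in> vals"
  shows "val_ext f (val_ext e v) = val_ext (f \<circ>\<^sub>m e) v"
proof -
  let ?w = "flip (dom e) v"
  have "val_ext f (val_ext e v) = flip (ran f) (relabel (perm_of f) (relabel (perm_of e) ?w))"
    using assms(5) by (simp add: val_ext_def flip_flip)
  also have "relabel (perm_of f) (relabel (perm_of e) ?w) = relabel (perm_of (f \<circ>\<^sub>m e)) ?w"
    using assms flip_in perm_of_coherent[OF assms(1-5)] by (intro relabel_comp perm_of_bij)
  finally show ?thesis using assms by (simp add: val_ext_def)
qed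

lemma extension_system_vals: "extension_system A P vals val_of val_sym val_ext"
proof
  show "finite vals" by (rule finite_vals)
  show "inj_on val_of A" by (auto simp: inj_on_def val_of_def)
  show "id \<in> val_sym" by (simp add: val_sym_def)
  show "bij_betw g vals vals" if "g \<in> val_sym" for g using that by (simp add: val_sym_def)
  show "val_ext f \<in> val_sym" if "f \<in> P" for f
    unfolding val_ext_def using that by (intro val_sym_comp flip_sym relabel_sym perm_of_bij)
qed (use val_of_in val_sym_comp val_sym_inv val_ext_extends val_ext_coherent val_sym_restrict in auto)

end

section \<open>Labels: conformality\<close>

type_synonym 'x lab_vertex = "'x \<times> ('x set \<Rightarrow> nat)"

context extension_system
begin

definition uncovered :: "'x set set" where
  "uncovered = {U. U \<subseteq> X \<and> (\<forall>g\<in>G. \<not> U \<subseteq> g ` \<iota> ` A)}"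

definition pre :: "('x \<Rightarrow> 'x) \<Rightarrow> 'x set \<Rightarrow> 'x set" where
  "pre g U = {v \<in> X. g v \<in> U}"

lemma image_pre: "g \<in> G \<Longrightarrow> U \<subseteq> X \<Longrightarrow> g ` pre g U = U"
  using G_bij[of g] by (force simp: pre_def bij_betw_def)

lemma pre_image: "g \<in> G \<Longrightarrow> U \<subseteq> X \<Longrightarrow> pre g (g ` U) = U"
  using G_inj[of g] by (auto simp: pre_def)

lemma uncovered_image: assumes "g \<in> G" "U \<in> uncovered" shows "g ` U \<in> uncovered"
proof -
  have U: "U \<subseteq> X" "\<And>h. h \<in> G \<Longrightarrow> \<not> U \<subseteq> h ` \<iota> ` A" using assms by (auto simp: uncovered_def)
  obtain k where k: "k \<in> G" "\<And>v. v \<in> X \<Longrightarrow> k (g v) = v" using G_inverse[OF assms(1)] by metis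
  have "\<not> g ` U \<subseteq> h ` \<iota> ` A" if "h \<in> G" for h
  proof
    assume "g ` U \<subseteq> h ` \<iota> ` A"
    then have "k ` g ` U \<subseteq> (k \<circ> h) ` \<iota> ` A"
      unfolding image_comp[symmetric] by (rule image_mono)
    moreover have "k ` g ` U = U" using k(2) U(1) by (force simp: image_iff)
    ultimately show False using U(2)[OF G_comp[OF k(1) that]] by simp
  qed
  then show ?thesis using U(1) G_in[OF assms(1)] by (auto simp: uncovered_def)
qed

lemma uncovered_pre: assumes "g \<in> G" "U \<in> uncovered" shows "pre g U \<in> uncovered"
proof -
  have U: "U \<subseteq> X" using assms by (auto simp: uncovered_def)
  have "\<not> pre g U \<subseteq> h ` \<iota> ` A" if "h \<in> G" for h
  proof
    assume "pre g U \<subseteq> h ` \<iota> ` A"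
    then have "g ` pre g U \<subseteq> (g \<circ> h) ` \<iota> ` A"
      unfolding image_comp[symmetric] by (rule image_mono)
    then show False
      unfolding image_pre[OF assms(1) U]
      using assms(2) G_comp[OF assms(1) that] unfolding uncovered_def by blast
  qed
  then show ?thesis by (auto simp: uncovered_def pre_def)
qed

definition labels :: "'x set \<Rightarrow> nat set" where
  "labels U = {..<card U - 1}"

lemma finite_labels: "finite (labels U)"
  by (simp add: labels_def)

lemma labels_pre: "g \<in> G \<Longrightarrow> U \<subseteq> X \<Longrightarrow> labels (pre g U) = labels U"
proof -
  assume g: "g \<in> G" and U: "U \<subseteq> X"
  have "inj_on g (pre g U)" using G_inj[OF g] by (auto simp: inj_on_def pre_def)
  from card_image[OF this] show ?thesis using image_pre[OF g U] by (simp add: labels_def)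
qed

text \<open>A label is only meaningful at an uncovered set through the vertex; elsewhere it is \<open>0\<close>. A vertex that
forms an uncovered singleton has no admissible label and disappears.\<close>

definition labelled :: "('x lab_vertex) set" where
  "labelled = {(v, \<chi>). v \<in> X \<and>
     (\<forall>U. if U \<in> uncovered \<and> v \<in> U then \<chi> U \<in> labels U else \<chi> U = 0)}"

lemma labelledI:
  "v \<in> X \<Longrightarrow> (\<And>U. U \<in> uncovered \<Longrightarrow> v \<in> U \<Longrightarrow> \<chi> U \<in> labels U) \<Longrightarrow>
     (\<And>U. \<not> (U \<in> uncovered \<and> v \<in> U) \<Longrightarrow> \<chi> U = 0) \<Longrightarrow> (v, \<chi>) \<in> labelled"
  by (simp add: labelled_def)

lemma labelledD:
  assumes "w \<in> labelled"
  shows "fst w \<in> X" "U \<in> uncovered \<Longrightarrow> fst w \<in> U \<Longrightarrow> snd w U \<in> labels U"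
    "\<not> (U \<in> uncovered \<and> fst w \<in> U) \<Longrightarrow> snd w U = 0"
proof -
  have "fst w \<in> X" "if U \<in> uncovered \<and> fst w \<in> U then snd w U \<in> labels U else snd w U = 0"
    using assms by (cases w; simp add: labelled_def)+
  then show "fst w \<in> X" "U \<in> uncovered \<Longrightarrow> fst w \<in> U \<Longrightarrow> snd w U \<in> labels U"
    "\<not> (U \<in> uncovered \<and> fst w \<in> U) \<Longrightarrow> snd w U = 0"
    by simp_all
qed

lemma finite_labelled: "finite labelled"
proof -
  let ?F = "{\<chi>. \<forall>U. (U \<in> Pow X \<longrightarrow> \<chi> U \<in> {..card X}) \<and> (U \<notin> Pow X \<longrightarrow> \<chi> U = 0)}"
  have "finite ?F" using finite_X by (intro finite_set_of_finite_funs) auto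
  then have "finite (X \<times> ?F)" using finite_X by simp
  moreover have "labelled \<subseteq> X \<times> ?F"
  proof
    fix w assume w: "w \<in> labelled"
    obtain v \<chi> where [simp]: "w = (v, \<chi>)" by (cases w)
    have "\<chi> U \<le> card X" for U
    proof (cases "U \<in> uncovered \<and> v \<in> U")
      case True
      then have "\<chi> U \<in> labels U" using labelledD(2)[OF w] by simp
      moreover have "card U \<le> card X" using True finite_X by (auto simp: uncovered_def card_mono)
      ultimately show ?thesis by (simp add: labels_def)
    qed (use labelledD(3)[OF w] in simp)
    moreover have "\<chi> U = 0" if "U \<notin> Pow X" for U
    proof -
      have "U \<notin> uncovered" using that by (simp add: uncovered_def)
      then show ?thesis using labelledD(3)[OF w] by simp
    qed
    moreover have "v \<in> X" using labelledD(1)[OF w] by simp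
    ultimately show "w \<in> X \<times> ?F" by simp
  qed
  ultimately show ?thesis by (rule rev_finite_subset)
qed

lemma labelled_eqI:
  assumes "v \<in> labelled" "w \<in> labelled" "fst v = fst w"
    and "\<And>U. U \<in> uncovered \<Longrightarrow> fst v \<in> U \<Longrightarrow> snd v U = snd w U"
  shows "v = w"
proof -
  have "snd v U = snd w U" for U
    using assms(3,4) labelledD(3)[OF assms(1)] labelledD(3)[OF assms(2)]
    by (cases "U \<in> uncovered \<and> fst v \<in> U") auto
  then show ?thesis using assms(3) by (auto simp: prod_eq_iff)
qed

definition lab :: "'a \<Rightarrow> 'x set \<Rightarrow> nat" where
  "lab x U = (if U \<in> uncovered \<and> \<iota> x \<in> U then numbering (U \<inter> \<iota> ` A) (\<iota> x) else 0)"

definition \<iota>_lab :: "'a \<Rightarrow> 'x lab_vertex" where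
  "\<iota>_lab x = (\<iota> x, lab x)"

text \<open>An uncovered set \<open>U\<close> is not contained in the copy \<open>\<iota> ` A\<close>, so \<open>U \<inter> \<iota> ` A\<close> has at most \<open>card U - 1\<close> elements and can be
numbered by the labels of \<open>U\<close>.\<close>

lemma lab_props:
  assumes "U \<in> uncovered"
  shows lab_in: "x \<in> A \<Longrightarrow> \<iota> x \<in> U \<Longrightarrow> lab x U \<in> labels U"
    and lab_inj: "inj_on (\<lambda>x. lab x U) {x \<in> A. \<iota> x \<in> U}"
proof -
  have "U \<subseteq> X" "\<not> U \<subseteq> id ` \<iota> ` A" using assms G_id unfolding uncovered_def by blast+
  then have U: "U \<subseteq> X" "\<not> U \<subseteq> \<iota> ` A" by simp_all
  have fin: "finite U" using U finite_X finite_subset by blast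
  then have e: "bij_betw (numbering (U \<inter> \<iota> ` A)) (U \<inter> \<iota> ` A) {..<card (U \<inter> \<iota> ` A)}"
    by (intro numbering_bij) simp
  have "U \<inter> \<iota> ` A \<subset> U" using U by blast
  then have "card (U \<inter> \<iota> ` A) < card U" using fin by (rule psubset_card_mono[rotated])
  then show "lab x U \<in> labels U" if "x \<in> A" "\<iota> x \<in> U"
    using bij_betwE[OF e] that assms by (force simp: lab_def labels_def)
  show "inj_on (\<lambda>x. lab x U) {x \<in> A. \<iota> x \<in> U}"
  proof (rule inj_onI)
    fix x y assume *: "x \<in> {x \<in> A. \<iota> x \<in> U}" "y \<in> {x \<in> A. \<iota> x \<in> U}" "lab x U = lab y U"
    then have "\<iota> x = \<iota> y"
      using assms e by (auto simp: lab_def bij_betw_def inj_on_def)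
    then show "x = y" using * \<iota>_inj by (auto simp: inj_on_def)
  qed
qed

lemma \<iota>_lab_in: "x \<in> A \<Longrightarrow> \<iota>_lab x \<in> labelled"
  unfolding \<iota>_lab_def using lab_in by (intro labelledI \<iota>_in) (auto simp: lab_def)

definition relabel_act :: "('x \<Rightarrow> 'x) \<Rightarrow> ('x set \<Rightarrow> nat \<Rightarrow> nat) \<Rightarrow> 'x lab_vertex \<Rightarrow> 'x lab_vertex"
  where "relabel_act g \<tau> w = (g (fst w),
     \<lambda>U. if U \<in> uncovered \<and> g (fst w) \<in> U then \<tau> U (snd w (pre g U)) else 0)"

text \<open>The symmetries act on the first components as some \<open>g \<in> G\<close> and may permute the labels of each uncovered
set freely, so they preserve whether two labels at the same set are equal.\<close>

definition lab_sym :: "('x lab_vertex \<Rightarrow> 'x lab_vertex) set" where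
  "lab_sym = {p. bij_betw p labelled labelled \<and> (\<exists>g\<in>G. \<forall>v\<in>labelled. fst (p v) = g (fst v) \<and>
     (\<forall>w\<in>labelled. \<forall>U\<in>uncovered. fst v \<in> U \<longrightarrow> fst w \<in> U \<longrightarrow>
        (snd (p v) (g ` U) = snd (p w) (g ` U) \<longleftrightarrow> snd v U = snd w U)))}"

lemma lab_symI:
  assumes "bij_betw p labelled labelled" "g \<in> G" "\<And>v. v \<in> labelled \<Longrightarrow> fst (p v) = g (fst v)"
    "\<And>v w U. v \<in> labelled \<Longrightarrow> w \<in> labelled \<Longrightarrow> U \<in> uncovered \<Longrightarrow> fst v \<in> U \<Longrightarrow> fst w \<in> U \<Longrightarrow>
       snd (p v) (g ` U) = snd (p w) (g ` U) \<longleftrightarrow> snd v U = snd w U"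
  shows "p \<in> lab_sym"
  using assms unfolding lab_sym_def by blast

lemma lab_symE:
  assumes "p \<in> lab_sym"
  obtains g where "bij_betw p labelled labelled" "g \<in> G"
    "\<And>v. v \<in> labelled \<Longrightarrow> fst (p v) = g (fst v)"
    "\<And>v w U. v \<in> labelled \<Longrightarrow> w \<in> labelled \<Longrightarrow> U \<in> uncovered \<Longrightarrow> fst v \<in> U \<Longrightarrow> fst w \<in> U \<Longrightarrow>
       snd (p v) (g ` U) = snd (p w) (g ` U) \<longleftrightarrow> snd v U = snd w U"
  using assms unfolding lab_sym_def by blast

lemma relabel_act_sym:
  assumes g: "g \<in> G"
    and \<tau>: "\<And>U. U \<in> uncovered \<Longrightarrow> bij_betw (\<tau> U) (labels U) (labels U)"
  shows "relabel_act g \<tau> \<in> lab_sym"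
proof -
  have label_pre: "snd w (pre g U) \<in> labels U"
    if "w \<in> labelled" "U \<in> uncovered" "g (fst w) \<in> U" for w U
  proof -
    have "fst w \<in> pre g U" using that labelledD(1) by (simp add: pre_def)
    then have "snd w (pre g U) \<in> labels (pre g U)"
      using labelledD(2)[OF that(1) uncovered_pre[OF g that(2)]] by blast
    then show ?thesis using labels_pre[OF g] that(2) by (auto simp: uncovered_def)
  qed
  have \<tau>_eq: "\<tau> U a = \<tau> U b \<longleftrightarrow> a = b"
    if "U \<in> uncovered" "a \<in> labels U" "b \<in> labels U" for U a b
    using \<tau>[OF that(1)] that(2,3) by (auto simp: bij_betw_def inj_on_eq_iff)
  have maps: "relabel_act g \<tau> w \<in> labelled" if "w \<in> labelled" for w
    unfolding relabel_act_def
    using label_pre[OF that] bij_betwE[OF \<tau>] G_in[OF g labelledD(1)[OF that]]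
    by (intro labelledI) auto
  have key: "snd (relabel_act g \<tau> v) (g ` U) = snd (relabel_act g \<tau> w) (g ` U) \<longleftrightarrow> snd v U = snd w U"
    if "v \<in> labelled" "w \<in> labelled" "U \<in> uncovered" "fst v \<in> U" "fst w \<in> U" for v w U
  proof -
    have gU: "g ` U \<in> uncovered" using uncovered_image[OF g that(3)] .
    have p: "pre g (g ` U) = U" using pre_image[OF g] that(3) by (simp add: uncovered_def)
    have "snd v U \<in> labels (g ` U)" "snd w U \<in> labels (g ` U)"
      using label_pre[OF that(1) gU] label_pre[OF that(2) gU] that(4,5) p by simp_all
    then show ?thesis using \<tau>_eq[OF gU] gU that(4,5) p by (simp add: relabel_act_def)
  qed
  have "inj_on (relabel_act g \<tau>) labelled"
  proof (rule inj_onI)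
    fix v w assume *: "v \<in> labelled" "w \<in> labelled" "relabel_act g \<tau> v = relabel_act g \<tau> w"
    then have "fst v = fst w"
      using G_inj[OF g] labelledD(1) by (auto simp: relabel_act_def)
    moreover from this have "snd v U = snd w U" if "U \<in> uncovered" "fst v \<in> U" for U
      using key[OF *(1,2) that] that *(3) by simp
    ultimately show "v = w" using labelled_eqI[OF *(1,2)] by blast
  qed
  moreover have "relabel_act g \<tau> ` labelled = labelled"
    using maps calculation finite_labelled by (intro endo_inj_surj) auto
  ultimately have "bij_betw (relabel_act g \<tau>) labelled labelled" by (simp add: bij_betw_def)
  then show ?thesis using g key by (intro lab_symI[of "relabel_act g \<tau>" g]) (simp_all add: relabel_act_def)
qed

lemma lab_sym_comp:
  assumes "p \<in> lab_sym" "q \<in> lab_sym" shows "p \<circ> q \<in> lab_sym"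
proof -
  obtain g where g: "bij_betw p labelled labelled" "g \<in> G"
    "\<And>v. v \<in> labelled \<Longrightarrow> fst (p v) = g (fst v)"
    "\<And>v w U. v \<in> labelled \<Longrightarrow> w \<in> labelled \<Longrightarrow> U \<in> uncovered \<Longrightarrow> fst v \<in> U \<Longrightarrow> fst w \<in> U \<Longrightarrow>
       snd (p v) (g ` U) = snd (p w) (g ` U) \<longleftrightarrow> snd v U = snd w U"
    using lab_symE[OF assms(1)] by metis
  obtain h where h: "bij_betw q labelled labelled" "h \<in> G"
    "\<And>v. v \<in> labelled \<Longrightarrow> fst (q v) = h (fst v)"
    "\<And>v w U. v \<in> labelled \<Longrightarrow> w \<in> labelled \<Longrightarrow> U \<in> uncovered \<Longrightarrow> fst v \<in> U \<Longrightarrow> fst w \<in> U \<Longrightarrow>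
       snd (q v) (h ` U) = snd (q w) (h ` U) \<longleftrightarrow> snd v U = snd w U"
    using lab_symE[OF assms(2)] by metis
  have q: "q v \<in> labelled" if "v \<in> labelled" for v using h(1) that by (rule bij_betw_apply)
  show ?thesis
  proof (rule lab_symI)
    show "bij_betw (p \<circ> q) labelled labelled" using h(1) g(1) by (rule bij_betw_trans)
    show "g \<circ> h \<in> G" using g(2) h(2) by (rule G_comp)
    show "fst ((p \<circ> q) v) = (g \<circ> h) (fst v)" if "v \<in> labelled" for v
      using g(3)[OF q[OF that]] h(3)[OF that] by simp
    fix v w U assume *: "v \<in> labelled" "w \<in> labelled" "U \<in> uncovered" "fst v \<in> U" "fst w \<in> U"
    have "fst (q v) \<in> h ` U" "fst (q w) \<in> h ` U" using * h(3) by auto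
    from g(4)[OF q[OF *(1)] q[OF *(2)] uncovered_image[OF h(2) *(3)] this] h(4)[OF *]
    show "snd ((p \<circ> q) v) ((g \<circ> h) ` U) = snd ((p \<circ> q) w) ((g \<circ> h) ` U) \<longleftrightarrow> snd v U = snd w U"
      by (simp add: image_image)
  qed
qed

lemma lab_sym_inv:
  assumes "p \<in> lab_sym" shows "\<exists>k\<in>lab_sym. \<forall>v\<in>labelled. k (p v) = v"
proof
  obtain g where g: "bij_betw p labelled labelled" "g \<in> G"
    "\<And>v. v \<in> labelled \<Longrightarrow> fst (p v) = g (fst v)"
    "\<And>v w U. v \<in> labelled \<Longrightarrow> w \<in> labelled \<Longrightarrow> U \<in> uncovered \<Longrightarrow> fst v \<in> U \<Longrightarrow> fst w \<in> U \<Longrightarrow>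
       snd (p v) (g ` U) = snd (p w) (g ` U) \<longleftrightarrow> snd v U = snd w U"
    using lab_symE[OF assms] by metis
  obtain k where k: "k \<in> G" "\<And>v. v \<in> X \<Longrightarrow> k (g v) = v" "\<And>v. v \<in> X \<Longrightarrow> g (k v) = v"
    using G_inverse[OF g(2)] by metis
  let ?q = "inv_into labelled p"
  have bij: "bij_betw ?q labelled labelled" using g(1) by (rule bij_betw_inv_into)
  have q: "?q v \<in> labelled" "p (?q v) = v" if "v \<in> labelled" for v
    using bij_betw_apply[OF bij that] bij_betw_inv_into_right[OF g(1) that] by auto
  have fst_q: "fst (?q v) = k (fst v)" if "v \<in> labelled" for v
    using g(3)[OF q(1)[OF that]] q(2)[OF that] k(2)[OF labelledD(1)[OF q(1)[OF that]]] by simp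
  show "?q \<in> lab_sym"
  proof (rule lab_symI[OF bij k(1) fst_q])
    fix v w U assume *: "v \<in> labelled" "w \<in> labelled" "U \<in> uncovered" "fst v \<in> U" "fst w \<in> U"
    have "g ` k ` U = U" using k(3) *(3) by (force simp: uncovered_def image_iff)
    moreover have "fst (?q v) \<in> k ` U" "fst (?q w) \<in> k ` U" using * fst_q by auto
    ultimately show "snd (?q v) (k ` U) = snd (?q w) (k ` U) \<longleftrightarrow> snd v U = snd w U"
      using g(4)[OF q(1)[OF *(1)] q(1)[OF *(2)] uncovered_image[OF k(1) *(3)]]
        q(2)[OF *(1)] q(2)[OF *(2)] by simp
  qed
  show "\<forall>v\<in>labelled. ?q (p v) = v" using bij_betw_inv_into_left[OF g(1)] by blast
qed

lemma lab_sym_id: "id \<in> lab_sym"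
  by (rule lab_symI[of _ id]) (auto simp: G_id)

text \<open>The labels at an uncovered set may be prescribed along a part \<open>S\<close> of \<open>A\<close>: any vertices \<open>w x\<close> over the
elements \<open>g (\<iota> x)\<close> whose labels are injective at each uncovered set are the images of the vertices
\<open>\<iota>_lab x\<close> under one symmetry. This yields the extensions of partial automorphisms, and it moves
pairwise compatible vertices into a copy in \<open>lab_conformal\<close>. The last three conclusions are the side
conditions of the transports used.\<close>

lemma relabel_act_transport:
  assumes g: "g \<in> G" and S: "S \<subseteq> A" and w_in: "\<And>x. x \<in> S \<Longrightarrow> w x \<in> labelled"
    and fst_w: "\<And>x. x \<in> S \<Longrightarrow> fst (w x) = g (\<iota> x)"
    and w_inj: "\<And>U. U \<in> uncovered \<Longrightarrow> inj_on (\<lambda>x. snd (w x) U) {x \<in> S. g (\<iota> x) \<in> U}"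
  defines "\<tau> U \<equiv> transport (labels U) {x \<in> S. g (\<iota> x) \<in> U} (\<lambda>x. lab x (pre g U)) (\<lambda>x. snd (w x) U)"
  shows "relabel_act g \<tau> \<in> lab_sym" and "x \<in> S \<Longrightarrow> relabel_act g \<tau> (\<iota>_lab x) = w x"
    and "U \<in> uncovered \<Longrightarrow> inj_on (\<lambda>x. lab x (pre g U)) {x \<in> S. g (\<iota> x) \<in> U}"
    and "U \<in> uncovered \<Longrightarrow> (\<lambda>x. lab x (pre g U)) ` {x \<in> S. g (\<iota> x) \<in> U} \<subseteq> labels U"
    and "U \<in> uncovered \<Longrightarrow> (\<lambda>x. snd (w x) U) ` {x \<in> S. g (\<iota> x) \<in> U} \<subseteq> labels U"
proof -
  show inj: "inj_on (\<lambda>x. lab x (pre g U)) {x \<in> S. g (\<iota> x) \<in> U}" if "U \<in> uncovered" for U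
    using lab_inj[OF uncovered_pre[OF g that]] by (rule inj_on_subset) (use S \<iota>_in in \<open>auto simp: pre_def\<close>)
  show a: "(\<lambda>x. lab x (pre g U)) ` {x \<in> S. g (\<iota> x) \<in> U} \<subseteq> labels U" if "U \<in> uncovered" for U
    using lab_in[OF uncovered_pre[OF g that]] labels_pre[OF g, of U] that S \<iota>_in
    by (auto simp: pre_def uncovered_def)
  show b: "(\<lambda>x. snd (w x) U) ` {x \<in> S. g (\<iota> x) \<in> U} \<subseteq> labels U" if "U \<in> uncovered" for U
    using labelledD(2)[OF w_in that] fst_w by auto
  show sym: "relabel_act g \<tau> \<in> lab_sym"
    unfolding \<tau>_def using inj w_inj a b finite_labels by (intro relabel_act_sym g transport_bij) auto
  show "relabel_act g \<tau> (\<iota>_lab x) = w x" if x: "x \<in> S"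
  proof (rule labelled_eqI)
    have "x \<in> A" using x S by blast
    then show "relabel_act g \<tau> (\<iota>_lab x) \<in> labelled"
      using sym \<iota>_lab_in by (auto simp: lab_sym_def bij_betw_def)
    show "w x \<in> labelled" using w_in x .
    show fst: "fst (relabel_act g \<tau> (\<iota>_lab x)) = fst (w x)" using fst_w[OF x] by (simp add: relabel_act_def \<iota>_lab_def)
    fix U assume U: "U \<in> uncovered" "fst (relabel_act g \<tau> (\<iota>_lab x)) \<in> U"
    then have "g (\<iota> x) \<in> U" using fst fst_w[OF x] by simp
    then show "snd (relabel_act g \<tau> (\<iota>_lab x)) U = snd (w x) U"
      using U(1) x transport_apply[OF inj[OF U(1)], of x "labels U" "\<lambda>x. snd (w x) U"]
      by (simp add: relabel_act_def \<iota>_lab_def \<tau>_def)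
  qed
qed

definition relabelling :: "('a \<rightharpoonup> 'a) \<Rightarrow> 'x set \<Rightarrow> nat \<Rightarrow> nat" where
  "relabelling f U = transport (labels U) {x \<in> dom f. \<phi> f (\<iota> x) \<in> U}
     (\<lambda>x. lab x (pre (\<phi> f) U)) (\<lambda>x. lab (the (f x)) U)"

definition lab_ext :: "('a \<rightharpoonup> 'a) \<Rightarrow> 'x lab_vertex \<Rightarrow> 'x lab_vertex" where
  "lab_ext f = relabel_act (\<phi> f) (relabelling f)"

lemma lab_image_inj:
  assumes f: "f \<in> P" and U: "U \<in> uncovered"
  shows "inj_on (\<lambda>x. lab (the (f x)) U) {x \<in> dom f. \<phi> f (\<iota> x) \<in> U}"
proof -
  let ?S = "{x \<in> dom f. \<phi> f (\<iota> x) \<in> U}"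
  have "inj_on (\<lambda>x. the (f x)) ?S" using P_inj_on[OF f] by (rule inj_on_subset) auto
  moreover have "(\<lambda>x. the (f x)) ` ?S \<subseteq> {x \<in> A. \<iota> x \<in> U}"
    using P_ran[OF f] \<phi>_extends[OF f] by (auto intro: ranI)
  ultimately show ?thesis
    using comp_inj_on[of "\<lambda>x. the (f x)" ?S "\<lambda>x. lab x U"] lab_inj[OF U]
    by (auto simp: comp_def intro: inj_on_subset)
qed

lemma lab_ext_props:
  assumes f: "f \<in> P"
  shows "lab_ext f \<in> lab_sym" and "f x = Some y \<Longrightarrow> lab_ext f (\<iota>_lab x) = \<iota>_lab y"
    and "U \<in> uncovered \<Longrightarrow> inj_on (\<lambda>x. lab x (pre (\<phi> f) U)) {x \<in> dom f. \<phi> f (\<iota> x) \<in> U}"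
    and "U \<in> uncovered \<Longrightarrow> (\<lambda>x. lab x (pre (\<phi> f) U)) ` {x \<in> dom f. \<phi> f (\<iota> x) \<in> U} \<subseteq> labels U"
    and "U \<in> uncovered \<Longrightarrow> (\<lambda>x. lab (the (f x)) U) ` {x \<in> dom f. \<phi> f (\<iota> x) \<in> U} \<subseteq> labels U"
proof -
  let ?w = "\<lambda>x. \<iota>_lab (the (f x))"
  have s: "snd (\<iota>_lab z) = lab z" for z by (simp add: \<iota>_lab_def)
  have ran: "the (f x) \<in> A" if "x \<in> dom f" for x using that P_ran[OF f] by (auto intro: ranI)
  have w: "?w x \<in> labelled" "fst (?w x) = \<phi> f (\<iota> x)" if "x \<in> dom f" for x
    using ran[OF that] that \<phi>_extends[OF f] \<iota>_lab_in by (auto simp: \<iota>_lab_def)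
  have i: "inj_on (\<lambda>x. snd (?w x) U) {x \<in> dom f. \<phi> f (\<iota> x) \<in> U}" if "U \<in> uncovered" for U
    unfolding s by (rule lab_image_inj[OF f that])
  note * = relabel_act_transport[OF \<phi>_in[OF f] P_dom[OF f] w i, unfolded s, folded relabelling_def, folded lab_ext_def]
  show "lab_ext f \<in> lab_sym" by (rule *(1))
  show "lab_ext f (\<iota>_lab x) = \<iota>_lab y" if "f x = Some y" using *(2)[of x] that by (simp add: domI)
  show "U \<in> uncovered \<Longrightarrow> inj_on (\<lambda>x. lab x (pre (\<phi> f) U)) {x \<in> dom f. \<phi> f (\<iota> x) \<in> U}" by (rule *(3))
  show "U \<in> uncovered \<Longrightarrow> (\<lambda>x. lab x (pre (\<phi> f) U)) ` {x \<in> dom f. \<phi> f (\<iota> x) \<in> U} \<subseteq> labels U" by (rule *(4))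
  show "U \<in> uncovered \<Longrightarrow> (\<lambda>x. lab (the (f x)) U) ` {x \<in> dom f. \<phi> f (\<iota> x) \<in> U} \<subseteq> labels U" by (rule *(5))
qed

text \<open>At an uncovered set \<open>U\<close>, the three extensions transport between the labels at the preimages of \<open>U\<close>.
Once all three transports are indexed by the same subset of \<open>dom e\<close>, \<open>transport_trans\<close> composes them.\<close>

lemma lab_ext_coherent:
  assumes e: "e \<in> P" and f: "f \<in> P" and fe: "f \<circ>\<^sub>m e \<in> P"
    and dom: "dom e = dom (f \<circ>\<^sub>m e)" "ran e = dom f" "ran f = ran (f \<circ>\<^sub>m e)"
    and v: "v \<in> labelled"
  shows "lab_ext f (lab_ext e v) = lab_ext (f \<circ>\<^sub>m e) v"
proof -
  let ?h = "f \<circ>\<^sub>m e" and ?e = "\<lambda>x. the (e x)" and ?f = "\<lambda>x. the (f x)"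
  have coh: "\<phi> f (\<phi> e z) = \<phi> ?h z" if "z \<in> X" for z
    using \<phi>_coherent[OF e f fe dom that] .
  have pre: "pre (\<phi> e) (pre (\<phi> f) U) = pre (\<phi> ?h) U" for U
    using coh G_in[OF \<phi>_in[OF e]] by (auto simp: pre_def)
  have in_lab: "lab_ext p w \<in> labelled" if "p \<in> P" "w \<in> labelled" for p w
    using lab_ext_props(1)[OF that(1)] that(2) by (auto simp: lab_sym_def bij_betw_def)
  show ?thesis
  proof (rule labelled_eqI)
    show "lab_ext f (lab_ext e v) \<in> labelled" "lab_ext ?h v \<in> labelled"
      using in_lab e f fe v by auto
    show eq: "fst (lab_ext f (lab_ext e v)) = fst (lab_ext ?h v)"
      using coh[OF labelledD(1)[OF v]] by (simp add: lab_ext_def relabel_act_def)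
    fix U assume U: "U \<in> uncovered" and "fst (lab_ext f (lab_ext e v)) \<in> U"
    then have hv: "\<phi> f (\<phi> e (fst v)) \<in> U" "\<phi> ?h (fst v) \<in> U"
      using eq by (simp_all add: lab_ext_def relabel_act_def)
    let ?U1 = "pre (\<phi> f) U" and ?U0 = "pre (\<phi> ?h) U"
    let ?S = "{x \<in> dom e. \<phi> e (\<iota> x) \<in> ?U1}"
    have U1: "?U1 \<in> uncovered" using uncovered_pre[OF \<phi>_in[OF f] U] .
    have U0: "?U0 \<in> uncovered" using uncovered_pre[OF \<phi>_in[OF fe] U] .
    have M: "labels ?U1 = labels U" "labels ?U0 = labels U"
      using labels_pre[OF \<phi>_in[OF f]] labels_pre[OF \<phi>_in[OF fe]] U by (auto simp: uncovered_def)
    have ev: "\<phi> e (fst v) \<in> ?U1" "fst v \<in> ?U0"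
      using hv labelledD(1)[OF v] G_in[OF \<phi>_in[OF e]] by (auto simp: pre_def)
    have Sh: "?S = {x \<in> dom ?h. \<phi> ?h (\<iota> x) \<in> U}"
      unfolding dom(1)[symmetric]
      using coh[OF \<iota>_in] P_dom[OF e] G_in[OF \<phi>_in[OF e] \<iota>_in] by (auto simp: pre_def)
    have Sf: "?e ` ?S = {x \<in> dom f. \<phi> f (\<iota> x) \<in> U}"
    proof -
      have "\<phi> e (\<iota> x) = \<iota> (?e x)" "\<iota> (?e x) \<in> X" if "x \<in> dom e" for x
        using that \<phi>_extends[OF e] P_ran[OF e] \<iota>_in by (auto intro: ranI)
      then have "x \<in> ?S \<longleftrightarrow> x \<in> dom e \<and> \<phi> f (\<iota> (?e x)) \<in> U" for x
        by (cases "x \<in> dom e") (simp_all add: pre_def)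
      then show ?thesis unfolding dom(2)[symmetric] P_image[symmetric] by auto
    qed
    have inj_e: "inj_on ?e ?S" using P_inj_on[OF e] by (rule inj_on_subset) auto
    have te: "relabelling e ?U1 = transport (labels U) ?S (\<lambda>x. lab x ?U0) (\<lambda>x. lab (?e x) ?U1)"
      unfolding relabelling_def pre M ..
    have tf: "relabelling f U = transport (labels U) ?S (\<lambda>x. lab (?e x) ?U1) (\<lambda>x. lab (?f (?e x)) U)"
      using transport_reindex[OF inj_e, of "\<lambda>x. lab x ?U1" "labels U" "\<lambda>x. lab (?f x) U"]
        lab_ext_props(3)[OF f U]
      unfolding relabelling_def Sf by (simp add: comp_def)
    have h_apply: "the (?h x) = ?f (?e x)" if "x \<in> dom ?h" for x
      using that by (cases "e x") (auto simp: map_comp_def)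
    have th: "relabelling ?h U = transport (labels U) ?S (\<lambda>x. lab x ?U0) (\<lambda>x. lab (?f (?e x)) U)"
      unfolding relabelling_def Sh
      by (rule transport_cong[OF refl _ lab_ext_props(3)[OF fe U]])
        (use h_apply in \<open>simp del: map_comp_simps\<close>)
    have i0: "inj_on (\<lambda>x. lab x ?U0) ?S" "(\<lambda>x. lab x ?U0) ` ?S \<subseteq> labels U"
      using lab_ext_props(3)[OF e U1] lab_ext_props(4)[OF e U1] unfolding pre M by auto
    have i1: "inj_on (\<lambda>x. lab (?e x) ?U1) ?S" "(\<lambda>x. lab (?e x) ?U1) ` ?S \<subseteq> labels U"
      using lab_image_inj[OF e U1] lab_ext_props(5)[OF e U1] unfolding M by auto
    have i2: "inj_on (\<lambda>x. lab (?f (?e x)) U) ?S" "(\<lambda>x. lab (?f (?e x)) U) ` ?S \<subseteq> labels U"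
    proof -
      have "inj_on (\<lambda>x. lab (?f x) U) (?e ` ?S)" unfolding Sf using lab_image_inj[OF f U] .
      from comp_inj_on[OF inj_e this] show "inj_on (\<lambda>x. lab (?f (?e x)) U) ?S" by (simp add: comp_def)
      have "(\<lambda>x. lab (?f x) U) ` ?e ` ?S \<subseteq> labels U" unfolding Sf using lab_ext_props(5)[OF f U] .
      then show "(\<lambda>x. lab (?f (?e x)) U) ` ?S \<subseteq> labels U" by (simp add: image_comp comp_def)
    qed
    have m: "snd v ?U0 \<in> labels U" using labelledD(2)[OF v U0 ev(2)] M by simp
    have "snd (lab_ext f (lab_ext e v)) U = relabelling f U (relabelling e ?U1 (snd v ?U0))"
      using U U1 hv ev by (simp add: lab_ext_def relabel_act_def pre)
    also have "\<dots> = relabelling ?h U (snd v ?U0)"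
      unfolding te tf th
      by (rule transport_trans[OF finite_labels i0(1) i1(1) i2(1) i0(2) i1(2) i2(2) m])
    also have "\<dots> = snd (lab_ext ?h v) U" using U hv by (simp add: lab_ext_def relabel_act_def)
    finally show "snd (lab_ext f (lab_ext e v)) U = snd (lab_ext ?h v) U" .
  qed
qed

lemma lab_system: "extension_system A P labelled \<iota>_lab lab_sym lab_ext"
proof
  show "finite labelled" by (rule finite_labelled)
  show "inj_on \<iota>_lab A" using \<iota>_inj by (auto simp: inj_on_def \<iota>_lab_def)
  show "id \<in> lab_sym" by (rule lab_sym_id)
  show "bij_betw p labelled labelled" if "p \<in> lab_sym" for p using that by (simp add: lab_sym_def)
  show "\<exists>f\<in>P. \<forall>x\<in>A. \<forall>y\<in>A. p (\<iota>_lab x) = \<iota>_lab y \<longrightarrow> f x = Some y" if p: "p \<in> lab_sym" for p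
  proof -
    obtain g where g: "g \<in> G" "\<And>v. v \<in> labelled \<Longrightarrow> fst (p v) = g (fst v)"
      using lab_symE[OF p] by metis
    obtain f where "f \<in> P" "\<forall>x\<in>A. \<forall>y\<in>A. g (\<iota> x) = \<iota> y \<longrightarrow> f x = Some y"
      using G_restrict[OF g(1)] by blast
    moreover have "g (\<iota> x) = \<iota> y" if "x \<in> A" "p (\<iota>_lab x) = \<iota>_lab y" for x y
      using g(2)[OF \<iota>_lab_in[OF that(1)]] that(2) by (simp add: \<iota>_lab_def)
    ultimately show ?thesis by blast
  qed
qed (use \<iota>_lab_in lab_sym_comp lab_sym_inv lab_ext_props(1,2) lab_ext_coherent in auto)

text \<open>Two distinct vertices in a common copy have distinct projections, and distinct labels at every
uncovered set that contains both projections. So if the projection of \<open>C\<close> were uncovered, \<open>card C\<close>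
vertices would need distinct labels out of \<open>card C - 1\<close>. Hence the projection lies in a copy, and the
labels of \<open>C\<close> can be produced from the labels of \<open>A\<close> by a suitable relabelling.\<close>

lemma lab_conformal: "conformal A labelled \<iota>_lab lab_sym"
  unfolding conformal_def
proof (intro allI impI)
  fix C assume C: "C \<subseteq> labelled"
    and clique: "\<forall>v\<in>C. \<forall>w\<in>C. \<exists>g\<in>lab_sym. v \<in> g ` \<iota>_lab ` A \<and> w \<in> g ` \<iota>_lab ` A"
  have sep: "fst v \<noteq> fst w \<and> (\<forall>U\<in>uncovered. fst v \<in> U \<longrightarrow> fst w \<in> U \<longrightarrow> snd v U \<noteq> snd w U)"
    if vw: "v \<in> C" "w \<in> C" "v \<noteq> w" for v w
  proof -
    obtain p where p: "p \<in> lab_sym" "v \<in> p ` \<iota>_lab ` A" "w \<in> p ` \<iota>_lab ` A"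
      using clique vw by blast
    then obtain x y where xy: "x \<in> A" "y \<in> A" "v = p (\<iota>_lab x)" "w = p (\<iota>_lab y)" by blast
    obtain g where g: "g \<in> G" "\<And>v. v \<in> labelled \<Longrightarrow> fst (p v) = g (fst v)"
      "\<And>v w U. v \<in> labelled \<Longrightarrow> w \<in> labelled \<Longrightarrow> U \<in> uncovered \<Longrightarrow> fst v \<in> U \<Longrightarrow> fst w \<in> U \<Longrightarrow>
       snd (p v) (g ` U) = snd (p w) (g ` U) \<longleftrightarrow> snd v U = snd w U"
      using lab_symE[OF p(1)] by metis
    have ne: "x \<noteq> y" using vw xy by blast
    have f: "fst v = g (\<iota> x)" "fst w = g (\<iota> y)"
      using g(2)[OF \<iota>_lab_in] xy by (auto simp: \<iota>_lab_def)
    have "fst v \<noteq> fst w"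
      unfolding f using G_inj[OF g(1) \<iota>_in \<iota>_in] xy(1,2) \<iota>_inj ne by (auto simp: inj_on_def)
    moreover have "snd v U \<noteq> snd w U" if U: "U \<in> uncovered" "fst v \<in> U" "fst w \<in> U" for U
    proof -
      let ?U = "pre g U"
      have "?U \<in> uncovered" using uncovered_pre[OF g(1) U(1)] .
      moreover have i: "\<iota> x \<in> ?U" "\<iota> y \<in> ?U" using U f xy \<iota>_in by (auto simp: pre_def)
      moreover have "lab x ?U \<noteq> lab y ?U"
        using lab_inj[OF \<open>?U \<in> uncovered\<close>] i xy ne by (auto simp: inj_on_def)
      moreover have "g ` ?U = U" using image_pre[OF g(1)] U(1) by (auto simp: uncovered_def)
      ultimately show ?thesis
        using g(3)[OF \<iota>_lab_in[OF xy(1)] \<iota>_lab_in[OF xy(2)], of ?U] xy by (auto simp: \<iota>_lab_def)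
    qed
    ultimately show ?thesis by blast
  qed
  have fst_inj: "inj_on fst C" using sep by (auto simp: inj_on_def)
  have "fst ` C \<notin> uncovered"
  proof
    assume U: "fst ` C \<in> uncovered"
    have "finite C" using C finite_labelled finite_subset by blast
    have "inj_on (\<lambda>v. snd v (fst ` C)) C"
    proof (rule inj_onI, rule ccontr)
      fix v w assume "v \<in> C" "w \<in> C" "snd v (fst ` C) = snd w (fst ` C)" "v \<noteq> w"
      then show False using sep[of v w] U by blast
    qed
    moreover have "(\<lambda>v. snd v (fst ` C)) ` C \<subseteq> labels (fst ` C)"
      using labelledD(2)[OF _ U] C by auto
    ultimately have "card C \<le> card (labels (fst ` C))"
      using card_inj_on_le finite_labels by blast
    moreover have "C \<noteq> {}" using U G_id by (auto simp: uncovered_def)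
    then have "0 < card C" using \<open>finite C\<close> by (simp add: card_gt_0_iff)
    ultimately show False
      using card_image[OF fst_inj] by (simp add: labels_def)
  qed
  moreover have "fst ` C \<subseteq> X" using C labelledD(1) by auto
  ultimately obtain g where g: "g \<in> G" "fst ` C \<subseteq> g ` \<iota> ` A" by (auto simp: uncovered_def)
  define S where "S = {x \<in> A. g (\<iota> x) \<in> fst ` C}"
  define w where "w x = inv_into C fst (g (\<iota> x))" for x
  have w: "w x \<in> C" "fst (w x) = g (\<iota> x)" if "x \<in> S" for x
    using that by (auto simp: S_def w_def inv_into_into f_inv_into_f)
  have w_in: "w x \<in> labelled" if "x \<in> S" for x using w(1)[OF that] C by blast
  have w_inj: "inj_on (\<lambda>x. snd (w x) U) {x \<in> S. g (\<iota> x) \<in> U}" if U: "U \<in> uncovered" for U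
  proof (rule inj_onI)
    fix x y assume *: "x \<in> {x \<in> S. g (\<iota> x) \<in> U}" "y \<in> {x \<in> S. g (\<iota> x) \<in> U}"
      "snd (w x) U = snd (w y) U"
    then have "w x = w y" using sep[of "w x" "w y"] w U by auto
    then have "g (\<iota> x) = g (\<iota> y)" using w * by (metis (no_types, lifting) mem_Collect_eq)
    then show "x = y"
      using G_inj[OF g(1) \<iota>_in \<iota>_in] \<iota>_inj * by (auto simp: S_def inj_on_def)
  qed
  have "S \<subseteq> A" by (auto simp: S_def)
  from relabel_act_transport(1,2)[OF g(1) this w_in w(2) w_inj]
  obtain \<tau> where \<tau>: "relabel_act g \<tau> \<in> lab_sym" "\<And>x. x \<in> S \<Longrightarrow> relabel_act g \<tau> (\<iota>_lab x) = w x"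
    by blast
  have "v \<in> relabel_act g \<tau> ` \<iota>_lab ` A" if v: "v \<in> C" for v
  proof -
    obtain x where x: "x \<in> A" "fst v = g (\<iota> x)" using g(2) v by blast
    then have "x \<in> S" using v by (auto simp: S_def image_iff intro!: bexI[of _ v])
    moreover have "w x = v" using x v fst_inj by (auto simp: w_def inv_into_f_eq)
    ultimately show ?thesis using \<tau>(2) x by force
  qed
  then show "\<exists>g\<in>lab_sym. C \<subseteq> g ` \<iota>_lab ` A" using \<tau>(1) by blast
qed

end

section \<open>Closures\<close>

definition closure_invariant :: "'a set \<Rightarrow> ('a \<Rightarrow> 'a set) \<Rightarrow> ('a \<Rightarrow> 'x) \<Rightarrow> ('x \<Rightarrow> 'x) set \<Rightarrow> bool" where
  "closure_invariant A cl \<iota> G \<longleftrightarrow>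
     (\<forall>g\<in>G. \<forall>x\<in>A. \<forall>y\<in>A. g (\<iota> x) = \<iota> y \<longrightarrow> g ` \<iota> ` cl x = \<iota> ` cl y)"

text \<open>Here \<open>cl\<close> is a closure operator that the members of \<open>P\<close> respect.\<close>

locale conformal_system = extension_system A P X \<iota> G \<phi>
  for A :: "'a set" and P and X :: "'x set" and \<iota> G \<phi> +
  fixes cl :: "'a \<Rightarrow> 'a set"
  assumes conf: "conformal A X \<iota> G"
    and cl_refl: "x \<in> A \<Longrightarrow> x \<in> cl x"
    and cl_in: "x \<in> A \<Longrightarrow> cl x \<subseteq> A"
    and cl_trans: "x \<in> A \<Longrightarrow> y \<in> cl x \<Longrightarrow> cl y \<subseteq> cl x"
    and P_cl: "f \<in> P \<Longrightarrow> f x = Some y \<Longrightarrow> cl x \<subseteq> dom f \<and> (\<lambda>z. the (f z)) ` cl x = cl y"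
begin

definition cl_verts :: "('x \<times> 'x set) set" where
  "cl_verts = {(g (\<iota> x), g ` \<iota> ` cl x) | g x. g \<in> G \<and> x \<in> A}"

definition \<iota>_cl :: "'a \<Rightarrow> 'x \<times> 'x set" where
  "\<iota>_cl x = (\<iota> x, \<iota> ` cl x)"

definition lift :: "('x \<Rightarrow> 'x) \<Rightarrow> 'x \<times> 'x set \<Rightarrow> 'x \<times> 'x set" where
  "lift g = (\<lambda>(v, V). (g v, g ` V))"

lemma lift_comp: "lift (g \<circ> h) = lift g \<circ> lift h"
  by (auto simp: lift_def image_comp)

lemma lift_\<iota>: "lift g (\<iota>_cl x) = (g (\<iota> x), g ` \<iota> ` cl x)"
  by (simp add: lift_def \<iota>_cl_def)

lemma cl_verts_eq: "cl_verts = (\<Union>g\<in>G. lift g ` \<iota>_cl ` A)"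
proof -
  have "cl_verts = {lift g (\<iota>_cl x) | g x. g \<in> G \<and> x \<in> A}" by (simp add: cl_verts_def lift_\<iota>)
  then show ?thesis by blast
qed

lemma cl_verts_sub: "(v, V) \<in> cl_verts \<Longrightarrow> v \<in> X \<and> V \<subseteq> X"
  using G_in \<iota>_in cl_in unfolding cl_verts_def by blast

lemma lift_in: "g \<in> G \<Longrightarrow> w \<in> cl_verts \<Longrightarrow> lift g w \<in> cl_verts"
proof -
  assume g: "g \<in> G" and "w \<in> cl_verts"
  then obtain h x where h: "h \<in> G" "x \<in> A" "w = lift h (\<iota>_cl x)" by (auto simp: cl_verts_eq)
  have "lift g w = lift (g \<circ> h) (\<iota>_cl x)" by (simp add: h lift_comp)
  then show ?thesis using G_comp[OF g h(1)] h(2) unfolding cl_verts_eq by blast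
qed

lemma lift_cong:
  assumes "w \<in> cl_verts" "\<And>v. v \<in> X \<Longrightarrow> g v = h v" shows "lift g w = lift h w"
proof -
  obtain v V where w: "w = (v, V)" by (cases w)
  then have "v \<in> X" "V \<subseteq> X" using cl_verts_sub assms(1) by auto
  then show ?thesis unfolding w lift_def using assms(2) by (auto intro!: image_cong)
qed

lemma lift_inverse:
  assumes "g \<in> G"
  obtains k where "k \<in> G" "\<And>w. w \<in> cl_verts \<Longrightarrow> lift k (lift g w) = w"
    "\<And>w. w \<in> cl_verts \<Longrightarrow> lift g (lift k w) = w"
proof -
  obtain k where k: "k \<in> G" "\<And>v. v \<in> X \<Longrightarrow> k (g v) = v" "\<And>v. v \<in> X \<Longrightarrow> g (k v) = v"
    using G_inverse[OF assms] by metis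
  have i: "lift id w = w" for w by (cases w) (simp add: lift_def)
  have "lift (k \<circ> g) w = w" "lift (g \<circ> k) w = w" if "w \<in> cl_verts" for w
    using lift_cong[OF that, of "k \<circ> g" id] lift_cong[OF that, of "g \<circ> k" id] k i by simp_all
  then show thesis using k(1) by (intro that[of k]) (simp_all add: lift_comp)
qed

text \<open>If the whole closure of \<open>x\<close> returns to \<open>A\<close> under \<open>g\<close>, then some \<open>f \<in> P\<close> agrees with \<open>g\<close> on it, and \<open>f\<close>
maps closures to closures.\<close>

lemma restrict_cl:
  assumes g: "g \<in> G" and x: "x \<in> A" and sub: "g ` \<iota> ` cl x \<subseteq> \<iota> ` A"
  obtains y where "y \<in> A" "g (\<iota> x) = \<iota> y" "g ` \<iota> ` cl x = \<iota> ` cl y"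
proof -
  obtain f where f: "f \<in> P" "\<And>x y. x \<in> A \<Longrightarrow> y \<in> A \<Longrightarrow> g (\<iota> x) = \<iota> y \<Longrightarrow> f x = Some y"
    using G_restrict[OF g] by metis
  have *: "f z \<noteq> None \<and> the (f z) \<in> A \<and> g (\<iota> z) = \<iota> (the (f z))" if "z \<in> cl x" for z
  proof -
    have "g (\<iota> z) \<in> \<iota> ` A" "z \<in> A" using sub that cl_in[OF x] by auto
    then obtain y where y: "y \<in> A" "g (\<iota> z) = \<iota> y" by blast
    then show ?thesis using f(2)[OF \<open>z \<in> A\<close> y] by simp
  qed
  obtain y where y: "f x = Some y" using *[OF cl_refl[OF x]] by auto
  have "g ` \<iota> ` cl x = \<iota> ` (\<lambda>z. the (f z)) ` cl x" using * by (auto simp: image_iff)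
  also have "(\<lambda>z. the (f z)) ` cl x = cl y" using P_cl[OF f(1) y] by simp
  finally show thesis using that[of y] *[OF cl_refl[OF x]] y by simp
qed

lemma closure_system: "extension_system A P cl_verts \<iota>_cl (lift ` G) (\<lambda>f. lift (\<phi> f))"
proof
  have "cl_verts \<subseteq> X \<times> Pow X" using cl_verts_sub by auto
  then show "finite cl_verts" by (rule finite_subset) (use finite_X in simp)
  show "inj_on \<iota>_cl A" using \<iota>_inj by (auto simp: inj_on_def \<iota>_cl_def)
  show "\<iota>_cl x \<in> cl_verts" if "x \<in> A" for x
  proof -
    have "lift id (\<iota>_cl x) = \<iota>_cl x" by (simp add: lift_def \<iota>_cl_def)
    then show ?thesis using that G_id unfolding cl_verts_eq by (metis UN_I imageI)
  qed
  show "id \<in> lift ` G"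
    by (rule image_eqI[OF _ G_id]) (auto simp: lift_def)
  show "bij_betw p cl_verts cl_verts" if "p \<in> lift ` G" for p
  proof -
    from that obtain g where g: "g \<in> G" "p = lift g" by blast
    obtain k where k: "k \<in> G" "\<And>w. w \<in> cl_verts \<Longrightarrow> lift k (lift g w) = w"
      "\<And>w. w \<in> cl_verts \<Longrightarrow> lift g (lift k w) = w"
      using lift_inverse[OF g(1)] by metis
    show ?thesis unfolding g(2)
      using k lift_in[OF g(1)] lift_in[OF k(1)] by (intro bij_betw_byWitness[of _ "lift k"]) auto
  qed
  show "\<exists>k\<in>lift ` G. \<forall>v\<in>cl_verts. k (p v) = v" if "p \<in> lift ` G" for p
  proof -
    from that obtain g where g: "g \<in> G" "p = lift g" by blast
    obtain k where "k \<in> G" "\<And>w. w \<in> cl_verts \<Longrightarrow> lift k (lift g w) = w"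
      using lift_inverse[OF g(1)] by metis
    then show ?thesis using g(2) by (intro bexI[of _ "lift k"]) auto
  qed
  show "p \<circ> q \<in> lift ` G" if "p \<in> lift ` G" "q \<in> lift ` G" for p q
  proof -
    from that obtain g h where g: "g \<in> G" "p = lift g" and h: "h \<in> G" "q = lift h" by blast
    have "p \<circ> q = lift (g \<circ> h)" unfolding g h lift_comp ..
    then show ?thesis using G_comp[OF g(1) h(1)] by simp
  qed
  show "lift (\<phi> f) \<in> lift ` G" if "f \<in> P" for f using \<phi>_in that by blast
  show "lift (\<phi> f) (\<iota>_cl x) = \<iota>_cl y" if f: "f \<in> P" and xy: "f x = Some y" for f x y
  proof -
    have c: "cl x \<subseteq> dom f" "(\<lambda>z. the (f z)) ` cl x = cl y" using P_cl[OF f xy] by auto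
    have "\<phi> f (\<iota> z) = \<iota> (the (f z))" if "z \<in> cl x" for z
      using \<phi>_extends[OF f] c(1) that by auto
    then have "\<phi> f ` \<iota> ` cl x = \<iota> ` (\<lambda>z. the (f z)) ` cl x" by (auto simp: image_iff)
    then show ?thesis using \<phi>_extends[OF f xy] c by (simp add: lift_\<iota>) (simp add: \<iota>_cl_def)
  qed
  show "lift (\<phi> f) (lift (\<phi> e) w) = lift (\<phi> (f \<circ>\<^sub>m e)) w"
    if "e \<in> P" "f \<in> P" "f \<circ>\<^sub>m e \<in> P" "dom e = dom (f \<circ>\<^sub>m e)" "ran e = dom f"
      "ran f = ran (f \<circ>\<^sub>m e)" "w \<in> cl_verts" for e f w
    using lift_cong[OF that(7), of "\<phi> f \<circ> \<phi> e" "\<phi> (f \<circ>\<^sub>m e)"] \<phi>_coherent[OF that(1-6)]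
    by (simp add: lift_comp)
  show "\<exists>f\<in>P. \<forall>x\<in>A. \<forall>y\<in>A. p (\<iota>_cl x) = \<iota>_cl y \<longrightarrow> f x = Some y" if "p \<in> lift ` G" for p
  proof -
    from that obtain g where g: "g \<in> G" "p = lift g" by blast
    have "g (\<iota> x) = \<iota> y" if "p (\<iota>_cl x) = \<iota>_cl y" for x y
      using that unfolding g lift_\<iota> by (simp add: \<iota>_cl_def)
    moreover obtain f where "f \<in> P" "\<forall>x\<in>A. \<forall>y\<in>A. g (\<iota> x) = \<iota> y \<longrightarrow> f x = Some y"
      using G_restrict[OF g(1)] by blast
    ultimately show ?thesis by (intro bexI[of _ f]) auto
  qed
qed

text \<open>If \<open>lift g\<close> maps the vertex of \<open>x\<close> to the vertex of \<open>y\<close>, then by definition of the vertices \<open>g\<close> maps the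
closure of \<open>x\<close> onto that of \<open>y\<close>. The same must be shown one level up, for the vertices attached to the
elements \<open>z\<close> of that closure; this holds because the closure of \<open>z\<close> is contained in that of \<open>x\<close>.\<close>

lemma closure_closure_invariant: "closure_invariant A cl \<iota>_cl (lift ` G)"
  unfolding closure_invariant_def
proof (intro ballI impI)
  fix p x y assume "p \<in> lift ` G" and x: "x \<in> A" "y \<in> A" and "p (\<iota>_cl x) = \<iota>_cl y"
  then obtain g where g: "g \<in> G" "p = lift g" "g (\<iota> x) = \<iota> y" "g ` \<iota> ` cl x = \<iota> ` cl y"
    by (auto simp: lift_\<iota> \<iota>_cl_def[of y])
  obtain f where f: "f \<in> P" "\<And>x y. x \<in> A \<Longrightarrow> y \<in> A \<Longrightarrow> g (\<iota> x) = \<iota> y \<Longrightarrow> f x = Some y"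
    using G_restrict[OF g(1)] by metis
  have xy: "f x = Some y" using f(2) x g(3) by blast
  have "p (\<iota>_cl z) = \<iota>_cl (the (f z))" if z: "z \<in> cl x" for z
  proof -
    have zA: "z \<in> A" using z cl_in x by blast
    have "f z = Some u \<Longrightarrow> g (\<iota> z) = \<iota> u" for u
    proof -
      assume "f z = Some u"
      moreover obtain u' where "u' \<in> cl y" "g (\<iota> z) = \<iota> u'" using g(4) z by blast
      ultimately show ?thesis using f(2)[OF zA, of u'] cl_in[OF x(2)] by auto
    qed
    moreover obtain u where u: "f z = Some u" using P_cl[OF f(1) xy] z by blast
    ultimately have gz: "g (\<iota> z) = \<iota> u" by blast
    have "cl z \<subseteq> cl x" using cl_trans[OF x(1) z] .
    then have "g ` \<iota> ` cl z \<subseteq> \<iota> ` A"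
      using g(4) cl_in[OF x(2)] by blast
    then obtain u' where "u' \<in> A" "g (\<iota> z) = \<iota> u'" "g ` \<iota> ` cl z = \<iota> ` cl u'"
      using restrict_cl[OF g(1) zA] by metis
    then show ?thesis using u f(2)[OF zA, of u'] g(2) by (simp add: lift_\<iota>) (simp add: \<iota>_cl_def)
  qed
  then have "p ` \<iota>_cl ` cl x = \<iota>_cl ` (\<lambda>z. the (f z)) ` cl x" by (auto simp: image_iff)
  then show "p ` \<iota>_cl ` cl x = \<iota>_cl ` cl y" using P_cl[OF f(1) xy] by simp
qed

text \<open>Pairwise compatible vertices have closures that are pairwise compatible as well, so the union of these
closures lies in one copy \<open>g ` \<iota> ` A\<close>. After applying the inverse of \<open>g\<close>, each closure lies in \<open>A\<close>, and
\<open>restrict_cl\<close> shows that it is the closure of a vertex of \<open>A\<close>.\<close>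

lemma closure_conformal: "conformal A cl_verts \<iota>_cl (lift ` G)"
  unfolding conformal_def
proof (intro allI impI)
  fix C assume C: "C \<subseteq> cl_verts"
    and clique: "\<forall>v\<in>C. \<forall>w\<in>C. \<exists>p\<in>lift ` G. v \<in> p ` \<iota>_cl ` A \<and> w \<in> p ` \<iota>_cl ` A"
  let ?W = "\<Union>(snd ` C)"
  have "\<exists>g\<in>G. a \<in> g ` \<iota> ` A \<and> b \<in> g ` \<iota> ` A" if ab: "a \<in> ?W" "b \<in> ?W" for a b
  proof -
    obtain v w where vw: "v \<in> C" "a \<in> snd v" "w \<in> C" "b \<in> snd w" using ab by blast
    then obtain g where g: "g \<in> G" "v \<in> lift g ` \<iota>_cl ` A" "w \<in> lift g ` \<iota>_cl ` A"
      using clique by blast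
    have "snd u \<subseteq> g ` \<iota> ` A" if "u \<in> lift g ` \<iota>_cl ` A" for u
    proof -
      from that obtain x where x: "x \<in> A" "u = lift g (\<iota>_cl x)" by blast
      show ?thesis unfolding x(2) lift_\<iota> snd_conv using cl_in[OF x(1)] by (intro image_mono)
    qed
    from subsetD[OF this[OF g(2)] vw(2)] subsetD[OF this[OF g(3)] vw(4)]
    show ?thesis using g(1) by blast
  qed
  then have W: "\<forall>a\<in>?W. \<forall>b\<in>?W. \<exists>g\<in>G. a \<in> g ` \<iota> ` A \<and> b \<in> g ` \<iota> ` A" by blast
  have "?W \<subseteq> X"
  proof -
    have "snd w \<subseteq> X" if "w \<in> C" for w using C cl_verts_sub[of "fst w" "snd w"] that by auto
    then show ?thesis by blast
  qed
  with W obtain g where g: "g \<in> G" "?W \<subseteq> g ` \<iota> ` A"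
    using conf unfolding conformal_def by meson
  obtain k where k: "k \<in> G" "\<And>v. v \<in> X \<Longrightarrow> k (g v) = v" "\<And>v. v \<in> X \<Longrightarrow> g (k v) = v"
    using G_inverse[OF g(1)] by metis
  have "w \<in> lift g ` \<iota>_cl ` A" if w: "w \<in> C" for w
  proof -
    obtain h x where h: "h \<in> G" "x \<in> A" "w = lift h (\<iota>_cl x)"
      using w C unfolding cl_verts_eq by blast
    have V: "h ` \<iota> ` cl x \<subseteq> g ` \<iota> ` A" using w g(2) unfolding h(3) lift_\<iota> by force
    have "(k \<circ> h) ` \<iota> ` cl x \<subseteq> \<iota> ` A"
    proof
      fix z assume "z \<in> (k \<circ> h) ` \<iota> ` cl x"
      then obtain b where b: "z = k b" "b \<in> h ` \<iota> ` cl x" by auto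
      obtain a where "a \<in> A" "b = g (\<iota> a)" using subsetD[OF V b(2)] by auto
      with b(1) show "z \<in> \<iota> ` A" using k(2) \<iota>_in by simp
    qed
    then obtain y where y: "y \<in> A" "(k \<circ> h) (\<iota> x) = \<iota> y" "(k \<circ> h) ` \<iota> ` cl x = \<iota> ` cl y"
      using restrict_cl[OF G_comp[OF k(1) h(1)] h(2)] by metis
    have "w = lift (g \<circ> (k \<circ> h)) (\<iota>_cl x)"
    proof -
      have w': "w \<in> cl_verts" using w C by blast
      have "lift (g \<circ> k) w = lift id w" by (rule lift_cong[OF w']) (simp add: k)
      then show ?thesis unfolding lift_comp h(3) by (cases "lift h (\<iota>_cl x)") (simp add: lift_def)
    qed
    also have "\<dots> = lift g (lift (k \<circ> h) (\<iota>_cl x))" unfolding lift_comp by simp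
    also have "lift (k \<circ> h) (\<iota>_cl x) = \<iota>_cl y" unfolding lift_\<iota> y(2,3) by (simp add: \<iota>_cl_def)
    finally show ?thesis using y(1) by blast
  qed
  then show "\<exists>p\<in>lift ` G. C \<subseteq> p ` \<iota>_cl ` A" using g(1) by blast
qed

end

text \<open>Extend the inverse of \<open>\<iota>\<close> to an injection \<open>j\<close> of \<open>X\<close> into the type of the vertices of \<open>A\<close>, and carry
everything over. The witness must contain \<open>A\<close> itself, so it has to be built in this type.\<close>

lemma (in extension_system) rename_system:
  assumes "infinite (UNIV :: 'a set)"
  obtains Y :: "'a set" and H \<psi> where "extension_system A P Y id H \<psi>" "A \<subseteq> Y"
    and "conformal A X \<iota> G \<Longrightarrow> conformal A Y id H"
    and "\<And>cl. closure_invariant A cl \<iota> G \<Longrightarrow> (\<And>x. x \<in> A \<Longrightarrow> cl x \<subseteq> A) \<Longrightarrow> closure_invariant A cl id H"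
proof -
  have "infinite (UNIV - A)" using assms finite_A by (rule Diff_infinite_finite[rotated])
  then obtain Z :: "'a set" where Z: "finite Z" "card Z = card (X - \<iota> ` A)" "Z \<subseteq> UNIV - A"
    using infinite_arbitrarily_large by metis
  then obtain z where z: "bij_betw z (X - \<iota> ` A) Z"
    using finite_same_card_bij[of "X - \<iota> ` A" Z] finite_X by auto
  define j where "j v = (if v \<in> \<iota> ` A then inv_into A \<iota> v else z v)" for v
  have j\<iota>: "j (\<iota> x) = x" if "x \<in> A" for x using that \<iota>_inj by (simp add: j_def)
  have j_inj: "inj_on j X"
  proof (rule inj_onI)
    fix v w assume *: "v \<in> X" "w \<in> X" "j v = j w"
    have jA: "j u \<in> A \<longleftrightarrow> u \<in> \<iota> ` A" if "u \<in> X" for u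
    proof (cases "u \<in> \<iota> ` A")
      case True
      then show ?thesis using j\<iota> by auto
    next
      case False
      then have "z u \<in> Z" using bij_betwE[OF z] that by blast
      then show ?thesis using False Z(3) by (auto simp: j_def)
    qed
    show "v = w"
    proof (cases "v \<in> \<iota> ` A")
      case True
      moreover have "w \<in> \<iota> ` A" using True * jA by metis
      ultimately show ?thesis using *(3) j\<iota> by auto
    next
      case False
      moreover have "w \<notin> \<iota> ` A" using False * jA by metis
      ultimately show ?thesis using * z by (auto simp: j_def bij_betw_def inj_on_def)
    qed
  qed
  define Y where "Y = j ` X"
  define i where "i = inv_into X j"
  have ij: "i (j v) = v" if "v \<in> X" for v using that j_inj by (simp add: i_def)
  have ji: "j (i y) = y" "i y \<in> X" if "y \<in> Y" for y using that ij by (auto simp: Y_def)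
  have iA: "i x = \<iota> x" if "x \<in> A" for x using ij[OF \<iota>_in[OF that]] j\<iota>[OF that] by simp
  define c where "c g = j \<circ> g \<circ> i" for g
  have c_apply: "c g (j v) = j (g v)" if "v \<in> X" for g v by (simp add: c_def ij that)
  have c_A: "c g x = j (g (\<iota> x))" if "x \<in> A" for g x by (simp add: c_def iA that)
  have AY: "A \<subseteq> Y" using j\<iota> \<iota>_in by (force simp: Y_def)
  \<comment> \<open>Conjugates \<open>j \<circ> g \<circ> i\<close> compose correctly only on \<open>Y\<close>, so all permutations that agree with one of
    them on \<open>Y\<close> are admitted.\<close>
  define H where "H = {p. bij_betw p Y Y \<and> (\<exists>g\<in>G. \<forall>v\<in>X. p (j v) = j (g v))}"
  have HE: "\<exists>g\<in>G. \<forall>v\<in>X. p (j v) = j (g v)" if "p \<in> H" for p using that by (auto simp: H_def)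
  have c_in: "c g \<in> H" if g: "g \<in> G" for g
  proof -
    have "bij_betw j X Y" unfolding Y_def using j_inj by (rule inj_on_imp_bij_betw)
    moreover from this have "bij_betw i Y X" unfolding i_def by (rule bij_betw_inv_into)
    ultimately have "bij_betw (c g) Y Y"
      unfolding c_def using G_bij[OF g] by (meson bij_betw_trans)
    then show ?thesis using c_apply g unfolding H_def by blast
  qed
  have sys: "extension_system A P Y id H (\<lambda>f. c (\<phi> f))"
  proof
    show "finite Y" using finite_X by (simp add: Y_def)
    show "id x \<in> Y" if "x \<in> A" for x using AY that by auto
    show "id \<in> H" using bexI[OF _ G_id, of "\<lambda>g. \<forall>v\<in>X. id (j v) = j (g v)"] by (simp add: H_def)
    show "bij_betw p Y Y" if "p \<in> H" for p using that by (simp add: H_def)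
    show "p \<circ> q \<in> H" if "p \<in> H" "q \<in> H" for p q
    proof -
      from that obtain g h where g: "bij_betw p Y Y" "g \<in> G" "\<forall>v\<in>X. p (j v) = j (g v)"
        and h: "bij_betw q Y Y" "h \<in> G" "\<forall>v\<in>X. q (j v) = j (h v)" by (auto simp: H_def)
      have "\<forall>v\<in>X. (p \<circ> q) (j v) = j ((g \<circ> h) v)" using g h G_in by simp
      then show ?thesis using bij_betw_trans[OF h(1) g(1)] G_comp[OF g(2) h(2)] unfolding H_def by blast
    qed
    show "\<exists>k\<in>H. \<forall>y\<in>Y. k (p y) = y" if "p \<in> H" for p
    proof -
      from that obtain g where g: "g \<in> G" "\<forall>v\<in>X. p (j v) = j (g v)" by (auto simp: H_def)
      obtain k where k: "k \<in> G" "\<forall>v\<in>X. k (g v) = v" using G_inv[OF g(1)] by blast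
      have "c k (p (j v)) = j v" if "v \<in> X" for v
        using g k c_apply[OF G_in[OF g(1) that]] that by simp
      then show ?thesis using c_in[OF k(1)] by (auto simp: Y_def)
    qed
    show "c (\<phi> f) \<in> H" if "f \<in> P" for f using c_in \<phi>_in that by blast
    show "c (\<phi> f) (id x) = id y" if "f \<in> P" "f x = Some y" for f x y
    proof -
      have "x \<in> A" "y \<in> A" using that P_dom P_ran by (auto intro: ranI)
      then show ?thesis using \<phi>_extends[OF that] c_A j\<iota> by simp
    qed
    show "c (\<phi> f) (c (\<phi> e) y) = c (\<phi> (f \<circ>\<^sub>m e)) y"
      if "e \<in> P" "f \<in> P" "f \<circ>\<^sub>m e \<in> P" "dom e = dom (f \<circ>\<^sub>m e)" "ran e = dom f"
        "ran f = ran (f \<circ>\<^sub>m e)" "y \<in> Y" for e f y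
      using \<phi>_coherent[OF that(1-6) ji(2)[OF that(7)]] ij[OF G_in[OF \<phi>_in[OF that(1)] ji(2)[OF that(7)]]]
      by (simp add: c_def)
    show "\<exists>f\<in>P. \<forall>x\<in>A. \<forall>y\<in>A. p (id x) = id y \<longrightarrow> f x = Some y" if "p \<in> H" for p
    proof -
      from that obtain g where g: "g \<in> G" "\<forall>v\<in>X. p (j v) = j (g v)" by (auto simp: H_def)
      have "g (\<iota> x) = \<iota> y" if "x \<in> A" "y \<in> A" "p x = y" for x y
      proof -
        have "j (g (\<iota> x)) = j (\<iota> y)" using g(2) \<iota>_in that j\<iota> by metis
        then show ?thesis using j_inj G_in[OF g(1) \<iota>_in] \<iota>_in that by (meson inj_onD)
      qed
      then show ?thesis using G_restrict[OF g(1)] by (metis id_apply)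
    qed
  qed auto
  have copy: "p ` S = j ` g ` \<iota> ` S" if "\<forall>v\<in>X. p (j v) = j (g v)" "S \<subseteq> A" for p g S
  proof -
    have "p x = j (g (\<iota> x))" if "x \<in> S" for x
      using \<open>\<forall>v\<in>X. p (j v) = j (g v)\<close> \<open>S \<subseteq> A\<close> that \<iota>_in j\<iota> by (metis subsetD)
    then show ?thesis by (simp add: image_image)
  qed
  have copy_c: "c g ` A = j ` g ` \<iota> ` A" for g using copy[of "c g" g A] c_apply by simp
  have conf: "conformal A Y id H" if c: "conformal A X \<iota> G"
    unfolding conformal_def
  proof (intro allI impI)
    fix C assume C: "C \<subseteq> Y"
      and clique: "\<forall>v\<in>C. \<forall>w\<in>C. \<exists>p\<in>H. v \<in> p ` id ` A \<and> w \<in> p ` id ` A"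
    have iC: "\<exists>g\<in>G. i v \<in> g ` \<iota> ` A \<and> i w \<in> g ` \<iota> ` A" if "v \<in> C" "w \<in> C" for v w
    proof -
      have "\<exists>p\<in>H. v \<in> p ` A \<and> w \<in> p ` A" using clique that by simp
      then obtain p where p: "p \<in> H" "v \<in> p ` A" "w \<in> p ` A" by meson
      obtain g where g: "g \<in> G" "\<forall>v\<in>X. p (j v) = j (g v)" using HE[OF p(1)] by blast
      have pA: "p ` A = j ` g ` \<iota> ` A" using copy[OF g(2)] by simp
      have iu: "i u \<in> g ` \<iota> ` A" if "u \<in> j ` g ` \<iota> ` A" for u
      proof -
        obtain a where "a \<in> A" "u = j (g (\<iota> a))" using \<open>u \<in> j ` g ` \<iota> ` A\<close> by auto
        then show ?thesis using ij[OF G_in[OF g(1) \<iota>_in]] by simp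
      qed
      show ?thesis using iu p(2,3) unfolding pA by (intro bexI[OF _ g(1)]) simp
    qed
    have "i ` C \<subseteq> X" using C ji by blast
    moreover have "\<forall>a\<in>i ` C. \<forall>b\<in>i ` C. \<exists>g\<in>G. a \<in> g ` \<iota> ` A \<and> b \<in> g ` \<iota> ` A" using iC by simp
    ultimately obtain g where g: "g \<in> G" "i ` C \<subseteq> g ` \<iota> ` A"
      using c unfolding conformal_def by meson
    have "C \<subseteq> j ` i ` C" using C ji(1) by (force simp: image_image)
    also have "\<dots> \<subseteq> j ` g ` \<iota> ` A" using g(2) by (rule image_mono)
    finally have "C \<subseteq> c g ` id ` A" using copy_c[of g] by simp
    then show "\<exists>p\<in>H. C \<subseteq> p ` id ` A" using c_in[OF g(1)] by blast
  qed
  have "closure_invariant A cl id H"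
    if inv: "closure_invariant A cl \<iota> G" and cl: "\<And>x. x \<in> A \<Longrightarrow> cl x \<subseteq> A" for cl
    unfolding closure_invariant_def
  proof (intro ballI impI)
    fix p x y assume p: "p \<in> H" and xy: "x \<in> A" "y \<in> A" "p (id x) = id y"
    obtain g where g: "g \<in> G" "\<forall>v\<in>X. p (j v) = j (g v)" using HE[OF p] by blast
    have "j (g (\<iota> x)) = j (\<iota> y)" using g(2) \<iota>_in xy j\<iota> by (metis id_apply)
    then have "g (\<iota> x) = \<iota> y" using j_inj G_in[OF g(1) \<iota>_in] \<iota>_in xy by (meson inj_onD)
    then have "g ` \<iota> ` cl x = \<iota> ` cl y" by (rule inv[unfolded closure_invariant_def, rule_format, OF g(1) xy(1,2)])
    then have "p ` cl x = j ` \<iota> ` cl y" using copy[OF g(2) cl[OF xy(1)]] by simp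
    also have "\<dots> = (\<lambda>x. x) ` cl y"
      unfolding image_image using j\<iota> cl[OF xy(2)] by (intro image_cong) auto
    finally show "p ` id ` cl x = id ` cl y" by simp
  qed
  with sys AY conf show thesis by (intro that[of Y H "\<lambda>f. c (\<phi> f)"]) blast+
qed

text \<open>The closure step comes last. Relabelling after it would destroy \<open>closure_invariant\<close>, since the labels of
a vertex do not determine the labels of the vertices in its closure.\<close>

lemma (in partial_bijections) exists_conformal_system:
  fixes cl :: "'a \<Rightarrow> 'a set"
  assumes inf: "infinite (UNIV :: 'a set)"
    and cl_refl: "\<And>x. x \<in> A \<Longrightarrow> x \<in> cl x" and cl_in: "\<And>x. x \<in> A \<Longrightarrow> cl x \<subseteq> A"
    and cl_trans: "\<And>x y. x \<in> A \<Longrightarrow> y \<in> cl x \<Longrightarrow> cl y \<subseteq> cl x"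
    and P_cl: "\<And>f x y. f \<in> P \<Longrightarrow> f x = Some y \<Longrightarrow>
      cl x \<subseteq> dom f \<and> (\<lambda>z. the (f z)) ` cl x = cl y"
  obtains Y G \<phi> where "extension_system A P Y id G \<phi>" "A \<subseteq> Y" "conformal A Y id G"
    "closure_invariant A cl id G"
proof -
  interpret v: extension_system A P vals val_of val_sym val_ext by (rule extension_system_vals)
  interpret l: extension_system A P v.labelled v.\<iota>_lab v.lab_sym v.lab_ext by (rule v.lab_system)
  interpret c: conformal_system A P v.labelled v.\<iota>_lab v.lab_sym v.lab_ext cl
    by unfold_locales (fact v.lab_conformal cl_refl cl_in cl_trans P_cl)+
  interpret r: extension_system A P c.cl_verts c.\<iota>_cl "c.lift ` v.lab_sym" "\<lambda>f. c.lift (v.lab_ext f)"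
    by (rule c.closure_system)
  obtain Y H \<psi> where Y: "extension_system A P Y id H \<psi>" "A \<subseteq> Y"
    and conf: "conformal A c.cl_verts c.\<iota>_cl (c.lift ` v.lab_sym) \<Longrightarrow> conformal A Y id H"
    and clos: "\<And>cl. closure_invariant A cl c.\<iota>_cl (c.lift ` v.lab_sym) \<Longrightarrow>
      (\<And>x. x \<in> A \<Longrightarrow> cl x \<subseteq> A) \<Longrightarrow> closure_invariant A cl id H"
    using r.rename_system[OF inf] by metis
  show thesis
    using that[OF Y conf[OF c.closure_conformal] clos[OF c.closure_closure_invariant cl_in]] .
qed

section \<open>Partial automorphisms of unary structures\<close>

definition unary_language :: "('r, 'f) language \<Rightarrow> bool" where
  "unary_language L \<longleftrightarrow> (\<forall>F\<in>funs L. fun_arity L F = 1)"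

definition induced :: "('r, 'f, 'a) struct \<Rightarrow> 'a set \<Rightarrow> ('r, 'f, 'a) struct" where
  "induced A S = \<lparr>verts = S, rel = (\<lambda>R. {xs \<in> rel A R. set xs \<subseteq> S}), fn = fn A\<rparr>"

definition closed_in :: "('r, 'f) language \<Rightarrow> ('r, 'f, 'a) struct \<Rightarrow> 'a set \<Rightarrow> bool" where
  "closed_in L A S \<longleftrightarrow> S \<subseteq> verts A \<and> (\<forall>F\<in>funs L. \<forall>x\<in>S. fn A F [x] \<subseteq> S)"

lemma tuples_1: "tuples X (Suc 0) = (\<lambda>x. [x]) ` X"
  by (auto simp: tuples_def length_Suc_conv)

lemma embedding_unary:
  assumes "unary_language L"
  shows "embedding L f A B \<longleftrightarrow> L_structure L A \<and> L_structure L B \<and>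
     f ` verts A \<subseteq> verts B \<and> inj_on f (verts A) \<and>
     (\<forall>R\<in>rels L. \<forall>xs\<in>tuples (verts A) (rel_arity L R). xs \<in> rel A R \<longleftrightarrow> map f xs \<in> rel B R) \<and>
     (\<forall>F\<in>funs L. \<forall>x\<in>verts A. f ` fn A F [x] = fn B F [f x])"
  using assms unfolding embedding_def unary_language_def by (simp add: tuples_1)

lemma L_structure_unary:
  assumes "unary_language L"
  shows "L_structure L A \<longleftrightarrow> (\<forall>R\<in>rels L. rel A R \<subseteq> tuples (verts A) (rel_arity L R)) \<and>
     (\<forall>F\<in>funs L. \<forall>x\<in>verts A. fn A F [x] \<subseteq> verts A)"
  using assms unfolding L_structure_def unary_language_def by (simp add: tuples_1)

lemma substructure_induced:
  assumes "unary_language L" "L_structure L A" "closed_in L A S"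
  shows "substructure L (induced A S) A"
proof -
  have "L_structure L (induced A S)"
    using assms by (auto simp: L_structure_unary induced_def closed_in_def tuples_def)
  then show ?thesis
    using assms unfolding substructure_def embedding_unary[OF assms(1)]
    by (auto simp: induced_def closed_in_def tuples_def)
qed

lemma substructure_closed:
  assumes "unary_language L" "substructure L D A"
  shows "closed_in L A (verts D)"
proof -
  have "verts D \<subseteq> verts A" "\<forall>F\<in>funs L. \<forall>x\<in>verts D. fn D F [x] = fn A F [x]"
    and "\<forall>F\<in>funs L. \<forall>x\<in>verts D. fn D F [x] \<subseteq> verts D"
    using assms(2) unfolding substructure_def embedding_unary[OF assms(1)] L_structure_unary[OF assms(1)]
      image_id id_apply by blast+
  then show ?thesis unfolding closed_in_def by simp
qed

text \<open>This form mentions no structures on the domain and the range; composition and inversion of partial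
automorphisms are read off from it.\<close>

lemma partial_automorphism_iff:
  assumes U: "unary_language L" and A: "L_structure L A"
  shows "partial_automorphism L A f \<longleftrightarrow>
     closed_in L A (dom f) \<and> ran f \<subseteq> verts A \<and> inj_on (\<lambda>x. the (f x)) (dom f) \<and>
     (\<forall>R\<in>rels L. \<forall>xs\<in>tuples (dom f) (rel_arity L R). xs \<in> rel A R \<longleftrightarrow> map (\<lambda>x. the (f x)) xs \<in> rel A R) \<and>
     (\<forall>F\<in>funs L. \<forall>x\<in>dom f. (\<lambda>x. the (f x)) ` fn A F [x] = fn A F [the (f x)])"
    (is "?l \<longleftrightarrow> ?r")
proof
  let ?f = "\<lambda>x. the (f x)"
  assume ?l
  then obtain D E where D: "substructure L D A" and E: "substructure L E A"
    and df: "dom f = verts D" "ran f = verts E" and em: "embedding L ?f D E"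
    unfolding partial_automorphism_def isomorphism_def by blast
  have sub: "verts D \<subseteq> verts A" "verts E \<subseteq> verts A" and
    relD: "\<And>R xs. R \<in> rels L \<Longrightarrow> xs \<in> tuples (verts D) (rel_arity L R) \<Longrightarrow> xs \<in> rel D R \<longleftrightarrow> xs \<in> rel A R" and
    relE: "\<And>R xs. R \<in> rels L \<Longrightarrow> xs \<in> tuples (verts E) (rel_arity L R) \<Longrightarrow> xs \<in> rel E R \<longleftrightarrow> xs \<in> rel A R" and
    fnD: "\<And>F x. F \<in> funs L \<Longrightarrow> x \<in> verts D \<Longrightarrow> fn D F [x] = fn A F [x]" and
    fnE: "\<And>F x. F \<in> funs L \<Longrightarrow> x \<in> verts E \<Longrightarrow> fn E F [x] = fn A F [x]"
    using D E unfolding substructure_def embedding_unary[OF U] by auto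
  have em_rel: "xs \<in> rel D R \<longleftrightarrow> map ?f xs \<in> rel E R"
    if "R \<in> rels L" "xs \<in> tuples (verts D) (rel_arity L R)" for R xs
    using em that unfolding embedding_unary[OF U] by blast
  have em_fn: "?f ` fn D F [x] = fn E F [?f x]" if "F \<in> funs L" "x \<in> verts D" for F x
    using em that unfolding embedding_unary[OF U] by blast
  have fE: "?f x \<in> verts E" if "x \<in> verts D" for x
    using em that unfolding embedding_unary[OF U] by blast
  have mE: "map ?f xs \<in> tuples (verts E) n" if "xs \<in> tuples (verts D) n" for xs n
    using that fE by (auto simp: tuples_def)
  show ?r
  proof (intro conjI ballI)
    show "closed_in L A (dom f)" using substructure_closed[OF U D] df by simp
    show "ran f \<subseteq> verts A" using sub df by simp
    show "inj_on ?f (dom f)" using em df unfolding embedding_unary[OF U] by simp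
    show "xs \<in> rel A R \<longleftrightarrow> map ?f xs \<in> rel A R"
      if "R \<in> rels L" "xs \<in> tuples (dom f) (rel_arity L R)" for R xs
      using em_rel[OF that(1), of xs] that relD[OF that(1), of xs] relE[OF that(1) mE, of xs] df
      by simp
    show "?f ` fn A F [x] = fn A F [?f x]" if "F \<in> funs L" "x \<in> dom f" for F x
      using em_fn[OF that(1), of x] that fnD[OF that(1), of x] fnE[OF that(1) fE, of x] df
      by simp
  qed
next
  let ?f = "\<lambda>x. the (f x)"
  assume r: ?r
  have im: "?f ` dom f = ran f"
  proof -
    have "(\<exists>x\<in>dom f. z = the (f x)) \<longleftrightarrow> (\<exists>x. f x = Some z)" for z
      by (auto simp: dom_def)
    then show ?thesis by (auto simp: ran_def image_iff)
  qed
  let ?D = "induced A (dom f)" and ?E = "induced A (ran f)"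
  have D: "substructure L ?D A" using substructure_induced[OF U A] r by blast
  have "closed_in L A (ran f)"
    unfolding closed_in_def
  proof (intro conjI ballI)
    show "ran f \<subseteq> verts A" using r by blast
    fix F y assume F: "F \<in> funs L" and "y \<in> ran f"
    then obtain x where x: "x \<in> dom f" "y = ?f x" unfolding im[symmetric] by blast
    have "fn A F [x] \<subseteq> dom f" using r F x unfolding closed_in_def by blast
    then have "?f ` fn A F [x] \<subseteq> ran f" unfolding im[symmetric] by (rule image_mono)
    then show "fn A F [y] \<subseteq> ran f" using r F x by simp
  qed
  then have E: "substructure L ?E A" by (rule substructure_induced[OF U A])
  have "embedding L ?f ?D ?E"
    unfolding embedding_unary[OF U]
  proof (intro conjI ballI)
    show "L_structure L ?D" "L_structure L ?E" using D E by (auto simp: substructure_def embedding_def)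
    show "?f ` verts ?D \<subseteq> verts ?E" using im by (simp add: induced_def)
    show "inj_on ?f (verts ?D)" using r by (simp add: induced_def)
    show "xs \<in> rel ?D R \<longleftrightarrow> map ?f xs \<in> rel ?E R"
      if "R \<in> rels L" "xs \<in> tuples (verts ?D) (rel_arity L R)" for R xs
    proof -
      have "xs \<in> tuples (dom f) (rel_arity L R)" using that by (simp add: induced_def)
      moreover from this have "set xs \<subseteq> dom f" by (simp add: tuples_def)
      moreover from this have "set (map ?f xs) \<subseteq> ran f"
        unfolding set_map im[symmetric] by (rule image_mono)
      ultimately show ?thesis using r that(1) by (simp add: induced_def)
    qed
    show "?f ` fn ?D F [x] = fn ?E F [?f x]" if "F \<in> funs L" "x \<in> verts ?D" for F x
      using that r by (simp add: induced_def)
  qed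
  then show ?l
    unfolding partial_automorphism_def isomorphism_def using D E
    by (intro exI[of _ ?D] exI[of _ ?E]) (simp add: induced_def)
qed

definition arrows :: "('r, 'f) language \<Rightarrow> ('r, 'f, 'a) struct \<Rightarrow> ('a \<times> 'a) set" where
  "arrows L A = {(x, y). \<exists>F\<in>funs L. y \<in> fn A F [x]}"

definition closure :: "('r, 'f) language \<Rightarrow> ('r, 'f, 'a) struct \<Rightarrow> 'a \<Rightarrow> 'a set" where
  "closure L A x = (arrows L A)\<^sup>* `` {x}"

lemma closure_refl: "x \<in> closure L A x"
  by (simp add: closure_def)

lemma closure_trans: "y \<in> closure L A x \<Longrightarrow> closure L A y \<subseteq> closure L A x"
  by (auto simp: closure_def)

lemma fn_closure: "F \<in> funs L \<Longrightarrow> fn A F [x] \<subseteq> closure L A x"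
  by (auto simp: closure_def arrows_def)

lemma closed_closure: "closed_in L A S \<Longrightarrow> x \<in> S \<Longrightarrow> closure L A x \<subseteq> S"
proof
  fix y assume S: "closed_in L A S" "x \<in> S" and "y \<in> closure L A x"
  then have "(x, y) \<in> (arrows L A)\<^sup>*" by (simp add: closure_def)
  then show "y \<in> S"
    by (induction rule: rtrancl_induct) (use S in \<open>auto simp: closed_in_def arrows_def\<close>)
qed

lemma closure_in: "unary_language L \<Longrightarrow> L_structure L A \<Longrightarrow> x \<in> verts A \<Longrightarrow> closure L A x \<subseteq> verts A"
  using closed_closure[of L A "verts A" x] by (simp add: closed_in_def L_structure_unary)

lemma partial_automorphism_closure:
  assumes U: "unary_language L" and A: "L_structure L A" and f: "partial_automorphism L A f"
    and xy: "f x = Some y"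
  shows "closure L A x \<subseteq> dom f" and "(\<lambda>z. the (f z)) ` closure L A x = closure L A y"
proof -
  let ?f = "\<lambda>z. the (f z)"
  have cf: "closed_in L A (dom f)" and
    fnf: "\<And>F x. F \<in> funs L \<Longrightarrow> x \<in> dom f \<Longrightarrow> ?f ` fn A F [x] = fn A F [?f x]"
    using f unfolding partial_automorphism_iff[OF U A] by blast+
  have x: "x \<in> dom f" using xy by blast
  show sub: "closure L A x \<subseteq> dom f" using closed_closure[OF cf x] .
  show "?f ` closure L A x = closure L A y"
  proof (rule equalityI; rule subsetI)
    fix w assume "w \<in> ?f ` closure L A x"
    then obtain z where z: "(x, z) \<in> (arrows L A)\<^sup>*" "w = ?f z" by (auto simp: closure_def)
    from z(1) have "(y, ?f z) \<in> (arrows L A)\<^sup>*"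
    proof (induction rule: rtrancl_induct)
      case base then show ?case using xy by simp
    next
      case (step u v)
      then obtain F where F: "F \<in> funs L" "v \<in> fn A F [u]" by (auto simp: arrows_def)
      have "u \<in> dom f" using sub step(1) by (auto simp: closure_def)
      then have "?f v \<in> fn A F [?f u]" using fnf[OF F(1)] F(2) by blast
      then have "(?f u, ?f v) \<in> arrows L A" using F(1) by (auto simp: arrows_def)
      with step.IH show ?case by (rule rtrancl_into_rtrancl)
    qed
    then show "w \<in> closure L A y" using z(2) by (simp add: closure_def)
  next
    fix w assume "w \<in> closure L A y"
    then have "(y, w) \<in> (arrows L A)\<^sup>*" by (simp add: closure_def)
    then show "w \<in> ?f ` closure L A x"
    proof (induction rule: rtrancl_induct)
      case base then show ?case using xy closure_refl[of x L A] by (force simp: image_iff)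
    next
      case (step u v)
      then obtain z where z: "z \<in> closure L A x" "u = ?f z" by blast
      obtain F where F: "F \<in> funs L" "v \<in> fn A F [u]" using step(2) by (auto simp: arrows_def)
      have "z \<in> dom f" using sub z(1) by blast
      then have "fn A F [u] = ?f ` fn A F [z]" using fnf[OF F(1)] z(2) by simp
      also have "\<dots> \<subseteq> ?f ` closure L A x"
        by (intro image_mono subset_trans[OF fn_closure[OF F(1)] closure_trans[OF z(1)]])
      finally show ?case using F(2) by (rule subsetD)
    qed
  qed
qed

lemma partial_automorphism_bijections:
  assumes U: "unary_language L" and fin: "finite_structure L A"
  shows "partial_bijections (verts A) {f. partial_automorphism L A f}"
proof -
  have A: "L_structure L A" "finite (verts A)" using fin by (auto simp: finite_structure_def)
  note iff = partial_automorphism_iff[OF U A(1)]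
  show ?thesis
  proof
    show "finite (verts A)" by (rule A)
    show "dom f \<subseteq> verts A" if "f \<in> {f. partial_automorphism L A f}" for f
      using that by (simp add: iff closed_in_def)
    show "ran f \<subseteq> verts A" if "f \<in> {f. partial_automorphism L A f}" for f
      using that by (simp add: iff)
    show "x = y" if "f \<in> {f. partial_automorphism L A f}" "f x = Some z" "f y = Some z" for f x y z
    proof -
      have "inj_on (\<lambda>x. the (f x)) (dom f)" using that(1) by (simp add: iff)
      then show ?thesis by (rule inj_onD) (use that in auto)
    qed
    show "\<exists>i\<in>{f. partial_automorphism L A f}. \<forall>x\<in>verts A. i x = Some x"
    proof
      let ?i = "\<lambda>x. if x \<in> verts A then Some x else None"
      have d: "dom ?i = verts A" "ran ?i \<subseteq> verts A" by (auto simp: dom_def ran_def split: if_splits)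
      have m: "map (\<lambda>x. the (?i x)) xs = xs" if "set xs \<subseteq> verts A" for xs
        using that by (auto intro!: map_idI)
      have fnA: "fn A F [x] \<subseteq> verts A" if "F \<in> funs L" "x \<in> verts A" for F x
        using A(1) that by (simp add: L_structure_unary[OF U])
      have im: "(\<lambda>x. the (?i x)) ` S = S" if "S \<subseteq> verts A" for S
        using that by force
      show "?i \<in> {f. partial_automorphism L A f}"
        unfolding mem_Collect_eq iff d
      proof (intro conjI ballI)
        show "closed_in L A (verts A)" using fnA by (simp add: closed_in_def)
        show "ran ?i \<subseteq> verts A" by (rule d)
        show "inj_on (\<lambda>x. the (?i x)) (verts A)" by (simp add: inj_on_def)
        show "xs \<in> rel A R \<longleftrightarrow> map (\<lambda>x. the (?i x)) xs \<in> rel A R"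
          if "xs \<in> tuples (verts A) (rel_arity L R)" for R xs
          using m[of xs] that by (simp add: tuples_def)
        show "(\<lambda>x. the (?i x)) ` fn A F [x] = fn A F [the (?i x)]"
          if "F \<in> funs L" "x \<in> verts A" for F x
          using im[OF fnA[OF that]] that by simp
      qed
      show "\<forall>x\<in>verts A. ?i x = Some x" by simp
    qed
    show "g \<circ>\<^sub>m f \<in> {f. partial_automorphism L A f}"
      if "f \<in> {f. partial_automorphism L A f}" "g \<in> {f. partial_automorphism L A f}" for f g
    proof -
      let ?f = "\<lambda>x. the (f x)" and ?g = "\<lambda>x. the (g x)" and ?h = "\<lambda>x. the ((g \<circ>\<^sub>m f) x)"
      have f: "closed_in L A (dom f)" "ran f \<subseteq> verts A" "inj_on ?f (dom f)"
        "\<And>R xs. R \<in> rels L \<Longrightarrow> xs \<in> tuples (dom f) (rel_arity L R) \<Longrightarrow> xs \<in> rel A R \<longleftrightarrow> map ?f xs \<in> rel A R"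
        "\<And>F x. F \<in> funs L \<Longrightarrow> x \<in> dom f \<Longrightarrow> ?f ` fn A F [x] = fn A F [?f x]"
        using that(1) unfolding mem_Collect_eq iff by blast+
      have g: "closed_in L A (dom g)" "ran g \<subseteq> verts A" "inj_on ?g (dom g)"
        "\<And>R xs. R \<in> rels L \<Longrightarrow> xs \<in> tuples (dom g) (rel_arity L R) \<Longrightarrow> xs \<in> rel A R \<longleftrightarrow> map ?g xs \<in> rel A R"
        "\<And>F x. F \<in> funs L \<Longrightarrow> x \<in> dom g \<Longrightarrow> ?g ` fn A F [x] = fn A F [?g x]"
        using that(2) unfolding mem_Collect_eq iff by blast+
      have D: "x \<in> dom (g \<circ>\<^sub>m f) \<longleftrightarrow> x \<in> dom f \<and> ?f x \<in> dom g" for x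
        by (cases "f x") (auto simp: map_comp_def)
      have h: "?h x = ?g (?f x)" if "x \<in> dom f" for x
        using that by (auto simp: map_comp_def)
      show ?thesis
        unfolding mem_Collect_eq iff
      proof (intro conjI ballI)
        show "closed_in L A (dom (g \<circ>\<^sub>m f))"
          unfolding closed_in_def
        proof (intro conjI ballI subsetI)
          show "x \<in> verts A" if "x \<in> dom (g \<circ>\<^sub>m f)" for x
            using that f(1) unfolding D closed_in_def by blast
          show "y \<in> dom (g \<circ>\<^sub>m f)" if "F \<in> funs L" "x \<in> dom (g \<circ>\<^sub>m f)" "y \<in> fn A F [x]" for F x y
            using that f(1) f(5)[of F x] g(1) unfolding D closed_in_def by blast
        qed
        show "ran (g \<circ>\<^sub>m f) \<subseteq> verts A"
        proof -
          have "ran (g \<circ>\<^sub>m f) \<subseteq> ran g" by (auto simp: ran_def map_comp_def split: option.splits)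
          then show ?thesis using g(2) by blast
        qed
        show "inj_on ?h (dom (g \<circ>\<^sub>m f))"
        proof (rule inj_onI)
          fix x y assume *: "x \<in> dom (g \<circ>\<^sub>m f)" "y \<in> dom (g \<circ>\<^sub>m f)" "?h x = ?h y"
          then have "?g (?f x) = ?g (?f y)" using h unfolding D by metis
          then show "x = y" using * f(3) g(3) unfolding D by (metis inj_onD)
        qed
        show "xs \<in> rel A R \<longleftrightarrow> map ?h xs \<in> rel A R"
          if "R \<in> rels L" "xs \<in> tuples (dom (g \<circ>\<^sub>m f)) (rel_arity L R)" for R xs
        proof -
          have xs: "xs \<in> tuples (dom f) (rel_arity L R)" "map ?f xs \<in> tuples (dom g) (rel_arity L R)"
          proof -
            have "x \<in> dom f \<and> ?f x \<in> dom g" if "x \<in> set xs" for x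
              using \<open>xs \<in> tuples _ _\<close> that D unfolding tuples_def by blast
            moreover have "length xs = rel_arity L R" using that(2) by (simp add: tuples_def)
            ultimately show "xs \<in> tuples (dom f) (rel_arity L R)"
              "map ?f xs \<in> tuples (dom g) (rel_arity L R)"
              unfolding tuples_def by auto
          qed
          have "map ?h xs = map ?g (map ?f xs)" using xs(1) h by (auto simp: tuples_def)
          then show ?thesis using f(4)[OF that(1) xs(1)] g(4)[OF that(1) xs(2)] by (simp only:)
        qed
        show "?h ` fn A F [x] = fn A F [?h x]" if "F \<in> funs L" "x \<in> dom (g \<circ>\<^sub>m f)" for F x
        proof -
          have x: "x \<in> dom f" "?f x \<in> dom g" using that(2) D by auto
          have "fn A F [x] \<subseteq> dom f" using f(1) that(1) x unfolding closed_in_def by blast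
          then have "?h ` fn A F [x] = ?g ` ?f ` fn A F [x]"
            using h unfolding image_image by (intro image_cong) auto
          then show ?thesis using f(5)[OF that(1) x(1)] g(5)[OF that(1) x(2)] h[OF x(1)] by simp
        qed
      qed
    qed
    show "\<exists>k\<in>{f. partial_automorphism L A f}. \<forall>x y. f x = Some y \<longrightarrow> k y = Some x"
      if f: "f \<in> {f. partial_automorphism L A f}" for f
    proof -
      let ?f = "\<lambda>x. the (f x)"
      have f: "closed_in L A (dom f)" "ran f \<subseteq> verts A" "inj_on ?f (dom f)"
        "\<And>R xs. R \<in> rels L \<Longrightarrow> xs \<in> tuples (dom f) (rel_arity L R) \<Longrightarrow> xs \<in> rel A R \<longleftrightarrow> map ?f xs \<in> rel A R"
        "\<And>F x. F \<in> funs L \<Longrightarrow> x \<in> dom f \<Longrightarrow> ?f ` fn A F [x] = fn A F [?f x]"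
        using f unfolding mem_Collect_eq iff by blast+
      define k where "k y = (if y \<in> ran f then Some (inv_into (dom f) ?f y) else None)" for y
      have im: "?f ` dom f = ran f"
      proof -
        have "(\<exists>x\<in>dom f. z = the (f x)) \<longleftrightarrow> (\<exists>x. f x = Some z)" for z
          by (auto simp: dom_def)
        then show ?thesis by (auto simp: ran_def image_iff)
      qed
      have kf: "k (?f x) = Some x" if "x \<in> dom f" for x
        using that inv_into_f_f[OF f(3) that] im unfolding k_def by (metis imageI)
      have dk: "dom k = ran f" by (auto simp: k_def split: if_splits)
      have k_f: "the (k y) \<in> dom f" "?f (the (k y)) = y" if "y \<in> ran f" for y
      proof -
        from that obtain x where x: "x \<in> dom f" "y = ?f x" unfolding im[symmetric] by blast
        then show "the (k y) \<in> dom f" "?f (the (k y)) = y" using kf[OF x(1)] by simp_all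
      qed
      have mk: "map ?f (map (\<lambda>y. the (k y)) ys) = ys" if "set ys \<subseteq> ran f" for ys
        using that k_f(2) by (auto intro!: map_idI)
      have "partial_automorphism L A k"
        unfolding iff dk
      proof (intro conjI ballI)
        show "closed_in L A (ran f)"
          unfolding closed_in_def
        proof (intro conjI ballI)
          show "ran f \<subseteq> verts A" by (rule f)
          fix F y assume F: "F \<in> funs L" and "y \<in> ran f"
          then obtain x where x: "x \<in> dom f" "y = ?f x" unfolding im[symmetric] by blast
          have "fn A F [x] \<subseteq> dom f" using f(1) F x unfolding closed_in_def by blast
          then have "?f ` fn A F [x] \<subseteq> ran f" unfolding im[symmetric] by (rule image_mono)
          then show "fn A F [y] \<subseteq> ran f" using f(5) F x by simp
        qed
        show "ran k \<subseteq> verts A"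
        proof
          fix x assume "x \<in> ran k"
          then obtain y where "k y = Some x" by (auto simp: ran_def)
          moreover from this have "y \<in> ran f" using dk by blast
          ultimately have "x \<in> dom f" using k_f(1)[of y] by simp
          then show "x \<in> verts A" using f(1) unfolding closed_in_def by blast
        qed
        show "inj_on (\<lambda>y. the (k y)) (ran f)"
          by (rule inj_on_inverseI[where g = ?f]) (rule k_f(2))
        show "ys \<in> rel A R \<longleftrightarrow> map (\<lambda>y. the (k y)) ys \<in> rel A R"
          if "R \<in> rels L" "ys \<in> tuples (ran f) (rel_arity L R)" for R ys
        proof -
          have ys: "set ys \<subseteq> ran f" using that(2) by (simp add: tuples_def)
          then have "map (\<lambda>y. the (k y)) ys \<in> tuples (dom f) (rel_arity L R)"
            using that(2) k_f(1) unfolding tuples_def by auto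
          from f(4)[OF that(1) this] show ?thesis unfolding mk[OF ys] by simp
        qed
        show "(\<lambda>y. the (k y)) ` fn A F [y] = fn A F [the (k y)]" if "F \<in> funs L" "y \<in> ran f" for F y
        proof -
          let ?x = "the (k y)"
          have x: "?x \<in> dom f" "?f ?x = y" using k_f[OF that(2)] by auto
          have sub: "fn A F [?x] \<subseteq> dom f" using f(1) that(1) x(1) unfolding closed_in_def by blast
          have "fn A F [y] = ?f ` fn A F [?x]" using f(5)[OF that(1) x(1)] x(2) by simp
          then show ?thesis using kf sub by (force simp: image_image)
        qed
      qed
      moreover have "\<forall>x y. f x = Some y \<longrightarrow> k y = Some x"
      proof (intro allI impI)
        fix x y assume "f x = Some y"
        then show "k y = Some x" using kf[of x] by auto
      qed
      ultimately show ?thesis by blast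
    qed
  qed
qed

section \<open>Irreducible unary structures\<close>

text \<open>Since all functions are unary, a tuple meeting both sides of a free amalgam has length at least two, and
only the relations can obstruct freeness.\<close>

lemma reducible_cover:
  assumes U: "unary_language L" and C: "L_structure L C"
    and S: "closed_in L C S" "S \<noteq> verts C" and T: "closed_in L C T" "T \<noteq> verts C"
    and cover: "S \<union> T = verts C"
    and rel: "\<And>R xs. R \<in> rels L \<Longrightarrow> xs \<in> rel C R \<Longrightarrow> set xs \<subseteq> S \<or> set xs \<subseteq> T"
  shows "\<not> irreducible L C"
proof -
  let ?A = "induced C (S \<inter> T)" and ?S = "induced C S" and ?T = "induced C T"
  have c: "closed_in L ?S (S \<inter> T)" "closed_in L ?T (S \<inter> T)"
    using S(1) T(1) by (auto simp: closed_in_def induced_def)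
  have sub: "substructure L ?S C" "substructure L ?T C"
    using substructure_induced[OF U C] S(1) T(1) by auto
  have ls: "L_structure L ?S" "L_structure L ?T"
    using sub by (auto simp: substructure_def embedding_def)
  have i: "induced ?S (S \<inter> T) = ?A" "induced ?T (S \<inter> T) = ?A" by (auto simp: induced_def fun_eq_iff)
  have sub2: "substructure L ?A ?S" "substructure L ?A ?T"
    using substructure_induced[OF U ls(1) c(1)] substructure_induced[OF U ls(2) c(2)] by (simp_all add: i)
  have v: "verts ?S = S" "verts ?T = T" "verts ?A = S \<inter> T" by (auto simp: induced_def)
  have "free_amalgamation L id id id id ?A ?S ?T C"
    unfolding free_amalgamation_def amalgamation_def
  proof (intro conjI)
    show "embedding L id ?A ?S" "embedding L id ?A ?T" "embedding L id ?S C" "embedding L id ?T C"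
      using sub sub2 by (auto simp: substructure_def)
    have across: "\<not> set xs \<subseteq> S \<and> \<not> set xs \<subseteq> T"
      if "set xs \<inter> id ` (verts ?S - id ` verts ?A) \<noteq> {}" "set xs \<inter> id ` (verts ?T - id ` verts ?A) \<noteq> {}"
      for xs using that unfolding v by auto
    show "\<forall>xs. set xs \<subseteq> verts C \<and> set xs \<inter> id ` (verts ?S - id ` verts ?A) \<noteq> {} \<and>
        set xs \<inter> id ` (verts ?T - id ` verts ?A) \<noteq> {} \<longrightarrow>
        (\<forall>R\<in>rels L. xs \<notin> rel C R) \<and> (\<forall>F\<in>funs L. fun_arity L F = length xs \<longrightarrow> fn C F xs = {})"
    proof (intro allI impI)
      fix xs
      assume xs: "set xs \<subseteq> verts C \<and> set xs \<inter> id ` (verts ?S - id ` verts ?A) \<noteq> {} \<and>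
        set xs \<inter> id ` (verts ?T - id ` verts ?A) \<noteq> {}"
      have "length xs \<noteq> 1"
      proof
        assume "length xs = 1"
        then obtain a where a: "xs = [a]" by (auto simp: length_Suc_conv)
        then have "a \<in> S \<union> T" using xs cover by simp
        then show False using across[of xs] xs a by auto
      qed
      then show "(\<forall>R\<in>rels L. xs \<notin> rel C R) \<and>
          (\<forall>F\<in>funs L. fun_arity L F = length xs \<longrightarrow> fn C F xs = {})"
        using across[of xs] xs rel U by (metis unary_language_def)
    qed
  qed (use cover in \<open>auto simp: v\<close>)
  moreover have "proper_substructure L ?S C" "proper_substructure L ?T C"
    using sub S(2) T(2) v by (auto simp: proper_substructure_def)
  ultimately show ?thesis unfolding irreducible_def by blast
qed

text \<open>For a vertex \<open>u\<close>, the vertices whose closure avoids \<open>u\<close> form the largest proper substructure without \<open>u\<close>.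
If the two substructures that belong to \<open>v\<close> and \<open>w\<close> do not cover \<open>C\<close>, a vertex outside both has \<open>v\<close> and
\<open>w\<close> in its closure. If they cover \<open>C\<close>, irreducibility provides a tuple that is contained in neither.\<close>

lemma irreducible_connected:
  assumes U: "unary_language L" and irr: "irreducible L C" and v: "v \<in> verts C" "w \<in> verts C"
  obtains (closure) z where "z \<in> verts C" "v \<in> closure L C z" "w \<in> closure L C z"
    | (rel) R xs a b where "R \<in> rels L" "xs \<in> rel C R" "a \<in> set xs" "b \<in> set xs"
        "v \<in> closure L C a" "w \<in> closure L C b"
proof -
  have C: "L_structure L C" using irr by (simp add: irreducible_def)
  define avoid where "avoid u = {z \<in> verts C. u \<notin> closure L C z}" for u
  have closed: "closed_in L C (avoid u)" for u
    unfolding closed_in_def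
  proof (intro conjI ballI subsetI)
    show "z \<in> verts C" if "z \<in> avoid u" for z using that by (simp add: avoid_def)
    fix F z y assume F: "F \<in> funs L" and z: "z \<in> avoid u" and y: "y \<in> fn C F [z]"
    have "closure L C y \<subseteq> closure L C z" by (rule closure_trans[OF subsetD[OF fn_closure[OF F] y]])
    moreover have "y \<in> verts C"
      using C F z y unfolding L_structure_unary[OF U] avoid_def by blast
    ultimately show "y \<in> avoid u" using z by (auto simp: avoid_def)
  qed
  have proper: "avoid u \<noteq> verts C" if "u \<in> verts C" for u
    using that closure_refl[of u L C] unfolding avoid_def by blast
  show thesis
  proof (cases "avoid v \<union> avoid w = verts C")
    case False
    then obtain z where "z \<in> verts C" "z \<notin> avoid v" "z \<notin> avoid w" by (auto simp: avoid_def)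
    then show thesis using closure by (auto simp: avoid_def)
  next
    case True
    then obtain R xs where R: "R \<in> rels L" "xs \<in> rel C R" "\<not> set xs \<subseteq> avoid v" "\<not> set xs \<subseteq> avoid w"
      using reducible_cover[OF U C closed proper[OF v(1)] closed proper[OF v(2)]] irr by metis
    have "set xs \<subseteq> verts C" using C R(1,2) unfolding L_structure_def tuples_def by blast
    then show thesis using rel[OF R(1,2)] R(3,4) by (auto simp: avoid_def)
  qed
qed

section \<open>Gluing the copies of a structure\<close>

text \<open>An extension system with all required properties whose copies of \<open>A\<close> contain \<open>A\<close> itself.\<close>

locale unary_eppa = extension_system "verts A" "{f. partial_automorphism L A f}" Y id G \<phi>
  for L :: "('r, 'f) language" and A :: "('r, 'f, 'a) struct" and Y G \<phi> +
  assumes U: "unary_language L" and A: "L_structure L A" and AY: "verts A \<subseteq> Y"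
    and conf: "conformal (verts A) Y id G"
    and inv: "closure_invariant (verts A) (closure L A) id G"
begin

definition glued :: "('r, 'f, 'a) struct" where
  "glued = \<lparr>verts = (\<Union>g\<in>G. g ` verts A),
     rel = (\<lambda>R. {map g xs | g xs. g \<in> G \<and> xs \<in> rel A R \<and> set xs \<subseteq> verts A}),
     fn = (\<lambda>F vs. {g y | g x y. g \<in> G \<and> x \<in> verts A \<and> [g x] = vs \<and> y \<in> fn A F [x]})\<rparr>"

lemma verts_glued: "verts glued = (\<Union>g\<in>G. g ` verts A)"
  by (simp add: glued_def)

lemma A_glued: "verts A \<subseteq> verts glued"
proof
  fix x assume "x \<in> verts A"
  then have "x \<in> id ` verts A" by simp
  then show "x \<in> verts glued" unfolding verts_glued using G_id by blast
qed

lemma glued_Y: "verts glued \<subseteq> Y"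
  using G_in AY by (auto simp: verts_glued)

lemma rel_glued:
  "vs \<in> rel glued R \<longleftrightarrow> (\<exists>g\<in>G. \<exists>xs\<in>rel A R. set xs \<subseteq> verts A \<and> vs = map g xs)"
  by (auto simp: glued_def)

lemma fnA: "F \<in> funs L \<Longrightarrow> x \<in> verts A \<Longrightarrow> fn A F [x] \<subseteq> verts A"
  using A by (simp add: L_structure_unary[OF U])

text \<open>On the closure of \<open>x\<close>, which stays in \<open>A\<close>, the permutation \<open>g\<close> agrees with a partial automorphism. This
makes the functions of the glued structure well defined.\<close>

lemma copies_agree:
  assumes g: "g \<in> G" and x: "x \<in> verts A" "y \<in> verts A" "g x = y" and F: "F \<in> funs L"
  shows "g ` fn A F [x] = fn A F [y]"
proof -
  obtain f where f: "partial_automorphism L A f"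
    "\<forall>x\<in>verts A. \<forall>y\<in>verts A. g (id x) = id y \<longrightarrow> f x = Some y"
    using G_restrict[OF g] by blast
  have fx: "f x = Some y" using f(2) x by simp
  have cl: "g ` closure L A x = closure L A y"
    using inv[unfolded closure_invariant_def, rule_format, OF g x(1,2)] x(3) by simp
  have "the (f z) = g z" if "z \<in> fn A F [x]" for z
  proof -
    have "z \<in> closure L A x" using fn_closure[OF F] that by (rule subsetD)
    then have "g z \<in> closure L A y" unfolding cl[symmetric] by (rule imageI)
    then have "g z \<in> verts A" using closure_in[OF U A x(2)] by blast
    moreover have "z \<in> verts A" using fnA[OF F x(1)] that by blast
    ultimately show ?thesis using f(2) by simp
  qed
  then have "g ` fn A F [x] = (\<lambda>z. the (f z)) ` fn A F [x]" by (intro image_cong) simp_all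
  also have "\<dots> = fn A F [y]"
    using f(1) F fx unfolding partial_automorphism_iff[OF U A] by (auto simp: domI)
  finally show ?thesis .
qed

lemma fn_glued:
  assumes g: "g \<in> G" and x: "x \<in> verts A" and F: "F \<in> funs L"
  shows "fn glued F [g x] = g ` fn A F [x]"
proof
  show "g ` fn A F [x] \<subseteq> fn glued F [g x]" using g x by (auto simp: glued_def)
  show "fn glued F [g x] \<subseteq> g ` fn A F [x]"
  proof
    fix w assume "w \<in> fn glued F [g x]"
    then obtain h x' y where h: "h \<in> G" "x' \<in> verts A" "h x' = g x" "y \<in> fn A F [x']" "w = h y"
      by (auto simp: glued_def)
    obtain k where k: "k \<in> G" "\<And>v. v \<in> Y \<Longrightarrow> k (g v) = v" "\<And>v. v \<in> Y \<Longrightarrow> g (k v) = v"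
      using G_inverse[OF g] by metis
    have "(k \<circ> h) x' = x" using h(3) k(2) x AY by auto
    from copies_agree[OF G_comp[OF k(1) h(1)] h(2) x this F]
    have "k (h y) \<in> fn A F [x]" using h(4) by auto
    moreover have "g (k (h y)) = h y" using k(3) G_in[OF h(1)] fnA[OF F h(2)] h(4) AY by blast
    ultimately show "w \<in> g ` fn A F [x]" unfolding h(5) by (metis imageI)
  qed
qed

lemma glued_structure: "L_structure L glued"
  unfolding L_structure_unary[OF U]
proof (intro conjI ballI subsetI)
  fix R vs assume R: "R \<in> rels L" and "vs \<in> rel glued R"
  then obtain g xs where g: "g \<in> G" "xs \<in> rel A R" "set xs \<subseteq> verts A" "vs = map g xs"
    by (auto simp: rel_glued)
  then have "length xs = rel_arity L R"
    using A R unfolding L_structure_def tuples_def by blast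
  then show "vs \<in> tuples (verts glued) (rel_arity L R)"
    using g by (auto simp: tuples_def verts_glued)
next
  fix F v w assume F: "F \<in> funs L" and "v \<in> verts glued" and w: "w \<in> fn glued F [v]"
  then obtain g x where g: "g \<in> G" "x \<in> verts A" "v = g x" by (auto simp: verts_glued)
  then show "w \<in> verts glued"
    using w fn_glued[OF g(1,2) F] fnA[OF F g(2)] by (auto simp: verts_glued)
qed

lemma finite_glued: "finite_structure L glued"
  using glued_structure finite_subset[OF glued_Y finite_X] by (simp add: finite_structure_def)

lemma substructure_glued: "substructure L A glued"
  unfolding substructure_def embedding_unary[OF U]
proof (intro conjI ballI)
  fix R xs assume R: "R \<in> rels L" and xs: "xs \<in> tuples (verts A) (rel_arity L R)"
  show "xs \<in> rel A R \<longleftrightarrow> map id xs \<in> rel glued R"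
  proof
    assume "xs \<in> rel A R"
    then show "map id xs \<in> rel glued R"
      using xs unfolding rel_glued tuples_def by (intro bexI[OF _ G_id] bexI[of _ xs]) auto
  next
    assume "map id xs \<in> rel glued R"
    then obtain g ys where g: "g \<in> G" "ys \<in> rel A R" "set ys \<subseteq> verts A" "xs = map g ys"
      by (auto simp: rel_glued)
    obtain f where f: "partial_automorphism L A f"
      "\<forall>x\<in>verts A. \<forall>y\<in>verts A. g (id x) = id y \<longrightarrow> f x = Some y"
      using G_restrict[OF g(1)] by blast
    have gf: "f y = Some (g y)" if "y \<in> set ys" for y
      using f(2) that g(3,4) xs by (auto simp: tuples_def)
    have "map (\<lambda>x. the (f x)) ys = xs" unfolding g(4) using gf by simp
    moreover have "ys \<in> tuples (dom f) (rel_arity L R)"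
      using xs gf unfolding g(4) by (auto simp: tuples_def)
    ultimately show "xs \<in> rel A R"
      using f(1) R g(2) unfolding partial_automorphism_iff[OF U A] by metis
  qed
next
  fix F x assume "F \<in> funs L" "x \<in> verts A"
  then show "id ` fn A F [x] = fn glued F [id x]" using fn_glued[OF G_id] by simp
qed (use A glued_structure A_glued in auto)

definition auto_of :: "('a \<Rightarrow> 'a) \<Rightarrow> 'a \<rightharpoonup> 'a" where
  "auto_of g v = (if v \<in> verts glued then Some (g v) else None)"

lemma dom_auto_of: "dom (auto_of g) = verts glued"
  by (auto simp: auto_of_def split: if_splits)

lemma glued_closed: "g \<in> G \<Longrightarrow> v \<in> verts glued \<Longrightarrow> g v \<in> verts glued"
proof -
  assume g: "g \<in> G" and "v \<in> verts glued"
  then obtain h x where h: "h \<in> G" "x \<in> verts A" "v = h x" by (auto simp: verts_glued)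
  have "g v = (g \<circ> h) x" by (simp add: h)
  then show ?thesis using G_comp[OF g h(1)] h(2) unfolding verts_glued by blast
qed

lemma image_glued: assumes g: "g \<in> G" shows "g ` verts glued = verts glued"
proof -
  have "inj_on g (verts glued)" using G_inj[OF g] glued_Y by (auto simp: inj_on_def)
  then show ?thesis
    using glued_closed[OF g] finite_glued by (intro endo_inj_surj) (auto simp: finite_structure_def)
qed

lemma automorphism_auto_of:
  assumes g: "g \<in> G" shows "automorphism L glued (auto_of g)"
proof -
  have ap: "the (auto_of g v) = g v" if "v \<in> verts glued" for v using that by (simp add: auto_of_def)
  have im: "g ` verts glued = verts glued" using image_glued[OF g] .
  have "ran (auto_of g) = g ` verts glued" by (auto simp: ran_def auto_of_def split: if_splits)
  with im have ran: "ran (auto_of g) = verts glued" by simp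
  obtain k where k: "k \<in> G" "\<And>v. v \<in> Y \<Longrightarrow> k (g v) = v" "\<And>v. v \<in> Y \<Longrightarrow> g (k v) = v"
    using G_inverse[OF g] by metis
  have rel_g: "map h vs \<in> rel glued R" if h: "h \<in> G" and "vs \<in> rel glued R" for h vs R
  proof -
    obtain h' xs where h': "h' \<in> G" "xs \<in> rel A R" "set xs \<subseteq> verts A" "vs = map h' xs"
      using \<open>vs \<in> rel glued R\<close> by (auto simp: rel_glued)
    have "map h vs = map (h \<circ> h') xs" by (simp add: h')
    then show ?thesis using G_comp[OF h h'(1)] h'(2,3) unfolding rel_glued by blast
  qed
  have "embedding L (\<lambda>v. the (auto_of g v)) glued glued"
    unfolding embedding_unary[OF U]
  proof (intro conjI ballI)
    show "(\<lambda>v. the (auto_of g v)) ` verts glued \<subseteq> verts glued" using ap im by force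
    show "inj_on (\<lambda>v. the (auto_of g v)) (verts glued)"
      using G_inj[OF g] glued_Y ap by (auto simp: inj_on_def)
  next
    fix R vs assume "R \<in> rels L" and "vs \<in> tuples (verts glued) (rel_arity L R)"
    then have vs: "set vs \<subseteq> verts glued" by (simp add: tuples_def)
    have m: "map (\<lambda>v. the (auto_of g v)) vs = map g vs" using vs ap by auto
    have "map k (map g vs) = vs" using vs glued_Y k(2) by (auto intro!: map_idI)
    then show "vs \<in> rel glued R \<longleftrightarrow> map (\<lambda>v. the (auto_of g v)) vs \<in> rel glued R"
      unfolding m using rel_g[OF g] rel_g[OF k(1), of "map g vs"] by metis
  next
    fix F v assume F: "F \<in> funs L" and v: "v \<in> verts glued"
    then obtain h x where h: "h \<in> G" "x \<in> verts A" "v = h x" by (auto simp: verts_glued)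
    have sub: "fn glued F [v] \<subseteq> verts glued"
      using glued_structure F v by (simp add: L_structure_unary[OF U])
    have "(\<lambda>v. the (auto_of g v)) ` fn glued F [v] = g ` fn glued F [v]"
      using sub ap by (intro image_cong) auto
    also have "\<dots> = (g \<circ> h) ` fn A F [x]" unfolding h(3) fn_glued[OF h(1,2) F] by (simp add: image_comp)
    also have "\<dots> = fn glued F [(g \<circ> h) x]" using fn_glued[OF G_comp[OF g h(1)] h(2) F] by simp
    finally show "(\<lambda>v. the (auto_of g v)) ` fn glued F [v] = fn glued F [the (auto_of g v)]"
      using ap[OF v] h(3) by simp
  qed (rule glued_structure)+
  then show ?thesis unfolding automorphism_def isomorphism_def dom_auto_of ran by simp
qed

lemma auto_of_extends:
  assumes f: "partial_automorphism L A f" shows "f \<subseteq>\<^sub>m auto_of (\<phi> f)"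
  unfolding map_le_def
proof
  fix x assume "x \<in> dom f"
  then obtain y where y: "f x = Some y" by blast
  have fP: "f \<in> {f. partial_automorphism L A f}" using f by simp
  have "\<phi> f x = y" using \<phi>_extends[OF fP y] by simp
  moreover have "x \<in> verts glued" using P_dom[OF fP] \<open>x \<in> dom f\<close> A_glued by blast
  ultimately show "f x = auto_of (\<phi> f) x" using y by (simp add: auto_of_def)
qed

lemma coherent_glued: "coherent_EPPA_witness L A glued"
proof -
  let ?P = "{f. partial_automorphism L A f}"
  have ext: "automorphism L glued (auto_of (\<phi> f)) \<and> f \<subseteq>\<^sub>m auto_of (\<phi> f)"
    if "partial_automorphism L A f" for f
    using automorphism_auto_of \<phi>_in auto_of_extends that by simp
  have "coherent_triple (auto_of (\<phi> e)) (auto_of (\<phi> f)) (auto_of (\<phi> h))"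
    if e: "e \<in> ?P" and f: "f \<in> ?P" and h: "h \<in> ?P" and t: "coherent_triple e f h" for e f h
  proof -
    have t: "dom e = dom h" "ran e = dom f" "ran f = ran h" "h = f \<circ>\<^sub>m e"
      using t by (auto simp: coherent_triple_def)
    have coh: "\<phi> f (\<phi> e v) = \<phi> h v" if "v \<in> Y" for v
      using \<phi>_coherent[OF e f _ _ t(2) _ that] h t(1,3) unfolding t(4) by simp
    have pb: "partial_bijection (auto_of g)" if "g \<in> G" for g
      unfolding partial_bijection_def dom_auto_of
      using G_inj[OF that] glued_Y by (auto simp: inj_on_def auto_of_def)
    have ran: "ran (auto_of g) = verts glued" if "g \<in> G" for g
      using automorphism_auto_of[OF that] by (simp add: automorphism_def isomorphism_def)
    have "auto_of (\<phi> h) = auto_of (\<phi> f) \<circ>\<^sub>m auto_of (\<phi> e)"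
      using coh glued_Y glued_closed[OF \<phi>_in[OF e]]
      by (auto simp: fun_eq_iff auto_of_def map_comp_def)
    then show ?thesis
      unfolding coherent_triple_def
      using pb[OF \<phi>_in[OF e]] pb[OF \<phi>_in[OF f]] pb[OF \<phi>_in[OF h]] ran[OF \<phi>_in[OF e]]
        ran[OF \<phi>_in[OF f]] ran[OF \<phi>_in[OF h]] dom_auto_of[of "\<phi> h"]
      by (intro conjI) (simp_all only: dom_auto_of)
  qed
  then have "coherent_map ?P (\<lambda>f. auto_of (\<phi> f))" unfolding coherent_map_def by blast
  moreover have "EPPA_witness L A glued"
    unfolding EPPA_witness_def using substructure_glued ext by blast
  ultimately show ?thesis
    unfolding coherent_EPPA_witness_def using ext by (intro conjI exI[of _ "\<lambda>f. auto_of (\<phi> f)"]) auto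
qed

end

text \<open>Copies are closed, and every tuple of a relation lies in a copy. So connected vertices share a copy, and
conformality puts the whole irreducible substructure into one copy, which \<open>G\<close> moves to \<open>A\<close>.\<close>

lemma (in unary_eppa) faithful_glued: "irreducible_substructure_faithful L A glued"
  unfolding irreducible_substructure_faithful_def
proof (intro allI impI)
  fix C assume C: "substructure L C glued \<and> irreducible L C"
  have CV: "verts C \<subseteq> verts glued" and Crel: "\<And>R xs. R \<in> rels L \<Longrightarrow> xs \<in> rel C R \<Longrightarrow> xs \<in> rel glued R"
    and Cfn: "\<And>F x. F \<in> funs L \<Longrightarrow> x \<in> verts C \<Longrightarrow> fn C F [x] = fn glued F [x]"
    and CL: "L_structure L C"
  proof -
    have e: "embedding L id C glued" using C by (simp add: substructure_def)
    show "L_structure L C" "verts C \<subseteq> verts glued" using e by (auto simp: embedding_def)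
    then show "xs \<in> rel glued R" if "R \<in> rels L" "xs \<in> rel C R" for R xs
    proof -
      have "xs \<in> tuples (verts C) (rel_arity L R)"
        using \<open>L_structure L C\<close> that unfolding L_structure_def by blast
      then show ?thesis using e that unfolding embedding_def by simp
    qed
    show "fn C F [x] = fn glued F [x]" if "F \<in> funs L" "x \<in> verts C" for F x
      using e that unfolding embedding_unary[OF U] by simp
  qed
  have closed: "closed_in L C (verts C \<inter> g ` verts A)" if g: "g \<in> G" for g
    unfolding closed_in_def
  proof (intro conjI ballI)
    fix F z assume F: "F \<in> funs L" and z: "z \<in> verts C \<inter> g ` verts A"
    then obtain x where x: "x \<in> verts A" "z = g x" by blast
    have "fn C F [z] = g ` fn A F [x]" using Cfn[OF F] z x fn_glued[OF g x(1) F] by simp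
    then have "fn C F [z] \<subseteq> g ` verts A" using image_mono[OF fnA[OF F x(1)]] by simp
    moreover have "fn C F [z] \<subseteq> verts C" using CL F z by (simp add: L_structure_unary[OF U])
    ultimately show "fn C F [z] \<subseteq> verts C \<inter> g ` verts A" by blast
  qed blast
  have in_copy: "u \<in> g ` verts A" if "g \<in> G" "z \<in> verts C" "z \<in> g ` verts A" "u \<in> closure L C z" for g z u
    using closed_closure[OF closed[OF that(1)], of z] that(2-4) by blast
  have "\<exists>g\<in>G. v \<in> g ` id ` verts A \<and> w \<in> g ` id ` verts A" if v: "v \<in> verts C" and w: "w \<in> verts C" for v w
  proof -
    have irr: "irreducible L C" using C by simp
    show ?thesis
    proof (rule irreducible_connected[OF U irr v w])
      fix z assume z: "z \<in> verts C" "v \<in> closure L C z" "w \<in> closure L C z"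
      then obtain g where g: "g \<in> G" "z \<in> g ` verts A" using CV by (auto simp: verts_glued)
      show ?thesis
        using in_copy[OF g(1) z(1) g(2) z(2)] in_copy[OF g(1) z(1) g(2) z(3)]
        unfolding image_id id_apply by (intro bexI[OF _ g(1)] conjI)
    next
      fix R xs a b assume R: "R \<in> rels L" "xs \<in> rel C R" and ab: "a \<in> set xs" "b \<in> set xs"
        "v \<in> closure L C a" "w \<in> closure L C b"
      obtain g ys where g: "g \<in> G" "set ys \<subseteq> verts A" "xs = map g ys"
        using Crel[OF R] by (auto simp: rel_glued)
      have "set xs \<subseteq> verts C" using CL R unfolding L_structure_def tuples_def by blast
      moreover have "set xs \<subseteq> g ` verts A" using g(2,3) by auto
      ultimately have "v \<in> g ` verts A" "w \<in> g ` verts A"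
        using in_copy[OF g(1), of a v] in_copy[OF g(1), of b w] ab by blast+
      then show ?thesis unfolding image_id id_apply by (intro bexI[OF _ g(1)] conjI)
    qed
  qed
  moreover have "verts C \<subseteq> Y" using CV glued_Y by blast
  ultimately obtain g where g: "g \<in> G" "verts C \<subseteq> g ` verts A"
    using conf unfolding conformal_def image_id id_apply by meson
  obtain k where k: "k \<in> G" "\<And>v. v \<in> Y \<Longrightarrow> k (g v) = v" using G_inverse[OF g(1)] by metis
  have "the (auto_of k v) \<in> verts A" if "v \<in> verts C" for v
  proof -
    from that g(2) obtain x where x: "x \<in> verts A" "v = g x" by blast
    have "the (auto_of k v) = k v" using that CV by (auto simp: auto_of_def)
    then show ?thesis using k(2) x AY by auto
  qed
  then show "\<exists>g. automorphism L glued g \<and> (\<lambda>x. the (g x)) ` verts C \<subseteq> verts A"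
    using automorphism_auto_of[OF k(1)] by blast
qed

theorem exists_faithful_coherent_witness:
  fixes A :: "('r, 'f, 'a) struct"
  assumes "infinite (UNIV :: 'a set)" and U: "unary_language L" and A: "finite_structure L A"
  obtains B :: "('r, 'f, 'a) struct" where "finite_structure L B"
    "irreducible_substructure_faithful L A B" "coherent_EPPA_witness L A B"
proof -
  have AL: "L_structure L A" using A by (simp add: finite_structure_def)
  interpret partial_bijections "verts A" "{f. partial_automorphism L A f}"
    using partial_automorphism_bijections[OF U A] .
  have cl: "closure L A x \<subseteq> dom f \<and> (\<lambda>z. the (f z)) ` closure L A x = closure L A y"
    if "f \<in> {f. partial_automorphism L A f}" "f x = Some y" for f x y
  proof -
    have "partial_automorphism L A f" using that(1) by simp
    from partial_automorphism_closure[OF U AL this that(2)] show ?thesis by (rule conjI)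
  qed
  obtain Y G \<phi> where Y: "extension_system (verts A) {f. partial_automorphism L A f} Y id G \<phi>"
    "verts A \<subseteq> Y" "conformal (verts A) Y id G" "closure_invariant (verts A) (closure L A) id G"
    using exists_conformal_system[OF assms(1), of "closure L A",
        OF closure_refl closure_in[OF U AL] closure_trans cl]
    by metis
  interpret unary_eppa L A Y G \<phi>
    using Y U AL by (simp add: unary_eppa_def unary_eppa_axioms_def)
  show thesis using that[OF finite_glued faithful_glued coherent_glued] .
qed

section \<open>Free amalgamation classes\<close>

lemma embedding_comp:
  assumes f: "embedding L f A B" and g: "embedding L g B C"
  shows "embedding L (g \<circ> f) A C"
proof -
  have fA: "f ` verts A \<subseteq> verts B" using f by (simp add: embedding_def)
  have t: "map f xs \<in> tuples (verts B) n" if "xs \<in> tuples (verts A) n" for xs n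
    using that fA by (auto simp: tuples_def)
  show ?thesis
    unfolding embedding_def
  proof (intro conjI ballI)
    show "L_structure L A" "L_structure L C" using f g by (auto simp: embedding_def)
    have "g ` f ` verts A \<subseteq> g ` verts B" using fA by (rule image_mono)
    then show "(g \<circ> f) ` verts A \<subseteq> verts C" using g by (auto simp: embedding_def)
    show "inj_on (g \<circ> f) (verts A)"
      using f g fA by (intro comp_inj_on) (auto simp: embedding_def intro: inj_on_subset)
    show "xs \<in> rel A R \<longleftrightarrow> map (g \<circ> f) xs \<in> rel C R"
      if "R \<in> rels L" "xs \<in> tuples (verts A) (rel_arity L R)" for R xs
      using f g that t[OF that(2)] unfolding embedding_def by simp
    show "(g \<circ> f) ` fn A F xs = fn C F (map (g \<circ> f) xs)"
      if "F \<in> funs L" "xs \<in> tuples (verts A) (fun_arity L F)" for F xs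
    proof -
      have "f ` fn A F xs = fn B F (map f xs)" using f that unfolding embedding_def by blast
      moreover have "g ` fn B F (map f xs) = fn C F (map g (map f xs))"
        using g that(1) t[OF that(2)] unfolding embedding_def by blast
      ultimately show ?thesis by (simp only: image_comp[symmetric] map_map[symmetric])
    qed
  qed
qed

lemma substructure_trans: "substructure L A B \<Longrightarrow> substructure L B C \<Longrightarrow> substructure L A C"
  using embedding_comp[of L id A B id C] by (simp add: substructure_def)

lemma embedding_inverse:
  assumes f: "embedding L f A B" and onto: "f ` verts A = verts B"
  shows "embedding L (inv_into (verts A) f) B A"
proof -
  let ?g = "inv_into (verts A) f"
  have inj: "inj_on f (verts A)" using f by (simp add: embedding_def)
  have fg: "f (?g y) = y" "?g y \<in> verts A" if "y \<in> verts B" for y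
    using that f_inv_into_f inv_into_into unfolding onto[symmetric] by metis+
  have m: "map f (map ?g ys) = ys" "map ?g ys \<in> tuples (verts A) n"
    if "ys \<in> tuples (verts B) n" for ys n
    using that fg by (auto simp: tuples_def subset_iff intro!: map_idI)
  have A: "L_structure L A" using f by (simp add: embedding_def)
  show ?thesis
    unfolding embedding_def
  proof (intro conjI ballI)
    show "L_structure L B" "L_structure L A" using f by (auto simp: embedding_def)
    show "?g ` verts B \<subseteq> verts A" using fg by blast
    show "inj_on ?g (verts B)" using fg(1) by (rule inj_on_inverseI)
    show "ys \<in> rel B R \<longleftrightarrow> map ?g ys \<in> rel A R"
      if "R \<in> rels L" "ys \<in> tuples (verts B) (rel_arity L R)" for R ys
    proof -
      have "map ?g ys \<in> rel A R \<longleftrightarrow> map f (map ?g ys) \<in> rel B R"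
        using f that(1) m(2)[OF that(2)] unfolding embedding_def by blast
      then show ?thesis unfolding m(1)[OF that(2)] by blast
    qed
    show "?g ` fn B F ys = fn A F (map ?g ys)"
      if "F \<in> funs L" "ys \<in> tuples (verts B) (fun_arity L F)" for F ys
    proof -
      have "fn A F (map ?g ys) \<subseteq> verts A"
        using A that(1) m(2)[OF that(2)] unfolding L_structure_def by blast
      then have "?g ` f ` fn A F (map ?g ys) = fn A F (map ?g ys)"
        using inj by (simp add: inv_into_image_cancel)
      moreover have "f ` fn A F (map ?g ys) = fn B F (map f (map ?g ys))"
        using f that(1) m(2)[OF that(2)] unfolding embedding_def by blast
      ultimately show ?thesis unfolding m(1)[OF that(2)] by simp
    qed
  qed
qed

lemma embedding_image:
  assumes U: "unary_language L" and f: "embedding L f C B" and A: "substructure L A B"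
    and im: "f ` verts C \<subseteq> verts A"
  obtains D where "substructure L D A" "embedding L f C D" "f ` verts C = verts D"
proof -
  let ?D = "induced A (f ` verts C)"
  have AL: "L_structure L A" and CL: "L_structure L C" and inj: "inj_on f (verts C)"
    using A f by (auto simp: substructure_def embedding_def)
  have fnA: "fn A F [f x] = f ` fn C F [x]" if "F \<in> funs L" "x \<in> verts C" for F x
  proof -
    have "f x \<in> verts A" using im that(2) by blast
    then show ?thesis
      using A f that unfolding substructure_def embedding_unary[OF U] by simp
  qed
  have fnC: "fn C F [x] \<subseteq> verts C" if "F \<in> funs L" "x \<in> verts C" for F x
    using CL that by (simp add: L_structure_unary[OF U])
  have "closed_in L A (f ` verts C)"
    unfolding closed_in_def
  proof (intro conjI ballI)
    fix F y assume F: "F \<in> funs L" and "y \<in> f ` verts C"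
    then obtain x where x: "x \<in> verts C" "y = f x" by blast
    show "fn A F [y] \<subseteq> f ` verts C" unfolding x(2) fnA[OF F x(1)] using fnC[OF F x(1)] by (rule image_mono)
  qed (rule im)
  then have D: "substructure L ?D A" by (rule substructure_induced[OF U AL])
  have "embedding L f C ?D"
    unfolding embedding_unary[OF U]
  proof (intro conjI ballI)
    show "L_structure L ?D" using D by (simp add: substructure_def embedding_def)
    show "xs \<in> rel C R \<longleftrightarrow> map f xs \<in> rel ?D R"
      if R: "R \<in> rels L" and xs: "xs \<in> tuples (verts C) (rel_arity L R)" for R xs
    proof -
      have fxs: "map f xs \<in> tuples (verts A) (rel_arity L R)" "set (map f xs) \<subseteq> f ` verts C"
        using xs im by (auto simp: tuples_def)
      have "xs \<in> rel C R \<longleftrightarrow> map f xs \<in> rel B R" using f R xs unfolding embedding_def by blast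
      also have "\<dots> \<longleftrightarrow> map f xs \<in> rel A R"
        using A R fxs(1) unfolding substructure_def embedding_def by simp
      also have "\<dots> \<longleftrightarrow> map f xs \<in> rel ?D R" using fxs(2) by (simp add: induced_def)
      finally show ?thesis .
    qed
    show "f ` fn C F [x] = fn ?D F [f x]" if "F \<in> funs L" "x \<in> verts C" for F x
      using fnA[OF that] by (simp add: induced_def)
  qed (use CL inj in \<open>auto simp: induced_def\<close>)
  then show thesis using that[OF D] by (simp add: induced_def)
qed

text \<open>The two amalgams share the components, and freeness determines the rest. All vertices lie in one type,
as the local facts about the two components are used for both of them.\<close>

lemma free_amalgamation_unique:
  fixes L :: "('r, 'f) language" and A B1 B2 B C :: "('r, 'f, 'a) struct"
  assumes U: "unary_language L"
    and B: "free_amalgamation L \<alpha>1 \<alpha>2 \<beta>1 \<beta>2 A B1 B2 B"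
    and C: "free_amalgamation L \<alpha>1 \<alpha>2 \<gamma>1 \<gamma>2 A B1 B2 C"
  obtains f where "embedding L f B C" "f ` verts B = verts C"
proof -
  note B = B[unfolded free_amalgamation_def amalgamation_def]
  note b1 = B[THEN conjunct1, THEN conjunct2, THEN conjunct2, THEN conjunct1]
  note b2 = B[THEN conjunct1, THEN conjunct2, THEN conjunct2, THEN conjunct2, THEN conjunct1]
  note bc = B[THEN conjunct1, THEN conjunct2, THEN conjunct2, THEN conjunct2, THEN conjunct2]
  note b = B[THEN conjunct2, THEN conjunct1] B[THEN conjunct2, THEN conjunct2, THEN conjunct1]
  note b_free = B[THEN conjunct2, THEN conjunct2, THEN conjunct2]
  have bf: "xs \<notin> rel B R" if "set xs \<subseteq> verts B" "v \<in> set xs \<inter> \<beta>1 ` (verts B1 - \<alpha>1 ` verts A)"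
    "w \<in> set xs \<inter> \<beta>2 ` (verts B2 - \<alpha>2 ` verts A)" "R \<in> rels L" for xs v w R
  proof -
    have "set xs \<inter> \<beta>1 ` (verts B1 - \<alpha>1 ` verts A) \<noteq> {}" using that(2) by (metis empty_iff)
    moreover have "set xs \<inter> \<beta>2 ` (verts B2 - \<alpha>2 ` verts A) \<noteq> {}" using that(3) by (metis empty_iff)
    ultimately show ?thesis using b_free that(1,4) by metis
  qed
  note C = C[unfolded free_amalgamation_def amalgamation_def]
  note c1 = C[THEN conjunct1, THEN conjunct2, THEN conjunct2, THEN conjunct1]
  note c2 = C[THEN conjunct1, THEN conjunct2, THEN conjunct2, THEN conjunct2, THEN conjunct1]
  note cc = C[THEN conjunct1, THEN conjunct2, THEN conjunct2, THEN conjunct2, THEN conjunct2]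
  note c = C[THEN conjunct2, THEN conjunct1] C[THEN conjunct2, THEN conjunct2, THEN conjunct1]
  note c_free = C[THEN conjunct2, THEN conjunct2, THEN conjunct2]
  have cf: "xs \<notin> rel C R" if "set xs \<subseteq> verts C" "v \<in> set xs \<inter> \<gamma>1 ` (verts B1 - \<alpha>1 ` verts A)"
    "w \<in> set xs \<inter> \<gamma>2 ` (verts B2 - \<alpha>2 ` verts A)" "R \<in> rels L" for xs v w R
  proof -
    have "set xs \<inter> \<gamma>1 ` (verts B1 - \<alpha>1 ` verts A) \<noteq> {}" using that(2) by (metis empty_iff)
    moreover have "set xs \<inter> \<gamma>2 ` (verts B2 - \<alpha>2 ` verts A) \<noteq> {}" using that(3) by (metis empty_iff)
    ultimately show ?thesis using c_free that(1,4) by metis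
  qed
  have a: "\<alpha>1 ` verts A \<subseteq> verts B1" "\<alpha>2 ` verts A \<subseteq> verts B2"
    using B[THEN conjunct1, THEN conjunct1] B[THEN conjunct1, THEN conjunct2, THEN conjunct1]
    by (simp_all add: embedding_def)
  have ib: "inj_on \<beta>1 (verts B1)" "inj_on \<beta>2 (verts B2)" and ic: "inj_on \<gamma>1 (verts B1)" "inj_on \<gamma>2 (verts B2)"
    using b1 b2 c1 c2 by (auto simp: embedding_def)
  define f where "f v = (if v \<in> \<beta>1 ` verts B1 then \<gamma>1 (inv_into (verts B1) \<beta>1 v)
    else \<gamma>2 (inv_into (verts B2) \<beta>2 v))" for v
  have f1: "f (\<beta>1 x) = \<gamma>1 x" if "x \<in> verts B1" for x
    using that ib(1) by (simp add: f_def)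
  have common: "\<exists>z\<in>verts A. x = \<alpha>1 z \<and> y = \<alpha>2 z"
    if "x \<in> verts B1" "y \<in> verts B2" "\<delta>1 x = \<delta>2 y"
      "inj_on \<delta>1 (verts B1)" "inj_on \<delta>2 (verts B2)" "\<forall>x\<in>verts A. \<delta>1 (\<alpha>1 x) = \<delta>2 (\<alpha>2 x)"
      and meet: "\<delta>1 ` verts B1 \<inter> \<delta>2 ` verts B2 = \<delta>1 ` \<alpha>1 ` verts A"
    for x y and \<delta>1 \<delta>2 :: "'a \<Rightarrow> 'a"
  proof -
    have "\<delta>1 x \<in> \<delta>1 ` verts B1 \<inter> \<delta>2 ` verts B2" using that(1-3) by (metis IntI imageI)
    then obtain z where z: "z \<in> verts A" "\<delta>1 x = \<delta>1 (\<alpha>1 z)" unfolding meet by blast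
    have "x = \<alpha>1 z" using that(4) z(2) that(1) a(1) z(1) by (auto dest!: inj_onD)
    moreover have "\<delta>2 y = \<delta>2 (\<alpha>2 z)" using that(3,6) z by simp
    then have "y = \<alpha>2 z" using that(5) that(2) a(2) z(1) by (auto dest!: inj_onD)
    ultimately show ?thesis using z(1) by blast
  qed
  have f2: "f (\<beta>2 y) = \<gamma>2 y" if y: "y \<in> verts B2" for y
  proof (cases "\<beta>2 y \<in> \<beta>1 ` verts B1")
    case True
    then obtain x where x: "x \<in> verts B1" "\<beta>1 x = \<beta>2 y" by auto
    obtain z where "z \<in> verts A" "x = \<alpha>1 z" "y = \<alpha>2 z"
      using common[OF x(1) y x(2) ib bc b(2)] by blast
    then show ?thesis using f1[OF x(1)] x(2) cc by simp
  next
    case False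
    then show ?thesis using y ib(2) by (simp add: f_def)
  qed
  have f_im: "f ` verts B = verts C"
    unfolding b(1)[symmetric] c(1)[symmetric] image_Un image_image
    using f1 f2 by (intro arg_cong2[of _ _ _ _ "(\<union>)"] image_cong) auto
  have inj_f: "inj_on f (verts B)"
  proof -
    have "v = w" if "f v = f w" "v \<in> \<beta>1 ` verts B1" "w \<in> \<beta>2 ` verts B2" for v w
    proof -
      from that(2,3) obtain x y where xy: "x \<in> verts B1" "v = \<beta>1 x" "y \<in> verts B2" "w = \<beta>2 y"
        by auto
      have "\<gamma>1 x = \<gamma>2 y" using that(1) f1 f2 xy by simp
      from common[OF xy(1,3) this ic cc c(2)] show ?thesis using bc xy by auto
    qed
    moreover have "v = w" if "f v = f w" "v \<in> \<beta>1 ` verts B1" "w \<in> \<beta>1 ` verts B1" for v w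
      using that f1 by (auto simp: inj_on_eq_iff[OF ic(1)])
    moreover have "v = w" if "f v = f w" "v \<in> \<beta>2 ` verts B2" "w \<in> \<beta>2 ` verts B2" for v w
      using that f2 by (auto simp: inj_on_eq_iff[OF ic(2)])
    ultimately show ?thesis unfolding inj_on_def b(1)[symmetric] by (metis UnE)
  qed
  have side: "xs \<in> rel B R \<longleftrightarrow> map f xs \<in> rel C R"
    if R: "R \<in> rels L" and xs: "length xs = rel_arity L R" "set xs \<subseteq> \<delta> ` verts D"
      and d: "embedding L \<delta> D B" "embedding L \<epsilon> D C" "\<And>x. x \<in> verts D \<Longrightarrow> f (\<delta> x) = \<epsilon> x"
    for R xs and D :: "('r, 'f, 'a) struct" and \<delta> \<epsilon>
  proof -
    have "xs \<in> lists (\<delta> ` verts D)" using xs(2) by (auto simp: in_lists_conv_set)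
    then obtain ys where ys: "xs = map \<delta> ys" "set ys \<subseteq> verts D"
      unfolding lists_image by (auto simp: in_lists_conv_set)
    then have t: "ys \<in> tuples (verts D) (rel_arity L R)" using xs(1) by (simp add: tuples_def)
    have m: "map f xs = map \<epsilon> ys" using ys d(3) by auto
    have "ys \<in> rel D R \<longleftrightarrow> map \<delta> ys \<in> rel B R" using d(1) R t unfolding embedding_def by blast
    moreover have "ys \<in> rel D R \<longleftrightarrow> map \<epsilon> ys \<in> rel C R" using d(2) R t unfolding embedding_def by blast
    ultimately show ?thesis unfolding m unfolding ys(1) by blast
  qed
  have "embedding L f B C"
    unfolding embedding_unary[OF U]
  proof (intro conjI ballI)
    show "L_structure L B" "L_structure L C" using b1 c1 by (auto simp: embedding_def)
    show "f ` verts B \<subseteq> verts C" using f_im by simp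
    show "inj_on f (verts B)" by (rule inj_f)
    show "f ` fn B F [v] = fn C F [f v]" if F: "F \<in> funs L" and v: "v \<in> verts B" for F v
    proof -
      have *: "f ` fn B F [\<delta> x] = fn C F [f (\<delta> x)]"
        if d: "embedding L \<delta> D B" "embedding L \<epsilon> D C" "\<And>x. x \<in> verts D \<Longrightarrow> f (\<delta> x) = \<epsilon> x"
          and x: "x \<in> verts D"
        for D :: "('r, 'f, 'a) struct" and \<delta> \<epsilon> x
      proof -
        have e: "fn B F [\<delta> x] = \<delta> ` fn D F [x]" "fn C F [\<epsilon> x] = \<epsilon> ` fn D F [x]"
          "fn D F [x] \<subseteq> verts D"
          using d(1,2) F x unfolding embedding_unary[OF U] L_structure_unary[OF U] by simp_all
        have "f ` \<delta> ` fn D F [x] = \<epsilon> ` fn D F [x]"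
          unfolding image_image using e(3) d(3) by (intro image_cong) auto
        then show ?thesis using e(1,2) d(3)[OF x] by simp
      qed
      consider x where "x \<in> verts B1" "v = \<beta>1 x" | y where "y \<in> verts B2" "v = \<beta>2 y"
        using v unfolding b(1)[symmetric] by blast
      then show ?thesis
        using *[OF b1 c1 f1] *[OF b2 c2 f2] by cases auto
    qed
    show "xs \<in> rel B R \<longleftrightarrow> map f xs \<in> rel C R"
      if R: "R \<in> rels L" and xs: "xs \<in> tuples (verts B) (rel_arity L R)" for R xs
    proof -
      have len: "length xs = rel_arity L R" and sub: "set xs \<subseteq> verts B" using xs by (auto simp: tuples_def)
      consider "set xs \<subseteq> \<beta>1 ` verts B1" | "set xs \<subseteq> \<beta>2 ` verts B2"
        | v w where "v \<in> set xs" "v \<notin> \<beta>2 ` verts B2" "w \<in> set xs" "w \<notin> \<beta>1 ` verts B1" by blast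
      then show ?thesis
      proof cases
        case 1
        then show ?thesis using side[OF R len _ b1 c1 f1] by blast
      next
        case 2
        then show ?thesis using side[OF R len _ b2 c2 f2] by blast
      next
        case 3
        have "v \<in> verts B" "w \<in> verts B" using 3 sub by auto
        then obtain x y where xy: "x \<in> verts B1" "v = \<beta>1 x" "y \<in> verts B2" "w = \<beta>2 y"
          using 3 unfolding b(1)[symmetric] by blast
        have "x \<notin> \<alpha>1 ` verts A"
        proof
          assume "x \<in> \<alpha>1 ` verts A"
          then obtain z where "z \<in> verts A" "x = \<alpha>1 z" by blast
          then have "v = \<beta>2 (\<alpha>2 z)" "\<alpha>2 z \<in> verts B2" using bc xy(2) a(2) by auto
          then show False using 3(2) by blast
        qed
        moreover have "y \<notin> \<alpha>2 ` verts A"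
        proof
          assume "y \<in> \<alpha>2 ` verts A"
          then obtain z where "z \<in> verts A" "y = \<alpha>2 z" by blast
          then have "w = \<beta>1 (\<alpha>1 z)" "\<alpha>1 z \<in> verts B1" using bc xy(4) a(1) by auto
          then show False using 3(4) by blast
        qed
        ultimately have m: "x \<in> verts B1 - \<alpha>1 ` verts A" "y \<in> verts B2 - \<alpha>2 ` verts A" using xy by auto
        have vB: "v \<in> set xs \<inter> \<beta>1 ` (verts B1 - \<alpha>1 ` verts A)"
          "w \<in> set xs \<inter> \<beta>2 ` (verts B2 - \<alpha>2 ` verts A)"
          using m xy(2,4) 3(1,3) by auto
        then have "xs \<notin> rel B R" using bf[OF sub _ _ R] by metis
        moreover have fv: "f v = \<gamma>1 x" "f w = \<gamma>2 y" using f1 f2 xy by auto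
        have "\<gamma>1 x \<in> set (map f xs) \<inter> \<gamma>1 ` (verts B1 - \<alpha>1 ` verts A)"
          using imageI[OF 3(1), of f] imageI[OF m(1), of \<gamma>1] fv(1) by simp
        moreover have "\<gamma>2 y \<in> set (map f xs) \<inter> \<gamma>2 ` (verts B2 - \<alpha>2 ` verts A)"
          using imageI[OF 3(3), of f] imageI[OF m(2), of \<gamma>2] fv(2) by simp
        moreover have "set (map f xs) \<subseteq> verts C" using sub f_im by auto
        ultimately show ?thesis using cf[OF _ _ _ R, of "map f xs"] by metis
      qed
    qed
  qed
  then show thesis using f_im by (rule that)
qed

text \<open>Induction on the number of vertices: a reducible structure is a free amalgam of two proper substructures
over a substructure of both, and the class contains such an amalgam up to isomorphism.\<close>

lemma class_contains_if_irreducibles: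
  fixes L :: "('r, 'f) language" and K :: "('r, 'f, 'a) struct set"
  assumes U: "unary_language L" and K: "free_amalgamation_class L K"
  shows "finite_structure L B \<Longrightarrow> (\<And>C. substructure L C B \<Longrightarrow> irreducible L C \<Longrightarrow> C \<in> K) \<Longrightarrow> B \<in> K"
proof (induction "card (verts B)" arbitrary: B rule: less_induct)
  case less
  have B: "L_structure L B" "finite (verts B)" using less.prems(1) by (auto simp: finite_structure_def)
  have iso: "C \<in> K" if "D \<in> K" "embedding L f D C" "f ` verts D = verts C" for C D f
    using K that unfolding free_amalgamation_class_def by blast
  show ?case
  proof (cases "irreducible L B")
    case True
    have "embedding L id B B" using B(1) by (simp add: embedding_def)
    then show ?thesis using less.prems(2)[of B] True by (simp add: substructure_def)
  next
    case False
    then obtain A :: "('r, 'f, 'a) struct" and B1 B2 \<alpha>1 \<alpha>2 where p: "proper_substructure L B1 B" "proper_substructure L B2 B"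
      and am: "free_amalgamation L \<alpha>1 \<alpha>2 id id A B1 B2 B"
      using B(1) unfolding irreducible_def by blast
    have sub_in: "D \<in> K" if D: "proper_substructure L D B" for D
    proof (rule less.hyps)
      have D': "substructure L D B" "L_structure L D" "verts D \<subset> verts B"
        using D by (auto simp: proper_substructure_def substructure_def embedding_def)
      show "card (verts D) < card (verts B)" using D'(3) B(2) by (rule psubset_card_mono[rotated])
      have "finite (verts D)" using D'(3) B(2) by (meson finite_subset psubset_imp_subset)
      then show "finite_structure L D" using D'(2) by (simp add: finite_structure_def)
      show "C \<in> K" if "substructure L C D" "irreducible L C" for C
        using less.prems(2) substructure_trans[OF that(1) D'(1)] that(2) by blast
    qed
    have B12: "B1 \<in> K" "B2 \<in> K" using sub_in p by auto
    have em: "embedding L \<alpha>1 A B1" "embedding L \<alpha>2 A B2"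
      using am by (auto simp: free_amalgamation_def amalgamation_def)
    have B1: "L_structure L B1" using em by (simp add: embedding_def)
    then have "substructure L B1 B1" by (simp add: substructure_def embedding_def)
    moreover have "\<alpha>1 ` verts A \<subseteq> verts B1" using em by (simp add: embedding_def)
    ultimately obtain D where D: "substructure L D B1" "embedding L \<alpha>1 A D" "\<alpha>1 ` verts A = verts D"
      using embedding_image[OF U em(1)] by metis
    have "D \<in> K" using K B12(1) D(1) unfolding free_amalgamation_class_def by blast
    moreover have e: "embedding L (inv_into (verts A) \<alpha>1) D A" using D(2,3) by (rule embedding_inverse)
    moreover have "inv_into (verts A) \<alpha>1 ` verts D = verts A"
      using D(2) by (simp add: D(3)[symmetric] embedding_def)
    ultimately have "A \<in> K" using iso by blast
    then obtain C \<beta>1 \<beta>2 where C: "C \<in> K" "free_amalgamation L \<alpha>1 \<alpha>2 \<beta>1 \<beta>2 A B1 B2 C"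
      using K B12 em unfolding free_amalgamation_class_def by meson
    obtain f where "embedding L f C B" "f ` verts C = verts B"
      using free_amalgamation_unique[OF U C(2) am] by metis
    then show ?thesis using iso[OF C(1)] by blast
  qed
qed

lemma class_contains_faithful:
  assumes U: "unary_language L" and K: "free_amalgamation_class L K" and A: "A \<in> K"
    and B: "finite_structure L B" "irreducible_substructure_faithful L A B" "substructure L A B"
  shows "B \<in> K"
proof (rule class_contains_if_irreducibles[OF U K B(1)])
  fix C assume C: "substructure L C B" "irreducible L C"
  then obtain g where g: "automorphism L B g" "(\<lambda>x. the (g x)) ` verts C \<subseteq> verts A"
    using B(2) unfolding irreducible_substructure_faithful_def by blast
  let ?f = "\<lambda>x. the (g x)"
  have "embedding L (?f \<circ> id) C B"
    using C(1) g(1) unfolding substructure_def automorphism_def isomorphism_def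
    by (intro embedding_comp) auto
  then have f: "embedding L ?f C B" by simp
  obtain D where D: "substructure L D A" "embedding L ?f C D" "?f ` verts C = verts D"
    using embedding_image[OF U f B(3) g(2)] by metis
  have "D \<in> K" using K A D(1) unfolding free_amalgamation_class_def by blast
  moreover have "embedding L (inv_into (verts C) ?f) D C" using D(2,3) by (rule embedding_inverse)
  moreover have "inv_into (verts C) ?f ` verts D = verts C"
    using D(2) by (simp add: D(3)[symmetric] embedding_def)
  ultimately show "C \<in> K" using K unfolding free_amalgamation_class_def by blast
qed

theorem theorem1p7:
  fixes L :: "('r, 'f) language"
  assumes "infinite (UNIV :: 'a set)"
    and "\<forall>F\<in>funs L. fun_arity L F = 1"
  shows "(\<forall>A :: ('r, 'f, 'a) struct. finite_structure L A \<longrightarrow>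
            (\<exists>B :: ('r, 'f, 'a) struct. finite_structure L B \<and>
               irreducible_substructure_faithful L A B \<and> coherent_EPPA_witness L A B)) \<and>
         (\<forall>K :: ('r, 'f, 'a) struct set.
            free_amalgamation_class L K \<longrightarrow> coherent_EPPA_class L K)"
proof -
  have U: "unary_language L" using assms(2) by (simp add: unary_language_def)
  have witness: "\<exists>B :: ('r, 'f, 'a) struct. finite_structure L B \<and>
      irreducible_substructure_faithful L A B \<and> coherent_EPPA_witness L A B"
    if "finite_structure L A" for A :: "('r, 'f, 'a) struct"
    using exists_faithful_coherent_witness[OF assms(1) U that] by metis
  have "\<exists>B\<in>K. coherent_EPPA_witness L A B"
    if K: "free_amalgamation_class L K" and A: "A \<in> K" for K :: "('r, 'f, 'a) struct set" and A
  proof -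
    have "finite_structure L A" using K A unfolding free_amalgamation_class_def by blast
    then obtain B :: "('r, 'f, 'a) struct" where B: "finite_structure L B"
      "irreducible_substructure_faithful L A B" "coherent_EPPA_witness L A B"
      using witness by blast
    have "substructure L A B" using B(3) by (simp add: coherent_EPPA_witness_def EPPA_witness_def)
    then show ?thesis using class_contains_faithful[OF U K A B(1,2)] B(3) by blast
  qed
  then show ?thesis using witness unfolding coherent_EPPA_class_def by blast
qed

end
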